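(* Quantum advantage samplers (QASs) exist if and only if non-interactive IV-PoQ exist.
   Context: Conventions: $\lambda$ is the security parameter; PPT = classical probabilistic polynomial-time, QPT = quantum polynomial-time; all algorithms are uniform. For an algorithm $\mathcal{A}$ outputting strings, $\mathcal{A}(1^\lambda)$ also denotes its output distribution; $\mathrm{SD}$ is statistical distance. QAS: a QPT algorithm $\mathcal{A}$ that on input $1^\lambda$ outputs a classical string, such that there exists a polynomial $p$ such that for every PPT algorithm $\mathcal{B}$ (taking $1^\lambda$, outputting a classical string), for all sufficiently large $\lambda$, $\mathrm{SD}(\mathcal{A}(1^\lambda),\mathcal{B}(1^\lambda))>1/p(\lambda)$. Non-interactive IV-PoQ: a pair $(\mathcal{P},\mathcal{V}_2)$ where $\mathcal{P}$ is QPT and on input $1^\lambda$ outputs a classical string $\tau$, and $\mathcal{V}_2$ is unbounded and on input $(1^\lambda,\tau)$ outputs $\top/\bot$, such that there exist $c,s$ with $c(\lambda)-s(\lambda)\ge 1/\mathrm{poly}(\lambda)$ with: for all sufficiently large $\lambda$, $\Pr[\top\gets\mathcal{V}_2(1^\lambda,\tau):\tau\gets\mathcal{P}(1^\lambda)]\ge c(\lambda)$; and for every PPT $\mathcal{P}^*$, for all sufficiently large $\lambda$, $\Pr[\top\gets\mathcal{V}_2(1^\lambda,\tau):\tau\gets\mathcal{P}^*(1^\lambda)]\le s(\lambda)$. *)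

theory Defs
  imports "HOL-Probability.Probability" "HOL-Computational_Algebra.Polynomial"
begin

definition pos_poly :: "(nat \<Rightarrow> real) \<Rightarrow> bool" where
  "pos_poly p \<longleftrightarrow> (\<exists>P :: real poly. \<forall>n. p n = poly P (real n)) \<and> (\<forall>n. p n > 0)"

datatype dir = Lft | Rgt | Stay

text \<open>A machine is a finite transition table: (state, read symbol) maps to
  (new state, written symbol, move). Missing entry = halted (configuration stays).
  Symbols: 0 = blank, 1 = bit 0, 2 = bit 1, 3 = separator, others = work symbols.\<close>
type_synonym tm = "((nat \<times> nat) \<times> (nat \<times> nat \<times> dir)) list"
type_synonym config = "nat \<times> (int \<Rightarrow> nat) \<times> int"

definition move :: "dir \<Rightarrow> int" where
  "move d = (case d of Lft \<Rightarrow> -1 | Rgt \<Rightarrow> 1 | Stay \<Rightarrow> 0)"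

definition tm_step :: "tm \<Rightarrow> config \<Rightarrow> config" where
  "tm_step M c = (case c of (q, tp, h) \<Rightarrow>
     (case map_of M (q, tp h) of
        None \<Rightarrow> (q, tp, h)
      | Some (q', s', d) \<Rightarrow> (q', tp(h := s'), h + move d)))"

definition tm_run :: "tm \<Rightarrow> nat \<Rightarrow> config \<Rightarrow> config" where
  "tm_run M t c = (tm_step M ^^ t) c"

definition tm_init :: "nat list \<Rightarrow> config" where
  "tm_init w = (0, (\<lambda>i. if 0 \<le> i \<and> i < int (length w) then w ! nat i else 0), 0)"

definition tm_output :: "nat \<Rightarrow> config \<Rightarrow> bool list" where
  "tm_output N c = (case c of (q, tp, h) \<Rightarrow>
     map (\<lambda>s. s = 2) (takeWhile (\<lambda>s. s = 1 \<or> s = 2) (map (\<lambda>i. tp (int i)) [0..<N])))"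

definition enc_bit :: "bool \<Rightarrow> nat" where
  "enc_bit b = (if b then 2 else 1)"

definition tm_exec :: "tm \<Rightarrow> nat \<Rightarrow> nat list \<Rightarrow> bool list" where
  "tm_exec M t w = tm_output (length w + t + 1) (tm_run M t (tm_init w))"

text \<open>Polynomial time bound n^k + k (every polynomial is dominated by one of these).\<close>
definition time_bound :: "nat \<Rightarrow> nat \<Rightarrow> nat" where
  "time_bound k n = n ^ k + k"

text \<open>An algorithm is a machine together with its polynomial-time exponent k.\<close>
type_synonym alg = "tm \<times> nat"

definition unary_input :: "nat \<Rightarrow> nat list" where
  "unary_input n = replicate n (enc_bit True)"

definition ppt_dist :: "alg \<Rightarrow> nat \<Rightarrow> bool list pmf" where
  "ppt_dist B n = (let t = time_bound (snd B) n in
     map_pmf (\<lambda>r. tm_exec (fst B) t (unary_input n @ [3] @ map enc_bit r))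
             (pmf_of_set {r :: bool list. length r = t}))"

datatype gate = Had nat | Toff nat nat nat

text \<open>Circuit descriptions: a sequence of unary numbers (1^a 0), namely
  number of qubits, number of measured output qubits, then gates
  (tag 0, i = Hadamard on i; tag 1, a, b, c = Toffoli with controls a b, target c).\<close>
fun unary_nums :: "nat \<Rightarrow> bool list \<Rightarrow> nat list" where
  "unary_nums a [] = []"
| "unary_nums a (True # xs) = unary_nums (Suc a) xs"
| "unary_nums a (False # xs) = a # unary_nums 0 xs"

fun parse_gates :: "nat list \<Rightarrow> gate list" where
  "parse_gates (0 # i # rest) = Had i # parse_gates rest"
| "parse_gates (Suc 0 # a # b # c # rest) = Toff a b c # parse_gates rest"
| "parse_gates _ = []"

definition decode_circuit :: "bool list \<Rightarrow> nat \<times> nat \<times> gate list" where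
  "decode_circuit bs = (case unary_nums 0 bs of
       n # m # rest \<Rightarrow> (n, m, parse_gates rest)
     | _ \<Rightarrow> (0, 0, []))"

text \<open>States of n qubits: real amplitudes indexed by bit lists of length n.
  Invalid gates act as identity.\<close>
fun apply_gate :: "nat \<Rightarrow> gate \<Rightarrow> (bool list \<Rightarrow> real) \<Rightarrow> (bool list \<Rightarrow> real)" where
  "apply_gate n (Had i) \<psi> =
     (if i < n then (\<lambda>x. (\<psi> (x[i := False]) + (if x ! i then -1 else 1) * \<psi> (x[i := True])) / sqrt 2)
      else \<psi>)"
| "apply_gate n (Toff a b c) \<psi> =
     (if a < n \<and> b < n \<and> c < n \<and> distinct [a, b, c]
      then (\<lambda>x. \<psi> (if x ! a \<and> x ! b then x[c := (\<not> x ! c)] else x))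
      else \<psi>)"

definition run_circuit :: "nat \<Rightarrow> gate list \<Rightarrow> (bool list \<Rightarrow> real)" where
  "run_circuit n gs = fold (apply_gate n) gs (\<lambda>x. if x = replicate n False then 1 else 0)"

definition circuit_dist :: "nat \<Rightarrow> nat \<Rightarrow> gate list \<Rightarrow> bool list pmf" where
  "circuit_dist n m gs =
     map_pmf (take m) (embed_pmf (\<lambda>x. if length x = n then (run_circuit n gs x)\<^sup>2 else 0))"

definition qpt_dist :: "alg \<Rightarrow> nat \<Rightarrow> bool list pmf" where
  "qpt_dist A n = (case decode_circuit (tm_exec (fst A) (time_bound (snd A) n) (unary_input n)) of
       (nq, m, gs) \<Rightarrow> circuit_dist nq m gs)"

definition stat_dist :: "'a pmf \<Rightarrow> 'a pmf \<Rightarrow> real" where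
  "stat_dist p q = (SUP A. \<bar>measure_pmf.prob p A - measure_pmf.prob q A\<bar>)"

text \<open>Pr[V(1^n, tau) = accept : tau <- D n] for an (unbounded, randomized) verifier V.\<close>
definition acc_prob :: "(nat \<Rightarrow> bool list \<Rightarrow> bool pmf) \<Rightarrow> (nat \<Rightarrow> bool list pmf) \<Rightarrow> nat \<Rightarrow> real" where
  "acc_prob V D n = pmf (bind_pmf (D n) (V n)) True"

definition is_QAS :: "alg \<Rightarrow> bool" where
  "is_QAS A \<longleftrightarrow> (\<exists>p. pos_poly p \<and>
     (\<forall>B :: alg. \<forall>\<^sub>F n in sequentially. stat_dist (qpt_dist A n) (ppt_dist B n) > 1 / p n))"

definition is_NI_IVPoQ :: "alg \<Rightarrow> (nat \<Rightarrow> bool list \<Rightarrow> bool pmf) \<Rightarrow> bool" where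
  "is_NI_IVPoQ P V2 \<longleftrightarrow> (\<exists>(c :: nat \<Rightarrow> real) (s :: nat \<Rightarrow> real) q.
     pos_poly q \<and> (\<forall>n. c n - s n \<ge> 1 / q n) \<and>
     (\<forall>\<^sub>F n in sequentially. acc_prob V2 (qpt_dist P) n \<ge> c n) \<and>
     (\<forall>B :: alg. \<forall>\<^sub>F n in sequentially. acc_prob V2 (ppt_dist B) n \<le> s n))"

end

theory Submission
  imports Defs
begin

text \<open>
  From an IV-PoQ to a QAS: a randomized test with acceptance gap \<open>c - s\<close> bounds the statistical distance from below.

  From a QAS \<open>A\<close> to an IV-PoQ: the prover sends \<open>N = 2 ^ l\<close> independent samples of \<open>A\<close>, and the unbounded
  verifier accepts \<open>\<tau>\<close> at security parameter \<open>n\<close> iff none of the first \<open>n\<close> PPT algorithms outputs \<open>\<tau>\<close> with more than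
  \<open>K\<close> times the probability of the honest prover. The prover fails with probability at most \<open>n / K\<close>. Conversely,
  let a PPT distribution \<open>Q\<close> pass with high probability. On the accepted set \<open>Q\<close> has density at most
  \<open>K\<close> relative to \<open>A\<^sup>N\<close>; under \<open>A\<^sup>N\<close> the fraction of the coordinates that lie in a test set \<open>T\<close> has variance at most \<open>1 / N\<close>,
  so under \<open>Q\<close> that fraction is still close to \<open>A(T)\<close>. Hence a random coordinate of \<open>Q\<close> is close to \<open>A\<close>,
  which contradicts that \<open>A\<close> is a QAS as soon as \<open>N\<close> is a large enough polynomial.

  The samples are interleaved by \<open>l\<close> rounds of doubling: qubit \<open>i\<close> becomes the two qubits \<open>2 * i\<close> and \<open>2 * i + 1\<close>, so
  that measuring twice as many leading qubits measures both copies. A random coordinate is then selected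
  by \<open>l\<close> coin flips, each of which keeps the even or the odd positions. Both transformations are programmed in a small
  language of stacks, which single-tape machines simulate with polynomial overhead.
\<close>

section \<open>A multi-stack language and its compilation to Turing machines\<close>

text \<open>Soundness is claimed only for \<open>n\<close> large in terms of the adversary, so
  testing the first \<open>n\<close> members of a fixed enumeration reaches every algorithm
  eventually. The price is a union bound over \<open>n\<close> tests, which forces the density
  factor \<open>K\<close> to grow with \<open>n\<close>. That factor multiplies the variance
  \<open>1 / N\<close>, so \<open>N\<close> has to outgrow \<open>K\<close>. If \<open>1 / p\<close>
  is the QAS bound, then \<open>K = 4 * (n + 1) * p\<close>, a tolerated deviation
  \<open>1 / (4 * p)\<close> and \<open>N \<ge> 16 * K * p^2\<close> make all errors add up to
  \<open>1 / p\<close>. Interleaving avoids arithmetic with sizes: the new place of a qubit does not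
  depend on the number of qubits, and the measured qubits remain a prefix, which would fail for two
  circuits put side by side. Likewise a sample can be selected without knowing the common sample
  length. Most of the work lies in uniformity: explicit transition tables have to compute the
  circuit of the new prover and to simulate an arbitrary PPT machine for exactly its time bound,
  since a machine's output is what stands on the tape when that time is over.\<close>

datatype com =
    Skip
  | Push nat nat
  | Pop nat
  | Read nat
  | Seq com com (infixr ";;" 60)
  | Cond nat "nat list" com com
  | Until nat "nat list" com

type_synonym stacks = "nat \<Rightarrow> nat list"

text \<open>The value \<open>0\<close> signals an empty stack; this is unambiguous because
  \<open>wf_com\<close> and \<open>wf_stacks\<close> keep \<open>0\<close> out of the
  stacks.\<close>

definition peek :: "stacks \<Rightarrow> nat \<Rightarrow> nat" where
  "peek s r = (case s r of [] \<Rightarrow> 0 | a # _ \<Rightarrow> a)"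

definition read_sym :: "nat \<Rightarrow> nat" where
  "read_sym a = (if a = 0 then 3 else a)"

text \<open>
  Stack \<open>0\<close> is the input pointer: its height is the number of input symbols read so far. The blank
  behind the input is read as the separator \<open>3\<close>, which lets one loop parse both \<open>1^n\<close> and \<open>1^n 3 r\<close>.
  The input never has to be read to its end; this matters because the random tape
  of a PPT machine is as long as its running time.
\<close>

inductive exec :: "(nat \<Rightarrow> nat) \<Rightarrow> com \<Rightarrow> stacks \<Rightarrow> nat \<Rightarrow> stacks \<Rightarrow> bool" for inp where
  Skip: "exec inp Skip s 1 s"
| Push: "exec inp (Push r a) s 1 (s(r := a # s r))"
| Pop: "exec inp (Pop r) s 1 (s(r := tl (s r)))"
| Read: "exec inp (Read r) s 2 (s(0 := 1 # s 0, r := read_sym (inp (length (s 0))) # (s(0 := 1 # s 0)) r))"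
| Seq: "exec inp c1 s t1 s1 \<Longrightarrow> exec inp c2 s1 t2 s2 \<Longrightarrow> exec inp (c1 ;; c2) s (t1 + t2 + 1) s2"
| Cond: "exec inp (if peek s r \<in> set A then c1 else c2) s t s' \<Longrightarrow> exec inp (Cond r A c1 c2) s (t + 1) s'"
| Until_stop: "peek s r \<in> set A \<Longrightarrow> exec inp (Until r A c) s 1 s"
| Until_loop: "peek s r \<notin> set A \<Longrightarrow> exec inp c s t1 s1 \<Longrightarrow> exec inp (Until r A c) s1 t2 s2
    \<Longrightarrow> exec inp (Until r A c) s (t1 + t2 + 1) s2"

text \<open>Time thus bounds heights, and heights bound the distance that the head of the compiled
  machine travels. \<open>Read\<close> is charged \<open>2\<close> because it pushes twice, possibly
  onto the same stack.\<close>

lemma exec_length: "exec inp c s t s' \<Longrightarrow> length (s' r) \<le> length (s r) + t"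
proof (induction arbitrary: r rule: exec.induct)
  case (Until_loop s r A c t1 s1 t2 s2 ra)
  have "length (s2 ra) \<le> length (s1 ra) + t2" "length (s1 ra) \<le> length (s ra) + t1"
    using Until_loop by auto
  then show ?case by simp
next
  case (Seq c1 s t1 s1 c2 t2 s2 ra)
  have "length (s2 ra) \<le> length (s1 ra) + t2" "length (s1 ra) \<le> length (s ra) + t1"
    using Seq by auto
  then show ?case by simp
next
  case (Cond s r A c1 c2 t s' ra)
  then show ?case by (auto simp: le_Suc_eq)
qed auto

fun wf_com :: "nat \<Rightarrow> nat \<Rightarrow> com \<Rightarrow> bool" where
  "wf_com K S Skip = True"
| "wf_com K S (Push r a) = (r < K \<and> 0 < a \<and> a < S)"
| "wf_com K S (Pop r) = (r < K)"
| "wf_com K S (Read r) = (r < K)"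
| "wf_com K S (c1 ;; c2) = (wf_com K S c1 \<and> wf_com K S c2)"
| "wf_com K S (Cond r A c1 c2) = (r < K \<and> wf_com K S c1 \<and> wf_com K S c2)"
| "wf_com K S (Until r A c) = (r < K \<and> wf_com K S c)"

definition wf_stacks :: "nat \<Rightarrow> stacks \<Rightarrow> bool" where
  "wf_stacks S s \<longleftrightarrow> (\<forall>r. \<forall>x \<in> set (s r). 0 < x \<and> x < S)"

text \<open>
  A tape cell holds an input symbol and one symbol per stack, \<open>0\<close> if the stack ends below it. Stacks grow to the
  right from cell \<open>0\<close>; cell \<open>-1\<close> carries the marker to which the head returns after every instruction. The control state is
  the list of commands that remain to be executed. Finally stack \<open>1\<close> is written out as raw symbols.
\<close>

datatype cell = Mark | Cell nat "nat list"
datatype phase = Go | Scan | Back | Return | Final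
datatype mstate = Start | Start2 | Done | State "com list" phase

text \<open>Through \<open>to_nat\<close>, control states and cells become the numbers that a
  \<open>tm\<close> uses. Countability of \<open>dir\<close> serves another end as well: it makes
  \<open>alg\<close> countable, so that a verifier can enumerate all PPT algorithms.\<close>

instance com :: countable by countable_datatype
instance cell :: countable by countable_datatype
instance phase :: countable by countable_datatype
instance mstate :: countable by countable_datatype
instance dir :: countable by countable_datatype

fun com_reg :: "com \<Rightarrow> nat" where
  "com_reg (Push r a) = r"
| "com_reg (Pop r) = r"
| "com_reg (Cond r A c1 c2) = r"
| "com_reg (Until r A c) = r"
| "com_reg _ = 0"

fun cell_peek :: "nat \<Rightarrow> cell \<Rightarrow> nat" where
  "cell_peek r Mark = 0"
| "cell_peek r (Cell a l) = l ! r"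

fun cell_clear :: "nat \<Rightarrow> cell \<Rightarrow> cell" where
  "cell_clear r Mark = Mark"
| "cell_clear r (Cell a l) = Cell a (l[r := 0])"

fun trans :: "nat \<Rightarrow> com \<Rightarrow> mstate \<Rightarrow> cell \<Rightarrow> (mstate \<times> cell \<times> dir) option" where
  "trans K p Start c = Some (Start2, c, Lft)"
| "trans K p Start2 c = Some (State [p] Go, Mark, Stay)"
| "trans K p (State k Go) c = Some (case k of
     [] \<Rightarrow> (State [] Final, c, Rgt)
   | x # k' \<Rightarrow> (case x of
       Skip \<Rightarrow> (State k' Go, c, Stay)
     | c1 ;; c2 \<Rightarrow> (State (c1 # c2 # k') Go, c, Stay)
     | _ \<Rightarrow> (State k Scan, c, Rgt)))"
| "trans K p (State (x # k) Scan) (Cell a l) = Some (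
     if l ! com_reg x \<noteq> 0 then (State (x # k) Scan, Cell a l, Rgt)
     else (case x of
       Push r v \<Rightarrow> (State k Return, Cell a (l[r := v]), Lft)
     | Read r \<Rightarrow> (State (Push r (read_sym a) # k) Return, Cell a (l[0 := 1]), Lft)
     | _ \<Rightarrow> (State (x # k) Back, Cell a l, Lft)))"
| "trans K p (State (x # k) Back) c = (case x of
       Pop r \<Rightarrow> Some (State k Return, cell_clear r c, Stay)
     | Cond r A c1 c2 \<Rightarrow> Some (State ((if cell_peek r c \<in> set A then c1 else c2) # k) Return, c, Stay)
     | Until r A d \<Rightarrow> Some (State (if cell_peek r c \<in> set A then k else d # x # k) Return, c, Stay)
     | _ \<Rightarrow> None)"
| "trans K p (State k Return) Mark = Some (State k Go, Mark, Stay)"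
| "trans K p (State k Return) (Cell a l) = Some (State k Return, Cell a l, Lft)"
| "trans K p (State k Final) (Cell a l) = Some (
     if l ! 1 \<noteq> 0 then (State [] Final, Cell (l ! 1) (replicate K 0), Rgt) else (Done, Mark, Stay))"
| "trans K p _ _ = None"

text \<open>Control states are whole continuations, so finiteness of the table is not automatic.
  These are the only continuations met while \<open>c\<close> runs in front of \<open>k\<close>:
  \<open>Until\<close> puts itself back, and \<open>Read\<close> remembers the symbol by turning
  into a \<open>Push\<close>, whence the three extra entries.\<close>

fun conts :: "com \<Rightarrow> com list \<Rightarrow> com list set" where
  "conts (c1 ;; c2) k = {(c1 ;; c2) # k} \<union> conts c1 (c2 # k) \<union> conts c2 k"
| "conts (Cond r A c1 c2) k = {Cond r A c1 c2 # k} \<union> conts c1 k \<union> conts c2 k"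
| "conts (Until r A c) k = {Until r A c # k} \<union> conts c (Until r A c # k)"
| "conts (Read r) k = {Read r # k} \<union> (\<lambda>a. Push r a # k) ` {1, 2, 3}"
| "conts c k = {c # k}"

lemma conts_self: "c # k \<in> conts c k"
  by (cases c) auto

lemma finite_conts: "finite (conts c k)"
  by (induction c arbitrary: k) auto

type_synonym acfg = "mstate \<times> (int \<Rightarrow> cell) \<times> int"

text \<open>Lists have the top of the stack in front, whereas the tape has its bottom at cell
  \<open>0\<close>; hence the reversal.\<close>

definition digit :: "nat list \<Rightarrow> nat \<Rightarrow> nat" where
  "digit l i = (if i < length l then rev l ! i else 0)"

lemma digit_Cons: "digit (v # l) i = (if i = length l then v else digit l i)"
  by (auto simp: digit_def nth_append)

lemma digit_tl: "digit (tl l) i = (if Suc i = length l then 0 else digit l i)"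
  by (cases l) (auto simp: digit_def nth_append)

definition tape_of :: "nat \<Rightarrow> (nat \<Rightarrow> nat) \<Rightarrow> stacks \<Rightarrow> int \<Rightarrow> cell" where
  "tape_of K inp s i = (if i = -1 then Mark else if i < 0 then Cell 0 (replicate K 0)
     else Cell (inp (nat i)) (map (\<lambda>r. digit (s r) (nat i)) [0..<K]))"

text \<open>Stack \<open>0\<close> (input pointer) and stack \<open>1\<close> (output) always exist,
  which is \<open>K2\<close>; \<open>S4\<close> makes room for the symbols \<open>1\<close>,
  \<open>2\<close>, \<open>3\<close> that \<open>Read\<close> can deliver.\<close>

locale stack_compiler =
  fixes K S :: nat and prog :: com
  assumes K2: "2 \<le> K" and S4: "4 \<le> S" and wf_prog: "wf_com K S prog"
begin

definition Q :: "com list set" where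
  "Q = insert [] (conts prog [])"

definition cells :: "cell set" where
  "cells = insert Mark {Cell a l | a l. a \<le> 3 \<and> length l = K \<and> set l \<subseteq> {..<S}}"

definition doms :: "(mstate \<times> cell) set" where
  "doms = ({Start, Start2} \<union> (\<lambda>(k, ph). State k ph) ` (Q \<times> {Go, Scan, Back, Return, Final})) \<times> cells"

text \<open>Cutting \<open>trans\<close> down to the finite set \<open>doms\<close> makes it a
  table. Nothing is lost: the proof of \<open>astep_tape\<close> shows that the pairs looked up
  during a run stay inside \<open>doms\<close>.\<close>

definition delta :: "mstate \<times> cell \<Rightarrow> (mstate \<times> cell \<times> dir) option" where
  "delta x = (if x \<in> doms then trans K prog (fst x) (snd x) else None)"

definition astep :: "acfg \<Rightarrow> acfg" where
  "astep c = (case c of (q, tp, h) \<Rightarrow>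
     (case delta (q, tp h) of
        None \<Rightarrow> (q, tp, h)
      | Some (q', s', d) \<Rightarrow> (q', tp(h := s'), h + move d)))"

text \<open>An upper bound on the number of steps is enough, because the final state
  \<open>Done\<close> has no transition and the configuration then stays.\<close>

definition reach :: "nat \<Rightarrow> acfg \<Rightarrow> acfg \<Rightarrow> bool" where
  "reach B c c' \<longleftrightarrow> (\<exists>n\<le>B. (astep ^^ n) c = c')"

lemma reach_refl: "reach B c c"
  unfolding reach_def by (rule exI[of _ 0]) simp

lemma reach_mono: "reach B c c' \<Longrightarrow> B \<le> B' \<Longrightarrow> reach B' c c'"
  unfolding reach_def using le_trans by blast

lemma reach_trans: "reach a c c1 \<Longrightarrow> reach b c1 c2 \<Longrightarrow> reach (a + b) c c2"
  unfolding reach_def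
proof (elim exE conjE)
  fix n m assume "n \<le> a" "(astep ^^ n) c = c1" "m \<le> b" "(astep ^^ m) c1 = c2"
  then show "\<exists>n\<le>a + b. (astep ^^ n) c = c2"
    by (intro exI[of _ "m + n"]) (auto simp: funpow_add)
qed

lemma reach_step: "astep c = c1 \<Longrightarrow> reach b c1 c2 \<Longrightarrow> reach (Suc b) c c2"
  using reach_trans[of 1 c c1 b c2] by (force simp: reach_def)

lemma finite_doms: "finite doms"
proof -
  have "{Cell a l | a l. a \<le> 3 \<and> length l = K \<and> set l \<subseteq> {..<S}}
      = (\<lambda>(a, l). Cell a l) ` ({..3} \<times> {l. set l \<subseteq> {..<S} \<and> length l = K})"
    by auto
  moreover have "finite {l :: nat list. set l \<subseteq> {..<S} \<and> length l = K}"
    by (rule finite_lists_length_eq) simp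
  ultimately have "finite cells" unfolding cells_def by simp
  then show ?thesis unfolding doms_def Q_def by (simp add: finite_conts)
qed

definition good :: "(nat \<Rightarrow> nat) \<Rightarrow> stacks \<Rightarrow> bool" where
  "good inp s \<longleftrightarrow> (\<forall>i. inp i \<le> 3) \<and> wf_stacks S s"

lemma digit_less: "wf_stacks S s \<Longrightarrow> digit (s r) i < S"
  using S4 unfolding wf_stacks_def digit_def
  by (auto simp: rev_nth) (metis nth_mem diff_less length_greater_0_conv less_nat_zero_code list.size(3) zero_less_Suc)

lemma digit_zero: "wf_stacks S s \<Longrightarrow> digit (s r) i = 0 \<longleftrightarrow> length (s r) \<le> i"
  unfolding wf_stacks_def digit_def
  by (metis length_rev less_irrefl not_le nth_mem set_rev)

lemma tape_in_cells: "good inp s \<Longrightarrow> tape_of K inp s i \<in> cells"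
  using S4 digit_less unfolding good_def cells_def tape_of_def by auto

lemma astep_tape:
  assumes "good inp s" "k \<in> Q" "trans K prog (State k ph) (tape_of K inp s h) = Some (q', c', d)"
  shows "astep (State k ph, tape_of K inp s, h) = (q', (tape_of K inp s)(h := c'), h + move d)"
proof -
  have "(State k ph, tape_of K inp s h) \<in> doms"
    unfolding doms_def using assms tape_in_cells by (cases ph) auto
  then show ?thesis using assms(3) by (simp add: astep_def delta_def)
qed

lemma reach_compose: "reach b c1 c2 \<Longrightarrow> reach a c c1 \<Longrightarrow> a + b \<le> B \<Longrightarrow> reach B c c2"
  using reach_trans reach_mono by blast

lemma tape_nonneg: "tape_of K inp s (int i) = Cell (inp i) (map (\<lambda>r. digit (s r) i) [0..<K])"
  by (simp add: tape_of_def)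

text \<open>The symbol of a stack is nonzero exactly below its height (\<open>digit_zero\<close>),
  so the scan halts on the first free cell of that stack.\<close>

lemma scan_right:
  assumes "good inp s" "x # k \<in> Q" "com_reg x < K"
  shows "j \<le> length (s (com_reg x)) \<Longrightarrow>
    reach (length (s (com_reg x)) - j) (State (x # k) Scan, tape_of K inp s, int j)
      (State (x # k) Scan, tape_of K inp s, int (length (s (com_reg x))))"
proof (induction "length (s (com_reg x)) - j" arbitrary: j)
  case 0
  then show ?case by (simp add: reach_refl)
next
  case (Suc d)
  have nz: "digit (s (com_reg x)) j \<noteq> 0"
    using assms(1) Suc(2) digit_zero[of s "com_reg x" j] unfolding good_def by simp
  have "astep (State (x # k) Scan, tape_of K inp s, int j) = (State (x # k) Scan, tape_of K inp s, int (Suc j))"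
    using nz assms by (subst astep_tape) (auto simp: tape_nonneg move_def)
  moreover have "reach (length (s (com_reg x)) - Suc j) (State (x # k) Scan, tape_of K inp s, int (Suc j))
      (State (x # k) Scan, tape_of K inp s, int (length (s (com_reg x))))"
    by (rule Suc(1)) (use Suc in auto)
  ultimately have "reach (Suc (length (s (com_reg x)) - Suc j)) (State (x # k) Scan, tape_of K inp s, int j)
      (State (x # k) Scan, tape_of K inp s, int (length (s (com_reg x))))"
    by (rule reach_step)
  then show ?case by (rule reach_mono) (use Suc(2) in auto)
qed

lemma return_home:
  assumes "good inp s" "k \<in> Q"
  shows "reach (i + 1) (State k Return, tape_of K inp s, int i - 1) (State k Go, tape_of K inp s, -1)"
proof (induction i)
  case 0
  have "astep (State k Return, tape_of K inp s, -1) = (State k Go, tape_of K inp s, -1)"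
    using assms by (subst astep_tape) (auto simp: tape_of_def move_def)
  then show ?case using reach_step[OF _ reach_refl] by simp
next
  case (Suc i)
  have "astep (State k Return, tape_of K inp s, int i) = (State k Return, tape_of K inp s, int i - 1)"
    using assms by (subst astep_tape) (auto simp: tape_nonneg move_def)
  from reach_step[OF this Suc] show ?case by simp
qed

lemma tape_push:
  assumes "r < K"
  shows "(tape_of K inp s)(int (length (s r)) := Cell (inp (length (s r)))
      ((map (\<lambda>q. digit (s q) (length (s r))) [0..<K])[r := v])) = tape_of K inp (s(r := v # s r))"
  using assms by (auto simp: tape_of_def digit_Cons fun_eq_iff nth_list_update intro!: nth_equalityI)

text \<open>If the stack is empty, the head stands on the marker in cell \<open>-1\<close>, which
  \<open>cell_clear\<close> leaves alone; this agrees with \<open>tl [] = []\<close>. In the same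
  way \<open>tape_peek\<close> yields \<open>0\<close> there.\<close>

lemma tape_pop:
  assumes "r < K"
  shows "(tape_of K inp s)(int (length (s r)) - 1 := cell_clear r (tape_of K inp s (int (length (s r)) - 1)))
    = tape_of K inp (s(r := tl (s r)))"
proof (cases "s r")
  case Nil
  then show ?thesis by (auto simp: tape_of_def fun_eq_iff intro!: nth_equalityI)
next
  case (Cons a l)
  then show ?thesis using assms digit_tl[of "s r"]
    by (auto simp: tape_of_def fun_eq_iff nth_list_update intro!: nth_equalityI)
qed

lemma tape_peek:
  assumes "good inp s" "r < K"
  shows "cell_peek r (tape_of K inp s (int (length (s r)) - 1)) = peek s r"
  using assms by (cases "s r") (auto simp: tape_of_def peek_def digit_def nth_append)

lemma go_scan:
  assumes "good inp s" "x # k \<in> Q" "com_reg x < K"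
    and x: "x \<noteq> Skip" "\<forall>a b. x \<noteq> a ;; b"
  shows "reach (length (s (com_reg x)) + 1) (State (x # k) Go, tape_of K inp s, -1)
      (State (x # k) Scan, tape_of K inp s, int (length (s (com_reg x))))"
proof -
  have "trans K prog (State (x # k) Go) (tape_of K inp s (-1)) = Some (State (x # k) Scan, tape_of K inp s (-1), Rgt)"
    using x by (cases x) simp_all
  from astep_tape[OF assms(1,2) this]
  have "astep (State (x # k) Go, tape_of K inp s, -1) = (State (x # k) Scan, tape_of K inp s, int 0)"
    by (simp add: move_def)
  from reach_step[OF this scan_right[OF assms(1-3), of 0]] show ?thesis by simp
qed

lemma go_back:
  assumes "good inp s" "x # k \<in> Q" "com_reg x < K"
    and x: "(\<exists>r. x = Pop r) \<or> (\<exists>r A a b. x = Cond r A a b) \<or> (\<exists>r A a. x = Until r A a)"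
  shows "reach (length (s (com_reg x)) + 2) (State (x # k) Go, tape_of K inp s, -1)
      (State (x # k) Back, tape_of K inp s, int (length (s (com_reg x))) - 1)"
proof -
  let ?l = "int (length (s (com_reg x)))"
  have z: "digit (s (com_reg x)) (length (s (com_reg x))) = 0"
    by (simp add: digit_def)
  have "trans K prog (State (x # k) Scan) (tape_of K inp s ?l) = Some (State (x # k) Back, tape_of K inp s ?l, Lft)"
    using assms(3) x z by (auto simp: tape_nonneg)
  from astep_tape[OF assms(1,2) this]
  have "astep (State (x # k) Scan, tape_of K inp s, ?l) = (State (x # k) Back, tape_of K inp s, ?l - 1)"
    by (simp add: move_def)
  from reach_trans[OF go_scan[OF assms(1-3)] reach_step[OF this reach_refl[of 0]]]
  show ?thesis using x by auto
qed

lemma good_upd: "good inp s \<Longrightarrow> (\<And>x. x \<in> set l \<Longrightarrow> 0 < x \<and> x < S) \<Longrightarrow> good inp (s(r := l))"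
  by (auto simp: good_def wf_stacks_def)

lemma good_pop: "good inp s \<Longrightarrow> good inp (s(r := tl (s r)))"
  unfolding good_def wf_stacks_def by (metis fun_upd_apply list.set_sel(2) tl_Nil)

lemma good_push: "good inp s \<Longrightarrow> 0 < a \<Longrightarrow> a < S \<Longrightarrow> good inp (s(r := a # s r))"
  by (rule good_upd) (auto simp: good_def wf_stacks_def)

lemma read_sym_bounds: "good inp s \<Longrightarrow> read_sym (inp i) \<in> {1, 2, 3}"
proof -
  assume "good inp s"
  then have "inp i \<le> 3" by (simp add: good_def)
  then show ?thesis unfolding read_sym_def by auto
qed

lemma run_push:
  assumes g: "good inp s" and Q: "Push r a # k \<in> Q" "k \<in> Q" and wf: "r < K" "0 < a" "a < S"
  shows "reach (2 * length (s r) + 3) (State (Push r a # k) Go, tape_of K inp s, -1)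
    (State k Go, tape_of K inp (s(r := a # s r)), -1)"
proof -
  let ?l = "length (s r)" and ?s = "s(r := a # s r)"
  have z: "digit (s r) ?l = 0" by (simp add: digit_def)
  have "astep (State (Push r a # k) Scan, tape_of K inp s, int ?l) = (State k Return, tape_of K inp ?s, int ?l - 1)"
    using assms z by (subst astep_tape) (auto simp: tape_nonneg move_def tape_push)
  from reach_step[OF this return_home] have "reach (?l + 2)
      (State (Push r a # k) Scan, tape_of K inp s, int ?l) (State k Go, tape_of K inp ?s, -1)"
    using Q good_push[OF g wf(2,3)] by simp
  moreover have "reach (?l + 1) (State (Push r a # k) Go, tape_of K inp s, -1)
      (State (Push r a # k) Scan, tape_of K inp s, int ?l)"
    using go_scan[OF g Q(1)] wf by simp
  ultimately show ?thesis by (rule reach_compose) simp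
qed

text \<open>The height of stack \<open>0\<close> is the position of the next input symbol, so the
  scan along stack \<open>0\<close> ends on the very cell that holds it. One push advances the
  pointer; the symbol travels in the control state until the \<open>Push\<close> that
  follows.\<close>

lemma run_read:
  assumes g: "good inp s" and Q: "Read r # k \<in> Q" "\<And>a. a \<in> {1, 2, 3} \<Longrightarrow> Push r a # k \<in> Q"
  shows "reach (2 * length (s 0) + 3) (State (Read r # k) Go, tape_of K inp s, -1)
    (State (Push r (read_sym (inp (length (s 0)))) # k) Go, tape_of K inp (s(0 := 1 # s 0)), -1)"
proof -
  let ?l = "length (s 0)" and ?s = "s(0 := 1 # s 0)" and ?k = "Push r (read_sym (inp (length (s 0)))) # k"
  have z: "digit (s 0) ?l = 0" by (simp add: digit_def)
  have Q': "?k \<in> Q" using Q(2) read_sym_bounds[OF g] by blast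
  have K0: "0 < K" using K2 by simp
  have "astep (State (Read r # k) Scan, tape_of K inp s, int ?l) = (State ?k Return, tape_of K inp ?s, int ?l - 1)"
    using assms z K0 tape_push[OF K0, of inp s 1] by (subst astep_tape) (auto simp: tape_nonneg move_def)
  from reach_step[OF this return_home] have "reach (?l + 2)
      (State (Read r # k) Scan, tape_of K inp s, int ?l) (State ?k Go, tape_of K inp ?s, -1)"
    using Q' good_push[OF g] S4 by simp
  moreover have "reach (?l + 1) (State (Read r # k) Go, tape_of K inp s, -1)
      (State (Read r # k) Scan, tape_of K inp s, int ?l)"
    using go_scan[OF g Q(1)] K0 by simp
  ultimately show ?thesis by (rule reach_compose) simp
qed

lemma run_pop:
  assumes g: "good inp s" and Q: "Pop r # k \<in> Q" "k \<in> Q" and wf: "r < K"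
  shows "reach (2 * length (s r) + 4) (State (Pop r # k) Go, tape_of K inp s, -1)
    (State k Go, tape_of K inp (s(r := tl (s r))), -1)"
proof -
  let ?l = "length (s r)" and ?s = "s(r := tl (s r))"
  have "astep (State (Pop r # k) Back, tape_of K inp s, int ?l - 1) = (State k Return, tape_of K inp ?s, int ?l - 1)"
    using assms by (subst astep_tape) (auto simp: move_def tape_pop)
  from reach_step[OF this return_home] have "reach (?l + 2)
      (State (Pop r # k) Back, tape_of K inp s, int ?l - 1) (State k Go, tape_of K inp ?s, -1)"
    using Q good_pop[OF g] by simp
  moreover have "reach (?l + 2) (State (Pop r # k) Go, tape_of K inp s, -1)
      (State (Pop r # k) Back, tape_of K inp s, int ?l - 1)"
    using go_back[OF g Q(1)] wf by simp
  ultimately show ?thesis by (rule reach_compose) simp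
qed

lemma run_test:
  assumes g: "good inp s" and Q: "x # k \<in> Q" and wf: "com_reg x < K"
    and x: "(\<exists>r A a b. x = Cond r A a b) \<or> (\<exists>r A a. x = Until r A a)"
    and t: "trans K prog (State (x # k) Back) (tape_of K inp s (int (length (s (com_reg x))) - 1))
        = Some (State k' Return, tape_of K inp s (int (length (s (com_reg x))) - 1), Stay)"
    and k': "k' \<in> Q"
  shows "reach (2 * length (s (com_reg x)) + 4) (State (x # k) Go, tape_of K inp s, -1)
    (State k' Go, tape_of K inp s, -1)"
proof -
  let ?l = "length (s (com_reg x))"
  have "astep (State (x # k) Back, tape_of K inp s, int ?l - 1) = (State k' Return, tape_of K inp s, int ?l - 1)"
    using assms by (subst astep_tape) (auto simp: move_def)
  from reach_trans[OF go_back[OF g Q wf] reach_step[OF this return_home[OF g k']]] x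
  show ?thesis by (auto elim!: reach_mono)
qed

lemma exec_good: "exec inp c s t s' \<Longrightarrow> wf_com K S c \<Longrightarrow> good inp s \<Longrightarrow> good inp s'"
proof (induction rule: exec.induct)
  case (Read r s)
  have "0 < read_sym (inp (length (s 0)))" "read_sym (inp (length (s 0))) < S"
    using read_sym_bounds[OF Read(2), of "length (s 0)"] S4 by auto
  moreover have "good inp (s(0 := 1 # s 0))" using good_push[OF Read(2)] S4 by simp
  ultimately have "good inp (s(0 := 1 # s 0, r := read_sym (inp (length (s 0))) # (s(0 := 1 # s 0)) r))"
    using good_push[where r = r] by blast
  then show ?case .
next
  case (Push r a s)
  then have "good inp (s(r := a # s r))" by (simp add: good_push)
  then show ?case .
next
  case (Pop r s)
  then have "good inp (s(r := tl (s r)))" by (simp add: good_pop)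
  then show ?case .
qed (auto simp: good_push good_pop split: if_splits)

text \<open>\<open>L\<close> bounds every height during the whole run. An instruction costs one trip
  from the marker to a stack top and back, at most \<open>2 * L + 5\<close> steps for each unit of
  time.\<close>

lemma run_exec:
  assumes "exec inp c s t s'" "wf_com K S c" "good inp s" "conts c k \<subseteq> Q" "k \<in> Q"
    and "\<And>r. length (s r) + t \<le> L"
  shows "reach (t * (2 * L + 5)) (State (c # k) Go, tape_of K inp s, -1) (State k Go, tape_of K inp s', -1)"
  using assms
proof (induction arbitrary: k rule: exec.induct)
  case (Skip s)
  have "astep (State (Skip # k) Go, tape_of K inp s, -1) = (State k Go, tape_of K inp s, -1)"
    using Skip.prems(1-4) by (subst astep_tape) (auto simp: move_def)
  from reach_step[OF this reach_refl[of 0]] show ?case by (rule reach_mono) simp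
next
  case (Push r a s)
  have "2 * length (s r) + 3 \<le> 1 * (2 * L + 5)" using Push.prems(5)[of r] by simp
  from reach_mono[OF run_push[OF Push.prems(2)] this, of a k] Push.prems(1,3,4)
  have "reach (1 * (2 * L + 5))
      (State (Push r a # k) Go, tape_of K inp s, -1) (State k Go, tape_of K inp (s(r := a # s r)), -1)"
    by simp
  then show ?case .
next
  case (Pop r s)
  have "2 * length (s r) + 4 \<le> 1 * (2 * L + 5)" using Pop.prems(5)[of r] by simp
  from reach_mono[OF run_pop[OF Pop.prems(2)] this, of k] Pop.prems(1,3,4)
  have "reach (1 * (2 * L + 5))
      (State (Pop r # k) Go, tape_of K inp s, -1) (State k Go, tape_of K inp (s(r := tl (s r))), -1)"
    by simp
  then show ?case .
next
  case (Read r s)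
  let ?s = "s(0 := 1 # s 0)" and ?a = "read_sym (inp (length (s 0)))"
  have L: "length (s 0) + 2 \<le> L" "length (s r) + 2 \<le> L"
    using Read.prems(5)[of 0] Read.prems(5)[of r] by simp_all
  have Q: "Read r # k \<in> Q" "\<And>a. a \<in> {1, 2, 3} \<Longrightarrow> Push r a # k \<in> Q" using Read.prems(3) by auto
  have a: "?a \<in> {1, 2, 3}" using read_sym_bounds[OF Read(2)] .
  then have a': "0 < ?a" "?a < S" using S4 by auto
  have g: "good inp ?s" using good_push[OF Read(2)] S4 by simp
  have "reach ((2 * length (s 0) + 3) + (2 * length (?s r) + 3)) (State (Read r # k) Go, tape_of K inp s, -1)
      (State k Go, tape_of K inp (?s(r := ?a # ?s r)), -1)"
    using Read.prems(1,4) a' by (intro reach_trans[OF run_read[OF Read(2) Q]] run_push[OF g Q(2)[OF a]]) simp_all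
  then show ?case by (rule reach_mono) (use L in auto)
next
  case (Seq c1 s t1 s1 c2 t2 s2)
  have "astep (State ((c1 ;; c2) # k) Go, tape_of K inp s, -1) = (State (c1 # c2 # k) Go, tape_of K inp s, -1)"
    using Seq.prems(1-4) by (subst astep_tape) (auto simp: move_def)
  moreover have "reach (t1 * (2 * L + 5)) (State (c1 # c2 # k) Go, tape_of K inp s, -1) (State (c2 # k) Go, tape_of K inp s1, -1)"
  proof (rule Seq.IH(1))
    show "length (s r) + t1 \<le> L" for r using Seq.prems(5)[of r] by simp
  qed (use Seq.prems(1-4) conts_self[of c2 k] in auto)
  moreover have "reach (t2 * (2 * L + 5)) (State (c2 # k) Go, tape_of K inp s1, -1) (State k Go, tape_of K inp s2, -1)"
  proof (rule Seq.IH(2))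
    show "length (s1 r) + t2 \<le> L" for r using Seq.prems(5)[of r] exec_length[OF Seq.hyps(1), of r] by simp
  qed (use Seq.prems(1-4) exec_good[OF Seq.hyps(1)] in auto)
  ultimately have "reach (Suc (t1 * (2 * L + 5) + t2 * (2 * L + 5))) (State ((c1 ;; c2) # k) Go, tape_of K inp s, -1) (State k Go, tape_of K inp s2, -1)"
    using reach_step reach_trans by blast
  then show ?case by (rule reach_mono) (simp add: algebra_simps)
next
  case (Cond s r A c1 c2 t s')
  let ?c = "if peek s r \<in> set A then c1 else c2"
  have k': "?c # k \<in> Q" using Cond.prems(3) conts_self[of ?c k] by (auto split: if_splits)
  have "reach (2 * length (s r) + 4) (State (Cond r A c1 c2 # k) Go, tape_of K inp s, -1) (State (?c # k) Go, tape_of K inp s, -1)"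
    using run_test[OF Cond.prems(2), of "Cond r A c1 c2" k "?c # k"] Cond.prems(1-4) k' tape_peek[OF Cond.prems(2), of r] by auto
  moreover have "reach (t * (2 * L + 5)) (State (?c # k) Go, tape_of K inp s, -1) (State k Go, tape_of K inp s', -1)"
  proof (rule Cond.IH)
    show "length (s r) + t \<le> L" for r using Cond.prems(5)[of r] by simp
  qed (use Cond.prems(1-4) in auto)
  ultimately have "reach (2 * length (s r) + 4 + t * (2 * L + 5)) (State (Cond r A c1 c2 # k) Go, tape_of K inp s, -1) (State k Go, tape_of K inp s', -1)"
    by (rule reach_trans)
  then show ?case by (rule reach_mono) (use Cond.prems(5)[of r] in \<open>simp add: algebra_simps\<close>)
next
  case (Until_stop s r A c)
  have "reach (2 * length (s r) + 4) (State (Until r A c # k) Go, tape_of K inp s, -1) (State k Go, tape_of K inp s, -1)"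
    using run_test[OF Until_stop.prems(2), of "Until r A c" k k] Until_stop(1) Until_stop.prems(1-4) tape_peek[OF Until_stop.prems(2), of r] by auto
  then show ?case by (rule reach_mono) (use Until_stop.prems(5)[of r] in \<open>simp add: algebra_simps\<close>)
next
  case (Until_loop s r A c t1 s1 t2 s2)
  let ?W = "Until r A c"
  have k': "c # ?W # k \<in> Q" using Until_loop.prems(3) conts_self[of c "?W # k"] by auto
  have "reach (2 * length (s r) + 4) (State (?W # k) Go, tape_of K inp s, -1) (State (c # ?W # k) Go, tape_of K inp s, -1)"
    using run_test[OF Until_loop.prems(2), of ?W k "c # ?W # k"] Until_loop(1) Until_loop.prems(1-4) k' tape_peek[OF Until_loop.prems(2), of r] by auto
  moreover have "reach (t1 * (2 * L + 5)) (State (c # ?W # k) Go, tape_of K inp s, -1) (State (?W # k) Go, tape_of K inp s1, -1)"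
  proof (rule Until_loop.IH(1))
    show "length (s r) + t1 \<le> L" for r using Until_loop.prems(5)[of r] by simp
  qed (use Until_loop.prems(1-4) in auto)
  moreover have "reach (t2 * (2 * L + 5)) (State (?W # k) Go, tape_of K inp s1, -1) (State k Go, tape_of K inp s2, -1)"
  proof (rule Until_loop.IH(2))
    show "length (s1 r) + t2 \<le> L" for r using Until_loop.prems(5)[of r] exec_length[OF Until_loop.hyps(2), of r] by simp
  qed (use Until_loop.prems(1-4) exec_good[OF Until_loop.hyps(2)] in auto)
  ultimately have "reach (2 * length (s r) + 4 + (t1 * (2 * L + 5) + t2 * (2 * L + 5))) (State (?W # k) Go, tape_of K inp s, -1) (State k Go, tape_of K inp s2, -1)"
    using reach_trans by blast
  then show ?case by (rule reach_mono) (use Until_loop.prems(5)[of r] in \<open>simp add: algebra_simps\<close>)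
qed

text \<open>Behind the output the cells may still contain data of other stacks. The
  \<open>Mark\<close> written there is encoded by a number above \<open>3\<close> and therefore ends
  what \<open>tm_output\<close> collects.\<close>

lemma final_phase:
  assumes g: "good inp s"
  shows "\<exists>tp h. reach (length (s 1) + 2) (State [] Go, tape_of K inp s, -1) (Done, tp, h) \<and>
    (\<forall>i < length (s 1). tp (int i) = Cell (rev (s 1) ! i) (replicate K 0)) \<and>
    tp (int (length (s 1))) = Mark"
proof -
  let ?m = "length (s 1)"
  define tp where "tp j i = (if 0 \<le> i \<and> i < int j then Cell (rev (s 1) ! nat i) (replicate K 0)
    else tape_of K inp s i)" for j i
  have Q: "[] \<in> Q" by (simp add: Q_def)
  have start: "astep (State [] Go, tape_of K inp s, -1) = (State [] Final, tp 0, int 0)"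
    using astep_tape[OF g Q, of Go "-1"] by (auto simp: move_def tp_def fun_eq_iff)
  have dom: "(State [] Final, tp j (int j)) \<in> doms" for j
    using tape_in_cells[OF g, of "int j"] Q by (auto simp: doms_def tp_def)
  have cell: "tp j (int j) = Cell (inp j) (map (\<lambda>r. digit (s r) j) [0..<K])" for j
    by (simp add: tp_def tape_nonneg)
  have step: "astep (State [] Final, tp j, int j) = (State [] Final, tp (Suc j), int (Suc j))" if "j < ?m" for j
  proof -
    have d: "digit (s 1) j \<noteq> 0" "digit (s 1) j = rev (s 1) ! j"
      using digit_zero[of s 1 j] g that by (auto simp: good_def digit_def)
    have "(tp j)(int j := Cell (rev (s 1) ! j) (replicate K 0)) = tp (Suc j)"
      using that by (auto simp: tp_def fun_eq_iff)
    then show ?thesis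
      using dom[of j] cell[of j] d K2 by (simp add: astep_def delta_def move_def)
  qed
  have "reach j (State [] Final, tp 0, int 0) (State [] Final, tp j, int j)" if "j \<le> ?m" for j
    using that
  proof (induction j)
    case 0
    show ?case by (rule reach_refl)
  next
    case (Suc j)
    then have "reach j (State [] Final, tp 0, int 0) (State [] Final, tp j, int j)" by simp
    moreover have "reach 1 (State [] Final, tp j, int j) (State [] Final, tp (Suc j), int (Suc j))"
      using reach_step[OF step reach_refl[of 0]] Suc by simp
    ultimately have "reach (j + 1) (State [] Final, tp 0, int 0) (State [] Final, tp (Suc j), int (Suc j))"
      by (rule reach_trans)
    then show ?case by simp
  qed
  then have "reach ?m (State [] Final, tp 0, int 0) (State [] Final, tp ?m, int ?m)" by simp
  moreover have "astep (State [] Final, tp ?m, int ?m) = (Done, (tp ?m)(int ?m := Mark), int ?m)"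
    using dom[of ?m] cell[of ?m] K2 by (simp add: astep_def delta_def move_def digit_def)
  ultimately have "reach (?m + Suc 0) (State [] Final, tp 0, int 0) (Done, (tp ?m)(int ?m := Mark), int ?m)"
    using reach_step[OF _ reach_refl[of 0]] reach_trans by blast
  from reach_step[OF start this]
  have "reach (?m + 2) (State [] Go, tape_of K inp s, -1) (Done, (tp ?m)(int ?m := Mark), int ?m)"
    by simp
  then show ?thesis
    by (intro exI[of _ "(tp ?m)(int ?m := Mark)"] exI[of _ "int ?m"] conjI) (auto simp: tp_def)
qed

text \<open>\<open>tm_init\<close> starts in state \<open>0\<close>, so \<open>Start\<close> has to
  become \<open>0\<close>.\<close>

definition enc_state :: "mstate \<Rightarrow> nat" where
  "enc_state q = (if q = Start then 0 else Suc (to_nat q))"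

text \<open>A cell without stack symbols must be the raw symbol itself: this lets the machine start
  on an unprepared input tape and leave its output as plain bits. All other cells are shifted past
  the raw symbols \<open>0\<close> to \<open>3\<close>.\<close>

definition enc_cell :: "cell \<Rightarrow> nat" where
  "enc_cell c = (case c of Mark \<Rightarrow> 4 + to_nat c
     | Cell a l \<Rightarrow> if a \<le> 3 \<and> l = replicate K 0 then a else 4 + to_nat c)"

lemma inj_enc_state: "inj enc_state"
  by (auto simp: inj_def enc_state_def)

lemma inj_enc_cell: "inj enc_cell"
  by (auto simp: inj_def enc_cell_def split: cell.splits if_splits)

definition enc_cfg :: "acfg \<Rightarrow> config" where
  "enc_cfg c = (case c of (q, tp, h) \<Rightarrow> (enc_state q, enc_cell \<circ> tp, h))"

lemma ex_table:
  "\<exists>M. \<forall>q c. map_of M (enc_state q, enc_cell c)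
     = map_option (\<lambda>(q', c', d). (enc_state q', enc_cell c', d)) (delta (q, c))"
proof -
  have "finite (dom delta)"
    by (rule finite_subset[OF _ finite_doms]) (auto simp: delta_def split: if_splits)
  then obtain xs where xs: "set xs = dom delta" using finite_list by blast
  define M where "M = map (\<lambda>(q, c). ((enc_state q, enc_cell c),
    (\<lambda>(q', c', d). (enc_state q', enc_cell c', d)) (the (delta (q, c))))) xs"
  have "map_of M (enc_state q, enc_cell c)
     = map_option (\<lambda>(q', c', d). (enc_state q', enc_cell c', d)) (delta (q, c))" for q c
  proof -
    have "map_of (map (\<lambda>(q, c). ((enc_state q, enc_cell c),
        (\<lambda>(q', c', d). (enc_state q', enc_cell c', d)) (the (delta (q, c))))) ys) (enc_state q, enc_cell c)
      = (if (q, c) \<in> set ys then Some ((\<lambda>(q', c', d). (enc_state q', enc_cell c', d)) (the (delta (q, c)))) else None)" for ys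
      by (induction ys) (auto simp: inj_eq[OF inj_enc_state] inj_eq[OF inj_enc_cell])
    from this[of xs] show ?thesis unfolding M_def xs by (cases "delta (q, c)") (auto simp: domIff)
  qed
  then show ?thesis by blast
qed

text \<open>The stacks start empty, so \<open>run_exec\<close> applies with \<open>L = t\<close>.
  Two steps plant the marker, and writing out stack \<open>1\<close>, of height at most
  \<open>t\<close>, takes at most \<open>t + 2\<close> more.\<close>

lemma compile_correct:
  "\<exists>M. \<forall>w t s' T. set w \<subseteq> {1, 2, 3} \<longrightarrow>
     exec (\<lambda>i. if i < length w then w ! i else 0) prog (\<lambda>_. []) t s' \<longrightarrow>
     set (s' 1) \<subseteq> {1, 2} \<longrightarrow> t * (2 * t + 5) + t + 4 \<le> T \<longrightarrow>
     tm_exec M T w = map (\<lambda>s. s = 2) (rev (s' 1))"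
proof -
  obtain M where M: "\<And>q c. map_of M (enc_state q, enc_cell c)
     = map_option (\<lambda>(q', c', d). (enc_state q', enc_cell c', d)) (delta (q, c))"
    using ex_table by blast
  have step: "tm_step M (enc_cfg c) = enc_cfg (astep c)" for c
    by (cases c) (auto simp: tm_step_def enc_cfg_def astep_def M fun_eq_iff split: option.split)
  have run: "(tm_step M ^^ n) (enc_cfg c) = enc_cfg ((astep ^^ n) c)" for n c
    by (induction n) (auto simp: step)
  have stuck: "(astep ^^ n) (Done, tp, h) = (Done, tp, h)" for n tp h
    by (induction n) (auto simp: astep_def delta_def doms_def)
  have "tm_exec M T w = map (\<lambda>s. s = 2) (rev (s' 1))"
    if w: "set w \<subseteq> {1, 2, 3}" and ex: "exec (\<lambda>i. if i < length w then w ! i else 0) prog (\<lambda>_. []) t s'"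
      and out: "set (s' 1) \<subseteq> {1, 2}" and T: "t * (2 * t + 5) + t + 4 \<le> T" for w t s' T
  proof -
    let ?inp = "\<lambda>i. if i < length w then w ! i else 0" and ?m = "length (s' 1)"
    have inp: "?inp i \<le> 3" for i
    proof (cases "i < length w")
      case True
      then have "w ! i \<in> {1, 2, 3}" using w nth_mem by blast
      then show ?thesis by auto
    qed simp
    define tp0 where "tp0 i = Cell (if 0 \<le> i then ?inp (nat i) else 0) (replicate K 0)" for i :: int
    have cells0: "tp0 i \<in> cells" for i
      using inp S4 unfolding tp0_def cells_def by auto
    have init: "tm_init w = enc_cfg (Start, tp0, 0)"
      using inp by (auto simp: tm_init_def enc_cfg_def enc_state_def tp0_def enc_cell_def fun_eq_iff)
    have g: "good ?inp (\<lambda>_. [])" using inp by (auto simp: good_def wf_stacks_def)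
    have t0: "tp0(-1 := Mark) = tape_of K ?inp (\<lambda>_. [])"
      by (auto simp: tp0_def tape_of_def digit_def fun_eq_iff intro!: nth_equalityI)
    have s1: "astep (Start, tp0, 0) = (Start2, tp0, -1)"
      using cells0[of 0] by (auto simp: astep_def delta_def doms_def move_def)
    have s2: "astep (Start2, tp0, -1) = (State [prog] Go, tape_of K ?inp (\<lambda>_. []), -1)"
      using cells0[of "-1"] t0 by (auto simp: astep_def delta_def doms_def move_def)
    have "reach (t * (2 * t + 5)) (State [prog] Go, tape_of K ?inp (\<lambda>_. []), -1) (State [] Go, tape_of K ?inp s', -1)"
      by (rule run_exec[OF ex wf_prog g]) (auto simp: Q_def)
    then have r: "reach (t * (2 * t + 5) + 2) (Start, tp0, 0) (State [] Go, tape_of K ?inp s', -1)"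
      using reach_step[OF s1 reach_step[OF s2]] by auto
    obtain tp h where fin: "reach (?m + 2) (State [] Go, tape_of K ?inp s', -1) (Done, tp, h)"
      and tp: "\<And>i. i < ?m \<Longrightarrow> tp (int i) = Cell (rev (s' 1) ! i) (replicate K 0)" "tp (int ?m) = Mark"
      using final_phase[OF exec_good[OF ex wf_prog g]] by blast
    have mt: "?m \<le> t" using exec_length[OF ex, of 1] by simp
    have "reach T (Start, tp0, 0) (Done, tp, h)"
      by (rule reach_compose[OF fin r]) (use mt T in simp)
    then obtain n where n: "n \<le> T" "(astep ^^ n) (Start, tp0, 0) = (Done, tp, h)"
      by (auto simp: reach_def)
    have "(astep ^^ T) (Start, tp0, 0) = (astep ^^ (T - n)) ((astep ^^ n) (Start, tp0, 0))"
      using n(1) by (metis comp_apply funpow_add le_add_diff_inverse2)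
    then have fin': "tm_run M T (tm_init w) = (enc_state Done, enc_cell \<circ> tp, h)"
      by (simp add: tm_run_def init run n stuck) (simp add: enc_cfg_def)
    let ?xs = "map (\<lambda>i. enc_cell (tp (int i))) [0..<length w + T + 1]"
    have bits: "enc_cell (tp (int i)) = rev (s' 1) ! i" "rev (s' 1) ! i \<in> {1, 2}" if "i < ?m" for i
    proof -
      show "rev (s' 1) ! i \<in> {1, 2}" using out that nth_mem[of i "rev (s' 1)"] by auto
      then show "enc_cell (tp (int i)) = rev (s' 1) ! i" using tp(1)[OF that] by (auto simp: enc_cell_def)
    qed
    have "takeWhile (\<lambda>s. s = 1 \<or> s = 2) ?xs = take ?m ?xs"
    proof (rule takeWhile_eq_take_P_nth)
      show "?xs ! i = 1 \<or> ?xs ! i = 2" if "i < ?m" "i < length ?xs" for i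
        using bits[OF that(1)] that(2) by (auto simp del: upt_Suc)
      show "\<not> (?xs ! ?m = 1 \<or> ?xs ! ?m = 2)" if "?m < length ?xs"
        using that tp(2) by (auto simp: enc_cell_def simp del: upt_Suc)
    qed
    also have "take ?m ?xs = rev (s' 1)"
      using bits mt T by (intro nth_equalityI) (auto simp del: upt_Suc)
    finally show ?thesis unfolding tm_exec_def fin' tm_output_def by simp
  qed
  then show ?thesis by blast
qed

end

section \<open>Timed execution and unary arithmetic\<close>

definition runs :: "(nat \<Rightarrow> nat) \<Rightarrow> com \<Rightarrow> stacks \<Rightarrow> nat \<Rightarrow> stacks \<Rightarrow> bool" where
  "runs inp c s T s' \<longleftrightarrow> (\<exists>t\<le>T. exec inp c s t s')"

lemma runs_mono: "runs inp c s T s' \<Longrightarrow> T \<le> T' \<Longrightarrow> runs inp c s T' s'"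
  unfolding runs_def using le_trans by blast

lemma runs_weaken: "runs inp c s T s1 \<Longrightarrow> T \<le> T' \<Longrightarrow> s1 = s' \<Longrightarrow> runs inp c s T' s'"
  using runs_mono by blast

lemma runs_length: "runs inp c s T s' \<Longrightarrow> length (s' r) \<le> length (s r) + T"
  unfolding runs_def using exec_length by (metis add_le_cancel_left le_trans)

lemma runs_Seq:
  assumes "runs inp c1 s T1 s1" "runs inp c2 s1 T2 s2"
  shows "runs inp (c1 ;; c2) s (T1 + T2 + 1) s2"
proof -
  from assms obtain t1 t2 where "t1 \<le> T1" "exec inp c1 s t1 s1" "t2 \<le> T2" "exec inp c2 s1 t2 s2"
    unfolding runs_def by blast
  then have "t1 + t2 + 1 \<le> T1 + T2 + 1" "exec inp (c1 ;; c2) s (t1 + t2 + 1) s2"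
    by (simp, blast intro: exec.Seq)
  then show ?thesis unfolding runs_def by blast
qed

lemma runs_Cond:
  assumes "runs inp (if peek s r \<in> set A then c1 else c2) s T s'"
  shows "runs inp (Cond r A c1 c2) s (T + 1) s'"
proof -
  from assms obtain t where "t \<le> T" "exec inp (if peek s r \<in> set A then c1 else c2) s t s'"
    unfolding runs_def by blast
  then show ?thesis unfolding runs_def by (intro exI[of _ "t + 1"] conjI exec.Cond) auto
qed

lemma runs_Cond_True: "peek s r \<in> set A \<Longrightarrow> runs inp c1 s T s' \<Longrightarrow> runs inp (Cond r A c1 c2) s (T + 1) s'"
  and runs_Cond_False: "peek s r \<notin> set A \<Longrightarrow> runs inp c2 s T s' \<Longrightarrow> runs inp (Cond r A c1 c2) s (T + 1) s'"
  using runs_Cond[of inp s r A c1 c2 T s'] by simp_all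

lemma runs_Until_stop: "peek s r \<in> set A \<Longrightarrow> runs inp (Until r A c) s 1 s"
  unfolding runs_def by (intro exI[of _ 1] conjI exec.Until_stop) auto

lemma runs_Until_loop:
  assumes "peek s r \<notin> set A" "runs inp c s T1 s1" "runs inp (Until r A c) s1 T2 s2"
  shows "runs inp (Until r A c) s (T1 + T2 + 1) s2"
proof -
  from assms obtain t1 t2 where "t1 \<le> T1" "exec inp c s t1 s1" "t2 \<le> T2" "exec inp (Until r A c) s1 t2 s2"
    unfolding runs_def by blast
  then have "t1 + t2 + 1 \<le> T1 + T2 + 1" "exec inp (Until r A c) s (t1 + t2 + 1) s2"
    using assms(1) by (simp, blast intro: exec.Until_loop)
  then show ?thesis unfolding runs_def by blast
qed

text \<open>The rule behind most loops below: \<open>I i\<close> is the state at the head of the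
  loop after \<open>i\<close> rounds, given in closed form, so that only one generic round has to be
  executed.\<close>

lemma runs_Until:
  assumes "\<And>i. i < m \<Longrightarrow> peek (I i) r \<notin> set A \<and> runs inp c (I i) B (I (Suc i))"
    and "peek (I m) r \<in> set A"
  shows "runs inp (Until r A c) (I 0) (m * (B + 1) + 1) (I m)"
proof -
  have "runs inp (Until r A c) (I i) ((m - i) * (B + 1) + 1) (I m)" if "i \<le> m" for i
    using that
  proof (induction "m - i" arbitrary: i)
    case 0
    then show ?case using runs_Until_stop[OF assms(2)] by simp
  next
    case (Suc d)
    then have i: "i < m" by simp
    have IH: "runs inp (Until r A c) (I (Suc i)) ((m - Suc i) * (B + 1) + 1) (I m)"
      by (rule Suc(1)) (use Suc in auto)
    have "runs inp (Until r A c) (I i) (B + ((m - Suc i) * (B + 1) + 1) + 1) (I m)"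
      by (rule runs_Until_loop[OF _ _ IH]) (use assms(1)[OF i] in auto)
    moreover have "(m - i) = Suc (m - Suc i)" using i by simp
    ultimately show ?case by (simp add: algebra_simps)
  qed
  from this[of 0] show ?thesis by simp
qed

text \<open>Loop-free fragments have a computable result \<open>sem\<close> and a computable time
  bound \<open>cost\<close>, so they can be verified by rewriting. For a conditional the costs of
  both branches are added, which keeps the bound independent of the state.\<close>

fun straight :: "com \<Rightarrow> bool" where
  "straight (c1 ;; c2) = (straight c1 \<and> straight c2)"
| "straight (Cond r A c1 c2) = (straight c1 \<and> straight c2)"
| "straight (Until r A c) = False"
| "straight _ = True"

fun cost :: "com \<Rightarrow> nat" where
  "cost (c1 ;; c2) = cost c1 + cost c2 + 1"
| "cost (Cond r A c1 c2) = cost c1 + cost c2 + 1"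
| "cost (Read r) = 2"
| "cost _ = 1"

fun sem :: "(nat \<Rightarrow> nat) \<Rightarrow> com \<Rightarrow> stacks \<Rightarrow> stacks" where
  "sem inp (Push r a) s = s(r := a # s r)"
| "sem inp (Pop r) s = s(r := tl (s r))"
| "sem inp (Read r) s = s(0 := 1 # s 0, r := read_sym (inp (length (s 0))) # (s(0 := 1 # s 0)) r)"
| "sem inp (c1 ;; c2) s = sem inp c2 (sem inp c1 s)"
| "sem inp (Cond r A c1 c2) s = (if peek s r \<in> set A then sem inp c1 s else sem inp c2 s)"
| "sem inp _ s = s"

lemma runs_straight: "straight c \<Longrightarrow> runs inp c s (cost c) (sem inp c s)"
proof (induction c arbitrary: s)
  case (Seq c1 c2)
  then have "runs inp c1 s (cost c1) (sem inp c1 s)"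
    "runs inp c2 (sem inp c1 s) (cost c2) (sem inp c2 (sem inp c1 s))" by auto
  from runs_Seq[OF this] show ?case by simp
next
  case (Cond r A c1 c2)
  have "runs inp (if peek s r \<in> set A then c1 else c2) s (cost c1 + cost c2)
      (if peek s r \<in> set A then sem inp c1 s else sem inp c2 s)"
    using Cond by (auto intro: runs_mono[where T = "cost c1"] runs_mono[where T = "cost c2"])
  from runs_Cond[OF this] show ?case by simp
next
  case (Push r a)
  show ?case unfolding sem.simps cost.simps runs_def using exec.Push by blast
next
  case (Pop r)
  show ?case unfolding sem.simps cost.simps runs_def using exec.Pop by blast
next
  case (Read r)
  show ?case unfolding sem.simps cost.simps runs_def using exec.Read by blast
next
  case Skip
  show ?case unfolding sem.simps cost.simps runs_def using exec.Skip by blast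
qed simp

lemma runs_line: "straight c \<Longrightarrow> sem inp c s = s' \<Longrightarrow> cost c \<le> T \<Longrightarrow> runs inp c s T s'"
  using runs_straight runs_mono by blast

primrec switch :: "nat \<Rightarrow> nat list \<Rightarrow> (nat \<Rightarrow> com) \<Rightarrow> com" where
  "switch r [] f = Skip"
| "switch r (a # as) f = Cond r [a] (f a) (switch r as f)"

lemma sem_switch: "sem inp (switch r as f) s = (if peek s r \<in> set as then sem inp (f (peek s r)) s else s)"
  by (induction as) auto

lemma straight_switch: "(\<And>a. a \<in> set as \<Longrightarrow> straight (f a)) \<Longrightarrow> straight (switch r as f)"
  by (induction as) auto

lemma wf_switch: "r < K \<Longrightarrow> (\<And>a. a \<in> set as \<Longrightarrow> wf_com K S (f a)) \<Longrightarrow> wf_com K S (switch r as f)"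
  by (induction as) auto

definition transfer :: "nat \<Rightarrow> nat list \<Rightarrow> nat \<Rightarrow> nat list \<Rightarrow> (nat \<Rightarrow> nat) \<Rightarrow> com" where
  "transfer a stop b as g = Until a stop (switch a as (\<lambda>x. Pop a ;; Push b (g x)))"

lemma cost_switch: "cost (switch a as (\<lambda>x. Pop a ;; Push b (g x))) = 4 * length as + 1"
  by (induction as) auto

text \<open>The loop tests \<open>stop\<close> while its body dispatches on \<open>as\<close>; the
  second assumption says that the two sets are complementary on everything that can occur, including
  the \<open>0\<close> of an empty stack.\<close>

lemma runs_transfer:
  assumes "a \<noteq> b" and "\<And>x. x \<in> insert 0 (set (s a)) \<Longrightarrow> x \<in> set stop \<longleftrightarrow> x \<notin> set as"
    and "0 \<notin> set as"
  shows "runs inp (transfer a stop b as g) s (length (takeWhile (\<lambda>x. x \<in> set as) (s a)) * (4 * length as + 2) + 1)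
    (s(a := dropWhile (\<lambda>x. x \<in> set as) (s a), b := map g (rev (takeWhile (\<lambda>x. x \<in> set as) (s a))) @ s b))"
  using assms(2)
proof (induction "s a" arbitrary: s)
  case Nil
  from Nil(2)[of 0] assms(3) Nil(1)[symmetric] have "peek s a \<in> set stop" "s a = []"
    by (auto simp: peek_def)
  then show ?case using runs_Until_stop[of s a stop] unfolding transfer_def
    by (simp add: fun_upd_idem)
next
  case (Cons x l)
  show ?case
  proof (cases "x \<in> set as")
    case False
    then have "peek s a \<in> set stop" using Cons(2,3) by (metis insertI2 list.set_intros(1) list.simps(5) peek_def)
    from runs_Until_stop[OF this]
    have "runs inp (transfer a stop b as g) s 1 s" unfolding transfer_def .
    moreover have "s = s(a := dropWhile (\<lambda>x. x \<in> set as) (s a),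
      b := map g (rev (takeWhile (\<lambda>x. x \<in> set as) (s a))) @ s b)"
      using False Cons(2)[symmetric] by (auto simp: fun_eq_iff)
    ultimately show ?thesis by (auto intro: runs_mono)
  next
    case True
    have pk: "peek s a = x" using Cons(2)[symmetric] by (simp add: peek_def)
    let ?s = "s(a := l, b := g x # s b)"
    let ?c = "switch a as (\<lambda>x. Pop a ;; Push b (g x))"
    have "sem inp ?c s = ?s"
      using True pk Cons(2)[symmetric] assms(1) by (auto simp: sem_switch fun_eq_iff)
    then have body: "runs inp ?c s (4 * length as + 1) ?s"
      by (intro runs_line) (auto simp: cost_switch intro!: straight_switch)
    have "?s a = l" using assms(1) by simp
    moreover have "runs inp (transfer a stop b as g) ?s (length (takeWhile (\<lambda>x. x \<in> set as) (?s a)) * (4 * length as + 2) + 1)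
      (?s(a := dropWhile (\<lambda>x. x \<in> set as) (?s a), b := map g (rev (takeWhile (\<lambda>x. x \<in> set as) (?s a))) @ ?s b))"
      by (rule Cons(1)) (use assms(1) Cons(3) Cons(2)[symmetric] in auto)
    ultimately have IH: "runs inp (transfer a stop b as g) ?s (length (takeWhile (\<lambda>x. x \<in> set as) l) * (4 * length as + 2) + 1)
      (?s(a := dropWhile (\<lambda>x. x \<in> set as) l, b := map g (rev (takeWhile (\<lambda>x. x \<in> set as) l)) @ ?s b))"
      by metis
    have "peek s a \<notin> set stop" using pk True Cons(3)[of x] Cons(2)[symmetric] by auto
    from runs_Until_loop[OF this body IH[unfolded transfer_def]]
    have "runs inp (transfer a stop b as g) s (4 * length as + 1 + (length (takeWhile (\<lambda>x. x \<in> set as) l) * (4 * length as + 2) + 1) + 1)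
      (?s(a := dropWhile (\<lambda>x. x \<in> set as) l, b := map g (rev (takeWhile (\<lambda>x. x \<in> set as) l)) @ ?s b))"
      unfolding transfer_def .
    then show ?thesis
      by (rule runs_weaken) (use True Cons(2)[symmetric] assms(1) in \<open>auto simp: fun_eq_iff\<close>)
  qed
qed

lemma wf_transfer:
  "a < K \<Longrightarrow> b < K \<Longrightarrow> (\<And>x. x \<in> set as \<Longrightarrow> 0 < g x \<and> g x < S) \<Longrightarrow> wf_com K S (transfer a stop b as g)"
  unfolding transfer_def by (auto intro: wf_switch)

lemma runs_transfer_all:
  assumes "a \<noteq> b" "set (s a) \<subseteq> set as" "0 \<notin> set as"
  shows "runs inp (transfer a [0] b as g) s (length (s a) * (4 * length as + 2) + 1)
    (s(a := [], b := map g (rev (s a)) @ s b))"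
proof -
  have eq: "dropWhile (\<lambda>x. x \<in> set as) (s a) = []" "takeWhile (\<lambda>x. x \<in> set as) (s a) = s a"
    using assms by (auto simp: takeWhile_eq_all_conv dropWhile_eq_Nil_conv)
  have "x \<in> set [0] \<longleftrightarrow> x \<notin> set as" if "x \<in> insert 0 (set (s a))" for x
    using assms that by auto
  from runs_transfer[where inp = inp and g = g and s = s, OF assms(1) this assms(3)] show ?thesis unfolding eq .
qed

definition drop_until :: "nat \<Rightarrow> nat list \<Rightarrow> com" where
  "drop_until a stop = Until a stop (Pop a)"

lemma runs_drop_until:
  assumes "0 \<in> set stop"
  shows "runs inp (drop_until a stop) s (2 * length (s a) + 1) (s(a := dropWhile (\<lambda>x. x \<notin> set stop) (s a)))"
proof (induction "s a" arbitrary: s)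
  case Nil
  then have "peek s a \<in> set stop" "s a = []" using assms by (auto simp: peek_def)
  then show ?case using runs_Until_stop[of s a stop] unfolding drop_until_def
    by (simp add: fun_upd_idem)
next
  case (Cons x l)
  have pk: "peek s a = x" using Cons(2)[symmetric] by (simp add: peek_def)
  show ?case
  proof (cases "x \<in> set stop")
    case True
    then have "s(a := dropWhile (\<lambda>x. x \<notin> set stop) (s a)) = s"
      using Cons(2)[symmetric] by (auto simp: fun_eq_iff)
    then show ?thesis using runs_Until_stop[of s a stop] pk True unfolding drop_until_def
      by (auto intro: runs_mono)
  next
    case False
    let ?s = "s(a := l)"
    have body: "runs inp (Pop a) s 1 ?s"
      by (rule runs_line) (simp_all add: Cons(2)[symmetric])
    have IH: "runs inp (Until a stop (Pop a)) ?s (2 * length l + 1) (?s(a := dropWhile (\<lambda>x. x \<notin> set stop) l))"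
      using Cons(1)[of ?s] unfolding drop_until_def by simp
    from runs_Until_loop[OF _ body IH] False pk
    have "runs inp (drop_until a stop) s (1 + (2 * length l + 1) + 1) (?s(a := dropWhile (\<lambda>x. x \<notin> set stop) l))"
      unfolding drop_until_def by auto
    then show ?thesis
      by (rule runs_weaken) (use Cons(2)[symmetric] False in \<open>auto simp: fun_eq_iff\<close>)
  qed
qed

section \<open>Registers and unary arithmetic\<close>

abbreviation U :: "nat \<Rightarrow> nat list" where
  "U n \<equiv> replicate n 1"

text \<open>Roles: \<open>rC\<close> keeps the security parameter, with \<open>rC'\<close> as its
  scratch copy; \<open>rT\<close> is a timer; \<open>rL\<close>, \<open>rR\<close>,
  \<open>rQ\<close> are the two half tapes and the state of a simulated machine; \<open>rZ\<close>
  buffers input symbols; \<open>rD\<close> holds the current bit string and \<open>rE\<close> a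
  reversed string under construction; \<open>rX\<close> counts rounds; \<open>rA\<close>,
  \<open>rB\<close>, \<open>rG\<close> are gate operands.\<close>

abbreviation (input) "rOut \<equiv> 1 :: nat"
abbreviation (input) "rC \<equiv> 2 :: nat"
abbreviation (input) "rC' \<equiv> 3 :: nat"
abbreviation (input) "rT \<equiv> 4 :: nat"
abbreviation (input) "rTmp \<equiv> 5 :: nat"
abbreviation (input) "rL \<equiv> 6 :: nat"
abbreviation (input) "rR \<equiv> 7 :: nat"
abbreviation (input) "rQ \<equiv> 8 :: nat"
abbreviation (input) "rZ \<equiv> 9 :: nat"
abbreviation (input) "rD \<equiv> 10 :: nat"
abbreviation (input) "rE \<equiv> 11 :: nat"
abbreviation (input) "rX \<equiv> 12 :: nat"
abbreviation (input) "rA \<equiv> 13 :: nat"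
abbreviation (input) "rB \<equiv> 14 :: nat"
abbreviation (input) "rG \<equiv> 15 :: nat"

abbreviation (input) "nregs \<equiv> 16 :: nat"

definition move_unary :: "nat \<Rightarrow> nat \<Rightarrow> com" where
  "move_unary a b = transfer a [0] b [1] (\<lambda>_. 1)"

lemma runs_move_unary:
  assumes "a \<noteq> b" "s a = U n"
  shows "runs inp (move_unary a b) s (6 * n + 1) (s(a := [], b := U n @ s b))"
proof -
  have "set (s a) \<subseteq> set [1]" using assms by auto
  from runs_transfer_all[of a b s "[1]", OF assms(1) this, of inp "\<lambda>_. 1"] show ?thesis
    unfolding move_unary_def
    by (rule runs_weaken) (use assms in \<open>auto simp: map_replicate_const\<close>)
qed

definition move_bits :: "nat \<Rightarrow> nat \<Rightarrow> com" where
  "move_bits a b = transfer a [0] b [1, 2] id"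

lemma runs_move_bits:
  assumes "a \<noteq> b" "set (s a) \<subseteq> {1, 2}"
  shows "runs inp (move_bits a b) s (10 * length (s a) + 1) (s(a := [], b := rev (s a) @ s b))"
  using runs_transfer_all[of a b s "[1, 2]" inp id] assms
  by (auto simp: move_bits_def mult.commute)

text \<open>Popping is the only way to count a stack, so \<open>rC\<close> is drained into
  \<open>rC'\<close> and refilled afterwards.\<close>

definition add_count :: "nat \<Rightarrow> nat \<Rightarrow> com" where
  "add_count b x = Until rC [0] (Pop rC ;; Push rC' 1 ;; Push b x) ;; move_unary rC' rC"

lemma runs_add_count:
  assumes "s rC = U n" "s rC' = []" "b \<noteq> rC" "b \<noteq> rC'"
  shows "runs inp (add_count b x) s (12 * n + 3) (s(b := replicate n x @ s b))"
proof -
  define I where "I i = s(rC := U (n - i), rC' := U i, b := replicate i x @ s b)" for i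
  have "runs inp (Until rC [0] (Pop rC ;; Push rC' 1 ;; Push b x)) (I 0) (n * (5 + 1) + 1) (I n)"
  proof (rule runs_Until)
    fix i assume i: "i < n"
    then obtain d where d: "n - i = Suc d" "n - Suc i = d" by (metis Suc_diff_Suc)
    show "peek (I i) rC \<notin> set [0] \<and> runs inp (Pop rC ;; Push rC' 1 ;; Push b x) (I i) 5 (I (Suc i))"
      using assms by (auto simp: I_def peek_def d fun_eq_iff intro!: runs_line)
  qed (use assms in \<open>simp add: I_def peek_def\<close>)
  moreover have "I 0 = s" using assms by (auto simp: I_def fun_eq_iff)
  moreover have "runs inp (move_unary rC' rC) (I n) (6 * n + 1) ((I n)(rC' := [], rC := U n @ I n rC))"
    by (rule runs_move_unary) (use assms in \<open>simp_all add: I_def\<close>)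
  moreover have "(I n)(rC' := [], rC := U n @ I n rC) = s(b := replicate n x @ s b)"
    using assms by (auto simp: I_def fun_eq_iff)
  ultimately have "runs inp (add_count b x) s (n * (5 + 1) + 1 + (6 * n + 1) + 1) (s(b := replicate n x @ s b))"
    unfolding add_count_def using runs_Seq by metis
  then show ?thesis by (rule runs_mono) simp
qed

definition mult_count :: com where
  "mult_count = Until rT [0] (Pop rT ;; add_count rTmp 1) ;; move_unary rTmp rT"

lemma runs_mult_count:
  assumes "s rC = U n" "s rC' = []" "s rT = U m" "s rTmp = []"
  shows "runs inp mult_count s (m * (12 * n + 6) + 6 * (m * n) + 3) (s(rT := U (m * n)))"
proof -
  define I where "I i = s(rT := U (m - i), rTmp := U (i * n))" for i
  have "runs inp (Until rT [0] (Pop rT ;; add_count rTmp 1)) (I 0) (m * (1 + (12 * n + 3) + 1 + 1) + 1) (I m)"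
  proof (rule runs_Until)
    fix i assume i: "i < m"
    then obtain d where d: "m - i = Suc d" "m - Suc i = d" by (metis Suc_diff_Suc)
    have "runs inp (Pop rT) (I i) 1 ((I i)(rT := U d))"
      by (rule runs_line) (simp_all add: I_def d)
    moreover have "runs inp (add_count rTmp 1) ((I i)(rT := U d)) (12 * n + 3)
        ((I i)(rT := U d, rTmp := U n @ ((I i)(rT := U d)) rTmp))"
      by (rule runs_add_count) (use assms in \<open>simp_all add: I_def\<close>)
    moreover have "(I i)(rT := U d, rTmp := U n @ ((I i)(rT := U d)) rTmp) = I (Suc i)"
      by (auto simp: I_def d fun_eq_iff replicate_add)
    ultimately have "runs inp (Pop rT ;; add_count rTmp 1) (I i) (1 + (12 * n + 3) + 1) (I (Suc i))"
      using runs_Seq by metis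
    then show "peek (I i) rT \<notin> set [0] \<and> runs inp (Pop rT ;; add_count rTmp 1) (I i) (1 + (12 * n + 3) + 1) (I (Suc i))"
      by (auto simp: I_def peek_def d)
  qed (simp add: I_def peek_def)
  moreover have "I 0 = s" using assms by (auto simp: I_def fun_eq_iff)
  moreover have "runs inp (move_unary rTmp rT) (I m) (6 * (m * n) + 1) ((I m)(rTmp := [], rT := U (m * n) @ I m rT))"
    by (rule runs_move_unary) (simp_all add: I_def)
  moreover have "(I m)(rTmp := [], rT := U (m * n) @ I m rT) = s(rT := U (m * n))"
    using assms by (auto simp: I_def fun_eq_iff)
  ultimately have "runs inp mult_count s (m * (1 + (12 * n + 3) + 1 + 1) + 1 + (6 * (m * n) + 1) + 1) (s(rT := U (m * n)))"
    unfolding mult_count_def using runs_Seq by metis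
  then show ?thesis by (rule runs_mono) (simp add: algebra_simps)
qed

primrec pushes :: "nat \<Rightarrow> nat \<Rightarrow> com" where
  "pushes r 0 = Skip"
| "pushes r (Suc k) = (Push r 1 ;; pushes r k)"

lemma runs_pushes: "runs inp (pushes r k) s (2 * k + 1) (s(r := U k @ s r))"
proof (induction k arbitrary: s)
  case 0
  show ?case by (rule runs_line) auto
next
  case (Suc k)
  have "runs inp (Push r 1) s 1 (s(r := 1 # s r))" by (rule runs_line) auto
  from runs_Seq[OF this Suc] have "runs inp (pushes r (Suc k)) s (2 * Suc k + 1) (s(r := U (Suc k) @ s r))"
    unfolding pushes.simps by (rule runs_weaken) (auto simp: replicate_app_Cons_same)
  then show ?case .
qed

primrec power_prog :: "nat \<Rightarrow> com" where
  "power_prog 0 = Push rT 1"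
| "power_prog (Suc k) = (power_prog k ;; mult_count)"

primrec power_time :: "nat \<Rightarrow> nat \<Rightarrow> nat" where
  "power_time 0 n = 1"
| "power_time (Suc k) n = power_time k n + (n ^ k * (12 * n + 6) + 6 * (n ^ k * n) + 3) + 1"

lemma runs_power_prog:
  assumes "s rC = U n" "s rC' = []" "s rT = []" "s rTmp = []"
  shows "runs inp (power_prog k) s (power_time k n) (s(rT := U (n ^ k)))"
proof (induction k)
  case 0
  show ?case using assms by (intro runs_line) auto
next
  case (Suc k)
  have "runs inp mult_count (s(rT := U (n ^ k))) (n ^ k * (12 * n + 6) + 6 * (n ^ k * n) + 3)
    (s(rT := U (n ^ k), rT := U (n ^ k * n)))"
    by (rule runs_mult_count) (use assms in simp_all)
  from runs_Seq[OF Suc this] have "runs inp (power_prog (Suc k)) s (power_time (Suc k) n) (s(rT := U (n ^ Suc k)))"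
    by (simp add: mult.commute)
  then show ?case .
qed

text \<open>The exact value matters: a simulated machine is stopped after
  \<open>time_bound k n\<close> steps whether or not it has halted, and it owns exactly that many
  random bits.\<close>

definition clock :: "nat \<Rightarrow> com" where
  "clock k = power_prog k ;; pushes rT k"

lemma runs_clock:
  assumes "s rC = U n" "s rC' = []" "s rT = []" "s rTmp = []"
  shows "runs inp (clock k) s (power_time k n + 2 * k + 2) (s(rT := U (time_bound k n)))"
proof -
  have "runs inp (clock k) s (power_time k n + (2 * k + 1) + 1) ((s(rT := U (n ^ k)))(rT := U k @ (s(rT := U (n ^ k))) rT))"
    unfolding clock_def by (rule runs_Seq[OF runs_power_prog[OF assms] runs_pushes])
  then show ?thesis by (simp add: time_bound_def replicate_add[symmetric] add.commute)
qed

definition read_count :: com where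
  "read_count = Read rZ ;; Until rZ [3] (Pop rZ ;; Push rC 1 ;; Read rZ) ;; Pop rZ"

lemma runs_read_count:
  assumes "\<And>i. i < n \<Longrightarrow> inp i = 2" "read_sym (inp n) = 3"
  shows "runs inp read_count (\<lambda>_. []) (7 * n + 6) ((\<lambda>_. [])(0 := U (Suc n), rC := U n))"
proof -
  define I where "I i = (\<lambda>_. [])(0 := U (Suc i), rC := U i, rZ := [read_sym (inp i)])" for i
  have "runs inp (Until rZ [3] (Pop rZ ;; Push rC 1 ;; Read rZ)) (I 0) (n * (6 + 1) + 1) (I n)"
  proof (rule runs_Until)
    fix i assume "i < n"
    then show "peek (I i) rZ \<notin> set [3] \<and> runs inp (Pop rZ ;; Push rC 1 ;; Read rZ) (I i) 6 (I (Suc i))"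
      using assms by (auto simp: I_def peek_def read_sym_def fun_eq_iff intro!: runs_line)
  qed (use assms in \<open>simp add: I_def peek_def\<close>)
  moreover have "runs inp (Read rZ) (\<lambda>_. []) 2 (I 0)"
    by (rule runs_line) (auto simp: I_def fun_eq_iff)
  moreover have "runs inp (Pop rZ) (I n) 1 ((\<lambda>_. [])(0 := U (Suc n), rC := U n))"
    by (rule runs_line) (auto simp: I_def fun_eq_iff)
  ultimately have "runs inp read_count (\<lambda>_. []) (2 + (n * (6 + 1) + 1 + 1 + 1) + 1) ((\<lambda>_. [])(0 := U (Suc n), rC := U n))"
    unfolding read_count_def using runs_Seq by metis
  then show ?thesis by (rule runs_mono) simp
qed

definition halve :: com where
  "halve = Until rX [0] (Pop rX ;; Cond rX [0] Skip (Pop rX ;; Push rTmp 1)) ;; move_unary rTmp rX"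

lemma runs_halve:
  assumes "s rX = U x" "s rTmp = []"
  shows "runs inp halve s (14 * x + 3) (s(rX := U (x div 2)))"
proof -
  \<comment> \<open>For odd \<open>x\<close> the last of the \<open>(x + 1) div 2\<close> rounds
    pops a single symbol and pushes nothing; the minimum accounts for it.\<close>
  define I where "I i = s(rX := U (x - 2 * i), rTmp := U (min i (x div 2)))" for i
  let ?m = "(x + 1) div 2"
  have "runs inp (Until rX [0] (Pop rX ;; Cond rX [0] Skip (Pop rX ;; Push rTmp 1))) (I 0) (?m * (7 + 1) + 1) (I ?m)"
  proof (rule runs_Until)
    fix i assume i: "i < ?m"
    show "peek (I i) rX \<notin> set [0] \<and> runs inp (Pop rX ;; Cond rX [0] Skip (Pop rX ;; Push rTmp 1)) (I i) 7 (I (Suc i))"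
    proof (cases "x - 2 * i = 1")
      case True
      then have "x div 2 = i" using i by presburger
      then show ?thesis using True by (auto simp: I_def peek_def fun_eq_iff intro!: runs_line)
    next
      case False
      define d where "d = x - 2 * i - 2"
      have "x - 2 * i = Suc (Suc d)" "x - 2 * Suc i = d" using False i unfolding d_def by presburger+
      moreover have "i \<le> x div 2" "Suc i \<le> x div 2" using False i by presburger+
      ultimately show ?thesis by (auto simp: I_def peek_def fun_eq_iff min_def intro!: runs_line)
    qed
  qed (simp add: I_def peek_def)
  moreover have "I 0 = s" using assms by (auto simp: I_def fun_eq_iff)
  moreover have "runs inp (move_unary rTmp rX) (I ?m) (6 * (x div 2) + 1) ((I ?m)(rTmp := [], rX := U (x div 2) @ I ?m rX))"
    by (rule runs_move_unary) (simp_all add: I_def min_absorb2)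
  moreover have "(I ?m)(rTmp := [], rX := U (x div 2) @ I ?m rX) = s(rX := U (x div 2))"
    using assms by (auto simp: I_def fun_eq_iff)
  ultimately have "runs inp halve s (?m * (7 + 1) + 1 + (6 * (x div 2) + 1) + 1) (s(rX := U (x div 2)))"
    unfolding halve_def using runs_Seq by metis
  moreover have "(x + 1) div 2 \<le> x" "x div 2 \<le> x" by (cases x) auto
  moreover have "a * (7 + 1) + 1 + (6 * b + 1) + 1 \<le> 14 * x + 3" if "a \<le> x" "b \<le> x" for a b
    using that by simp
  ultimately show ?thesis using runs_mono by blast
qed

section \<open>Doubling a circuit description\<close>

fun double_gate :: "gate \<Rightarrow> gate list" where
  "double_gate (Had i) = [Had (2 * i), Had (2 * i + 1)]"
| "double_gate (Toff a b c) = [Toff (2 * a) (2 * b) (2 * c), Toff (2 * a + 1) (2 * b + 1) (2 * c + 1)]"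

fun gate_nums :: "gate \<Rightarrow> nat list" where
  "gate_nums (Had i) = [0, i]"
| "gate_nums (Toff a b c) = [1, a, b, c]"

definition nums_bits :: "nat list \<Rightarrow> bool list" where
  "nums_bits ns = concat (map (\<lambda>a. replicate a True @ [False]) ns)"

lemma nums_bits_simps [simp]:
  "nums_bits [] = []" "nums_bits (n # ns) = replicate n True @ False # nums_bits ns"
  "nums_bits (ms @ ns) = nums_bits ms @ nums_bits ns"
  by (simp_all add: nums_bits_def)

definition double_nums :: "nat list \<Rightarrow> nat list" where
  "double_nums ns = concat (map gate_nums (concat (map double_gate (parse_gates ns))))"

text \<open>Every bit string is a circuit description, so malformed ones need a value too. With
  fewer than two complete numbers both the string and its image decode to the empty circuit; the
  image is simply what the stack program produces, which doubles an unfinished last number as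
  well.\<close>

definition double_bits :: "bool list \<Rightarrow> bool list" where
  "double_bits bs = (case unary_nums 0 bs of
     n # m # rest \<Rightarrow> nums_bits (2 * n # 2 * m # double_nums rest)
   | ns \<Rightarrow> nums_bits (map ((*) 2) ns) @ replicate (2 * (length bs - length (nums_bits ns))) True)"

lemma unary_nums_replicate: "unary_nums k (replicate a True @ bs) = unary_nums (k + a) bs"
  by (induction a arbitrary: k) auto

lemma unary_nums_replicate_end: "unary_nums k (replicate a True) = []"
  using unary_nums_replicate[of k a "[]"] by simp

lemma unary_nums_bits: "unary_nums 0 (nums_bits ns @ replicate r True) = ns"
  by (induction ns) (auto simp: unary_nums_replicate unary_nums_replicate_end)

text \<open>A bit string consists of complete unary numbers followed by an unfinished run of ones.
  The prefix of length \<open>k\<close> stands for the digits that \<open>unary_nums\<close> has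
  already counted.\<close>

lemma bits_decomp: "\<exists>r. replicate k True @ bs = nums_bits (unary_nums k bs) @ replicate r True"
proof (induction bs arbitrary: k)
  case Nil
  show ?case by auto
next
  case (Cons b bs)
  show ?case
  proof (cases b)
    case True
    then show ?thesis using Cons[of "Suc k"] by (simp add: replicate_app_Cons_same)
  next
    case False
    obtain r where "bs = nums_bits (unary_nums 0 bs) @ replicate r True" using Cons[of 0] by auto
    then show ?thesis using False by auto
  qed
qed

lemma parse_gate_nums: "parse_gates (concat (map gate_nums gs)) = gs"
proof (induction gs)
  case (Cons g gs)
  then show ?case by (cases g) auto
qed simp

definition double_circuit :: "nat \<times> nat \<times> gate list \<Rightarrow> nat \<times> nat \<times> gate list" where
  "double_circuit c = (case c of (n, m, gs) \<Rightarrow> (2 * n, 2 * m, concat (map double_gate gs)))"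

lemma decode_double_bits: "decode_circuit (double_bits bs) = double_circuit (decode_circuit bs)"
proof -
  have end0: "unary_nums 0 (nums_bits ns) = ns" for ns
    using unary_nums_bits[of ns 0] by simp
  show ?thesis
  proof (cases "unary_nums 0 bs" rule: remdups_adj.cases)
    case (3 n m rest)
    then show ?thesis unfolding decode_circuit_def double_bits_def double_circuit_def double_nums_def
      by (simp del: nums_bits_simps add: end0 parse_gate_nums)
  qed (auto simp: decode_circuit_def double_bits_def double_circuit_def unary_nums_bits unary_nums_replicate
      unary_nums_replicate_end)
qed

definition read_num :: "nat \<Rightarrow> com" where
  "read_num r = transfer rD [0, 1] r [2] (\<lambda>_. 1)"

lemma takeWhile_replicate_app: "l = [] \<or> (\<exists>l'. l = 1 # l') \<Longrightarrow>
  takeWhile (\<lambda>x. x \<in> set [2]) (replicate a 2 @ l) = replicate a (2::nat) \<and>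
  dropWhile (\<lambda>x. x \<in> set [2]) (replicate a 2 @ l) = l"
  by (induction a) auto

lemma runs_read_num:
  assumes "s rD = replicate a 2 @ l" "l = [] \<or> (\<exists>l'. l = 1 # l')" "set l \<subseteq> {1, 2}" "s r = []" "r \<noteq> rD"
  shows "runs inp (read_num r) s (6 * a + 1) (s(rD := l, r := U a))"
proof -
  have "runs inp (transfer rD [0, 1] r [2] (\<lambda>_. 1)) s (length (takeWhile (\<lambda>x. x \<in> set [2]) (s rD)) * (4 * length [2::nat] + 2) + 1)
    (s(rD := dropWhile (\<lambda>x. x \<in> set [2]) (s rD), r := map (\<lambda>_. 1) (rev (takeWhile (\<lambda>x. x \<in> set [2]) (s rD))) @ s r))"
    by (rule runs_transfer) (use assms in auto)
  then show ?thesis unfolding read_num_def assms(1)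
    by (rule runs_weaken) (use takeWhile_replicate_app[OF assms(2), of a] assms in \<open>auto simp: map_replicate_const\<close>)
qed

text \<open>Used for the two header numbers, which are doubled while they are moved to
  \<open>rE\<close>. The closing \<open>Cond\<close> separates a complete number from input that
  ended inside it.\<close>

definition copy_num :: com where
  "copy_num = Until rD [0, 1] (Pop rD ;; Push rE 2 ;; Push rE 2) ;; Cond rD [0] Skip (Pop rD ;; Push rE 1)"

lemma runs_double_loop:
  assumes "s rD = replicate a 2 @ l" "l = [] \<or> (\<exists>l'. l = 1 # l')"
  shows "runs inp (Until rD [0, 1] (Pop rD ;; Push rE 2 ;; Push rE 2)) s (6 * a + 1)
    (s(rD := l, rE := replicate (2 * a) 2 @ s rE))"
proof -
  define I where "I i = s(rD := replicate (a - i) 2 @ l, rE := replicate (2 * i) 2 @ s rE)" for i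
  have "runs inp (Until rD [0, 1] (Pop rD ;; Push rE 2 ;; Push rE 2)) (I 0) (a * (5 + 1) + 1) (I a)"
  proof (rule runs_Until)
    fix i assume i: "i < a"
    then obtain d where d: "a - i = Suc d" "a - Suc i = d" by (metis Suc_diff_Suc)
    show "peek (I i) rD \<notin> set [0, 1] \<and> runs inp (Pop rD ;; Push rE 2 ;; Push rE 2) (I i) 5 (I (Suc i))"
      by (auto simp: I_def peek_def d fun_eq_iff intro!: runs_line)
  qed (use assms in \<open>auto simp: I_def peek_def\<close>)
  moreover have "I 0 = s" using assms by (auto simp: I_def fun_eq_iff)
  ultimately show ?thesis by (simp add: I_def mult.commute)
qed

lemma runs_copy_num_end:
  assumes "s rD = replicate a 2"
  shows "runs inp copy_num s (6 * a + 7) (s(rD := [], rE := replicate (2 * a) 2 @ s rE))"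
  unfolding copy_num_def
  apply (rule runs_weaken)
    apply (rule runs_Seq)
     apply (rule runs_double_loop[where a = a and l = "[]"]; simp add: assms)
    apply (rule runs_straight; simp)
   apply simp
  apply (simp add: peek_def)
  done

lemma runs_copy_num:
  assumes "s rD = replicate a 2 @ 1 # l"
  shows "runs inp copy_num s (6 * a + 7) (s(rD := l, rE := 1 # replicate (2 * a) 2 @ s rE))"
  unfolding copy_num_def
  apply (rule runs_weaken)
    apply (rule runs_Seq)
     apply (rule runs_double_loop[where a = a and l = "1 # l"]; simp add: assms)
    apply (rule runs_straight; simp)
   apply simp
  apply (simp add: peek_def fun_eq_iff)
  done

text \<open>The operand is restored because every gate is written twice, with \<open>2 * a\<close>
  for the first copy and \<open>2 * a + 1\<close> for the second.\<close>

definition emit :: "bool \<Rightarrow> nat \<Rightarrow> com" where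
  "emit p r = Until r [0] (Pop r ;; Push rTmp 1 ;; Push rE 2 ;; Push rE 2) ;; move_unary rTmp r ;;
     (if p then Push rE 2 ;; Push rE 1 else Push rE 1)"

lemma runs_emit:
  assumes "s r = U a" "s rTmp = []" "r \<noteq> rTmp" "r \<noteq> rE"
  shows "runs inp (emit p r) s (14 * a + 7) (s(rE := 1 # replicate (2 * a + of_bool p) 2 @ s rE))"
proof -
  define I where "I i = s(r := U (a - i), rTmp := U i, rE := replicate (2 * i) 2 @ s rE)" for i
  have loop: "runs inp (Until r [0] (Pop r ;; Push rTmp 1 ;; Push rE 2 ;; Push rE 2)) (I 0) (a * (7 + 1) + 1) (I a)"
  proof (rule runs_Until)
    fix i assume i: "i < a"
    then obtain d where d: "a - i = Suc d" "a - Suc i = d" by (metis Suc_diff_Suc)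
    show "peek (I i) r \<notin> set [0] \<and> runs inp (Pop r ;; Push rTmp 1 ;; Push rE 2 ;; Push rE 2) (I i) 7 (I (Suc i))"
      using assms by (auto simp: I_def peek_def d fun_eq_iff intro!: runs_line)
  qed (use assms in \<open>auto simp: I_def peek_def\<close>)
  have I0: "I 0 = s" using assms by (auto simp: I_def fun_eq_iff)
  have restore: "runs inp (move_unary rTmp r) (I a) (6 * a + 1) ((I a)(rTmp := [], r := U a @ I a r))"
    by (rule runs_move_unary) (use assms in \<open>simp_all add: I_def\<close>)
  have tail: "runs inp (if p then Push rE 2 ;; Push rE 1 else Push rE 1) ((I a)(rTmp := [], r := U a @ I a r)) 3
    (s(rE := 1 # replicate (2 * a + of_bool p) 2 @ s rE))"
    using assms by (intro runs_line) (auto simp: I_def fun_eq_iff)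
  show ?thesis unfolding emit_def
    using runs_Seq[OF loop[unfolded I0] runs_Seq[OF restore tail]] by (rule runs_mono) simp
qed

definition emit_had :: "bool \<Rightarrow> com" where
  "emit_had p = Push rE 1 ;; emit p rA"

definition emit_toff :: "bool \<Rightarrow> com" where
  "emit_toff p = Push rE 2 ;; Push rE 1 ;; emit p rA ;; emit p rB ;; emit p rG"

text \<open>Follows \<open>parse_gates\<close> including its failures. A tag of at least
  \<open>2\<close> discards the rest, and input that ends inside a number leaves \<open>rD\<close>
  empty, which also ends the surrounding loop. Nothing is emitted before the last operand is known
  to be complete.\<close>

definition gate_prog :: com where
  "gate_prog =
     Cond rD [1]
       (Pop rD ;; read_num rA ;; Cond rD [0] Skip (Pop rD ;; emit_had False ;; emit_had True))
       (Pop rD ;; Cond rD [1]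
          (Pop rD ;; read_num rA ;; Cond rD [0] Skip
            (Pop rD ;; read_num rB ;; Cond rD [0] Skip
              (Pop rD ;; read_num rG ;; Cond rD [0] Skip (Pop rD ;; emit_toff False ;; emit_toff True))))
          (drop_until rD [0])) ;;
     drop_until rA [0] ;; drop_until rB [0] ;; drop_until rG [0]"

definition clean :: "stacks \<Rightarrow> bool" where
  "clean s \<longleftrightarrow> s rA = [] \<and> s rB = [] \<and> s rG = [] \<and> s rTmp = []"

definition num_rev :: "nat \<Rightarrow> nat list" where
  "num_rev a = 1 # replicate a 2"

lemma num_rev_code: "rev (map enc_bit (nums_bits (n # ns))) = rev (map enc_bit (nums_bits ns)) @ num_rev n"
  by (simp add: num_rev_def enc_bit_def)

lemma runs_clear:
  assumes "0 \<notin> set (s a)"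
  shows "runs inp (drop_until a [0]) s (2 * length (s a) + 1) (s(a := []))"
proof -
  have "runs inp (drop_until a [0]) s (2 * length (s a) + 1) (s(a := dropWhile (\<lambda>x. x \<notin> set [0]) (s a)))"
    by (rule runs_drop_until) simp
  moreover have "dropWhile (\<lambda>x. x \<notin> set [0]) (s a) = []"
    using assms by (auto simp: dropWhile_eq_Nil_conv) (metis gr0I)
  ultimately show ?thesis by metis
qed

text \<open>Stack \<open>rE\<close> is listed from its top, so the gate emitted last comes first;
  each \<open>num_rev 0\<close> is a Hadamard tag.\<close>

lemma runs_gate_had:
  assumes "s rD = 1 # replicate i 2 @ 1 # l" "clean s" "set l \<subseteq> {1, 2}"
  shows "runs inp gate_prog s (36 * i + 60) (s(rD := l,
    rE := num_rev (2 * i + 1) @ num_rev 0 @ num_rev (2 * i) @ num_rev 0 @ s rE))"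
proof -
  have cl: "s rA = []" "s rB = []" "s rG = []" "s rTmp = []" using assms by (auto simp: clean_def)
  show ?thesis
    unfolding gate_prog_def emit_had_def
    apply (rule runs_weaken)
      apply (rule runs_Seq)
       apply (rule runs_Cond_True)
        apply (simp add: peek_def assms)
       apply (rule runs_Seq, rule runs_straight, simp)
       apply (rule runs_Seq)
        apply (rule runs_read_num[where a = i and l = "1 # l"]; simp add: assms[simplified] cl set_replicate_conv_if)
       apply (rule runs_Cond_False)
        apply (simp add: peek_def)
       apply (rule runs_Seq, rule runs_straight, simp)
       apply (rule runs_Seq, rule runs_Seq, rule runs_straight, simp)
        apply (rule runs_emit[where a = i]; simp add: cl)
       apply (rule runs_Seq, rule runs_straight, simp)
       apply (rule runs_emit[where a = i]; simp add: cl)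
      apply (rule runs_Seq, rule runs_clear, simp)
      apply (rule runs_Seq, rule runs_clear, simp add: cl)
      apply (rule runs_clear, simp add: cl)
     apply (simp add: cl)
    apply (simp add: fun_eq_iff num_rev_def cl)
    done
qed

lemma runs_gate_toff:
  assumes "s rD = 2 # 1 # replicate a 2 @ 1 # replicate b 2 @ 1 # replicate c 2 @ 1 # l" "clean s" "set l \<subseteq> {1, 2}"
  shows "runs inp gate_prog s (36 * (a + b + c) + 150) (s(rD := l,
    rE := num_rev (2 * c + 1) @ num_rev (2 * b + 1) @ num_rev (2 * a + 1) @ num_rev 1 @
      num_rev (2 * c) @ num_rev (2 * b) @ num_rev (2 * a) @ num_rev 1 @ s rE))"
proof -
  have cl: "s rA = []" "s rB = []" "s rG = []" "s rTmp = []" using assms by (auto simp: clean_def)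
  show ?thesis
    unfolding gate_prog_def emit_toff_def
    apply (rule runs_weaken)
      apply (rule runs_Seq)
       apply (rule runs_Cond_False)
        apply (simp add: peek_def assms)
       apply (rule runs_Seq, rule runs_straight, simp)
       apply (rule runs_Cond_True)
        apply (simp add: peek_def assms)
       apply (rule runs_Seq, rule runs_straight, simp)
       apply (rule runs_Seq)
        apply (rule runs_read_num[where a = a and l = "1 # replicate b 2 @ 1 # replicate c 2 @ 1 # l"]; simp add: assms[simplified] cl set_replicate_conv_if)
       apply (rule runs_Cond_False)
        apply (simp add: peek_def)
       apply (rule runs_Seq, rule runs_straight, simp)
       apply (rule runs_Seq)
        apply (rule runs_read_num[where a = b and l = "1 # replicate c 2 @ 1 # l"]; simp add: assms[simplified] cl set_replicate_conv_if)
       apply (rule runs_Cond_False)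
        apply (simp add: peek_def)
       apply (rule runs_Seq, rule runs_straight, simp)
       apply (rule runs_Seq)
        apply (rule runs_read_num[where a = c and l = "1 # l"]; simp add: assms[simplified] cl set_replicate_conv_if)
       apply (rule runs_Cond_False)
        apply (simp add: peek_def)
       apply (rule runs_Seq, rule runs_straight, simp)
       apply (rule runs_Seq)
        apply (rule runs_Seq, rule runs_straight, simp)
        apply (rule runs_Seq, rule runs_straight, simp)
        apply (rule runs_Seq)
       apply (rule runs_emit[where a = a]; simp add: cl)
        apply (rule runs_Seq)
       apply (rule runs_emit[where a = b]; simp add: cl)
        apply (rule runs_emit[where a = c]; simp add: cl)
       apply (rule runs_Seq, rule runs_straight, simp)
       apply (rule runs_Seq, rule runs_straight, simp)
       apply (rule runs_Seq)
       apply (rule runs_emit[where a = a]; simp add: cl)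
       apply (rule runs_Seq)
       apply (rule runs_emit[where a = b]; simp add: cl)
       apply (rule runs_emit[where a = c]; simp add: cl)
      apply (rule runs_Seq, rule runs_clear, simp)
      apply (rule runs_Seq, rule runs_clear, simp)
      apply (rule runs_clear, simp)
     apply simp
    apply (simp add: fun_eq_iff num_rev_def cl)
    done
qed

text \<open>The five shapes are the ways in which parsing can end on nonempty input: inside the
  operand of a Hadamard gate, inside the first, second or third operand of a Toffoli gate, or at a
  tag that is unknown or itself unfinished.\<close>

lemma runs_gate_stop:
  assumes "s rD = 1 # replicate r 2 \<or> s rD = 2 # 1 # replicate r 2 \<or>
      s rD = 2 # 1 # replicate a 2 @ 1 # replicate r 2 \<or>
      s rD = 2 # 1 # replicate a 2 @ 1 # replicate b 2 @ 1 # replicate r 2 \<or>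
      (\<exists>l. s rD = 2 # l \<and> (l = [] \<or> hd l = 2) \<and> 0 \<notin> set l)"
    and "clean s"
  shows "runs inp gate_prog s (36 * length (s rD) + 60) (s(rD := []))"
proof -
  have cl: "s rA = []" "s rB = []" "s rG = []" "s rTmp = []" using assms by (auto simp: clean_def)
  consider (1) "s rD = 1 # replicate r 2" | (2) "s rD = 2 # 1 # replicate r 2"
    | (3) "s rD = 2 # 1 # replicate a 2 @ 1 # replicate r 2"
    | (4) "s rD = 2 # 1 # replicate a 2 @ 1 # replicate b 2 @ 1 # replicate r 2"
    | (5) l where "s rD = 2 # l" "l = [] \<or> hd l = 2" "0 \<notin> set l"
    using assms(1) by blast
  then show ?thesis
  proof cases
    case 1
    show ?thesis
      unfolding gate_prog_def
      apply (rule runs_weaken)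
        apply (rule runs_Seq)
         apply (rule runs_Cond_True)
          apply (simp add: peek_def 1)
         apply (rule runs_Seq, rule runs_straight, simp)
         apply (rule runs_Seq)
          apply (rule runs_read_num[where a = r and l = "[]"]; simp add: 1 cl)
         apply (rule runs_Cond_True)
          apply (simp add: peek_def)
         apply (rule runs_straight, simp)
        apply (rule runs_Seq, rule runs_clear, simp)
        apply (rule runs_Seq, rule runs_clear, simp add: cl)
        apply (rule runs_clear, simp add: cl)
       apply (simp add: 1 cl)
      apply (simp add: fun_eq_iff cl)
      done
  next
    case 2
    show ?thesis
      unfolding gate_prog_def
      apply (rule runs_weaken)
        apply (rule runs_Seq)
         apply (rule runs_Cond_False)
          apply (simp add: peek_def 2)
         apply (rule runs_Seq, rule runs_straight, simp)
         apply (rule runs_Cond_True)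
          apply (simp add: peek_def 2)
         apply (rule runs_Seq, rule runs_straight, simp)
         apply (rule runs_Seq)
          apply (rule runs_read_num[where a = r and l = "[]"]; simp add: 2 cl)
         apply (rule runs_Cond_True)
          apply (simp add: peek_def)
         apply (rule runs_straight, simp)
        apply (rule runs_Seq, rule runs_clear, simp)
        apply (rule runs_Seq, rule runs_clear, simp add: cl)
        apply (rule runs_clear, simp add: cl)
       apply (simp add: 2 cl)
      apply (simp add: fun_eq_iff cl)
      done
  next
    case 3
    show ?thesis
      unfolding gate_prog_def
      apply (rule runs_weaken)
        apply (rule runs_Seq)
         apply (rule runs_Cond_False)
          apply (simp add: peek_def 3)
         apply (rule runs_Seq, rule runs_straight, simp)
         apply (rule runs_Cond_True)
          apply (simp add: peek_def 3)
         apply (rule runs_Seq, rule runs_straight, simp)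
         apply (rule runs_Seq)
          apply (rule runs_read_num[where a = a and l = "1 # replicate r 2"]; simp add: 3 cl set_replicate_conv_if)
         apply (rule runs_Cond_False)
          apply (simp add: peek_def)
         apply (rule runs_Seq, rule runs_straight, simp)
         apply (rule runs_Seq)
          apply (rule runs_read_num[where a = r and l = "[]"]; simp add: cl)
         apply (rule runs_Cond_True)
          apply (simp add: peek_def)
         apply (rule runs_straight, simp)
        apply (rule runs_Seq, rule runs_clear, simp)
        apply (rule runs_Seq, rule runs_clear, simp add: cl)
        apply (rule runs_clear, simp add: cl)
       apply (simp add: 3 cl)
      apply (simp add: fun_eq_iff cl)
      done
  next
    case 4
    show ?thesis
      unfolding gate_prog_def
      apply (rule runs_weaken)
        apply (rule runs_Seq)
         apply (rule runs_Cond_False)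
          apply (simp add: peek_def 4)
         apply (rule runs_Seq, rule runs_straight, simp)
         apply (rule runs_Cond_True)
          apply (simp add: peek_def 4)
         apply (rule runs_Seq, rule runs_straight, simp)
         apply (rule runs_Seq)
          apply (rule runs_read_num[where a = a and l = "1 # replicate b 2 @ 1 # replicate r 2"]; simp add: 4 cl set_replicate_conv_if)
         apply (rule runs_Cond_False)
          apply (simp add: peek_def)
         apply (rule runs_Seq, rule runs_straight, simp)
         apply (rule runs_Seq)
          apply (rule runs_read_num[where a = b and l = "1 # replicate r 2"]; simp add: cl set_replicate_conv_if)
         apply (rule runs_Cond_False)
          apply (simp add: peek_def)
         apply (rule runs_Seq, rule runs_straight, simp)
         apply (rule runs_Seq)
          apply (rule runs_read_num[where a = r and l = "[]"]; simp add: cl)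
         apply (rule runs_Cond_True)
          apply (simp add: peek_def)
         apply (rule runs_straight, simp)
        apply (rule runs_Seq, rule runs_clear, simp)
        apply (rule runs_Seq, rule runs_clear, simp)
        apply (rule runs_clear, simp)
       apply (simp add: 4 cl)
      apply (simp add: fun_eq_iff cl)
      done
  next
    case 5
    have pk: "(case l of [] \<Rightarrow> 0 | a # _ \<Rightarrow> a) \<noteq> 1" using 5(2) by (cases l) auto
    show ?thesis
      unfolding gate_prog_def
      apply (rule runs_weaken)
        apply (rule runs_Seq)
         apply (rule runs_Cond_False)
          apply (simp add: peek_def 5)
         apply (rule runs_Seq, rule runs_straight, simp)
         apply (rule runs_Cond_False)
          apply (use pk in \<open>simp add: peek_def 5(1)\<close>)
         apply (rule runs_clear, use 5(3) in \<open>simp add: 5(1)\<close>)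
        apply (rule runs_Seq, rule runs_clear, simp add: cl)
        apply (rule runs_Seq, rule runs_clear, simp add: cl)
        apply (rule runs_clear, simp add: cl)
       apply (simp add: 5(1) cl)
      apply (simp add: fun_eq_iff cl)
      done
  qed
qed

lemma double_nums_simps:
  "double_nums [] = []" "double_nums [0] = []" "double_nums [1] = []" "double_nums [1, a] = []"
  "double_nums [1, a, b] = []" "double_nums (Suc (Suc k) # ns) = []"
  "double_nums (0 # a # ns) = 0 # 2 * a # 0 # (2 * a + 1) # double_nums ns"
  "double_nums (1 # a # b # c # ns) =
     1 # 2 * a # 2 * b # 2 * c # 1 # (2 * a + 1) # (2 * b + 1) # (2 * c + 1) # double_nums ns"
  by (simp_all add: double_nums_def)

lemma parse_cases:
  obtains "ns = []" | "ns = [0]" | "ns = [1]" | a where "ns = [1, a]" | a b where "ns = [1, a, b]"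
  | k ms where "ns = Suc (Suc k) # ms" | a ms where "ns = 0 # a # ms" | a b c ms where "ns = 1 # a # b # c # ms"
  by (rule parse_gates.cases[of ns]) (auto, (metis nat.exhaust)+)

lemma clean_upd: "clean s \<Longrightarrow> clean (s(rD := x, rE := y))" "clean s \<Longrightarrow> clean (s(rD := x))"
  by (simp_all add: clean_def)

lemma enc_bits_subset: "set (map enc_bit bs) \<subseteq> {1, 2}"
  by (auto simp: enc_bit_def)

text \<open>The induction is on length, as a gate consumes two or four numbers. The rate
  \<open>36\<close> per symbol of \<open>rD\<close> absorbs the constants: a Hadamard gate occupies
  \<open>i + 2\<close> symbols and \<open>72 \<ge> 61\<close>, a Toffoli gate
  \<open>a + b + c + 5\<close> symbols and \<open>180 \<ge> 151\<close>.\<close>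

lemma runs_gates:
  assumes "s rD = map enc_bit (nums_bits ns @ replicate r True)" "clean s"
  shows "runs inp (Until rD [0] gate_prog) s (36 * length (s rD) + 62)
    (s(rD := [], rE := rev (map enc_bit (nums_bits (double_nums ns))) @ s rE))"
  using assms
proof (induction ns arbitrary: s rule: length_induct)
  case (1 ns)
  let ?l = "\<lambda>ms. map enc_bit (nums_bits ms @ replicate r True)"
  have stop: "runs inp (Until rD [0] gate_prog) s (36 * length (s rD) + 62) (s(rD := []))"
    if "s rD = 1 # replicate r 2 \<or> s rD = 2 # 1 # replicate r 2 \<or>
      s rD = 2 # 1 # replicate a 2 @ 1 # replicate r 2 \<or>
      s rD = 2 # 1 # replicate a 2 @ 1 # replicate b 2 @ 1 # replicate r 2 \<or>
      (\<exists>l. s rD = 2 # l \<and> (l = [] \<or> hd l = 2) \<and> 0 \<notin> set l)" for a b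
  proof -
    have "peek s rD \<notin> set [0]" using that by (auto simp: peek_def)
    moreover have "peek (s(rD := [])) rD \<in> set [0]" by (simp add: peek_def)
    ultimately have "runs inp (Until rD [0] gate_prog) s (36 * length (s rD) + 60 + 1 + 1) (s(rD := []))"
      using runs_Until_loop runs_gate_stop[OF that 1(3)] runs_Until_stop by blast
    then show ?thesis by (rule runs_mono) simp
  qed
  have stop': ?case if "double_nums ns = []" "s rD = 1 # replicate r 2 \<or> s rD = 2 # 1 # replicate r 2 \<or>
      s rD = 2 # 1 # replicate a 2 @ 1 # replicate r 2 \<or>
      s rD = 2 # 1 # replicate a 2 @ 1 # replicate b 2 @ 1 # replicate r 2 \<or>
      (\<exists>l. s rD = 2 # l \<and> (l = [] \<or> hd l = 2) \<and> 0 \<notin> set l)" for a b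
  proof -
    have "s(rD := [], rE := rev (map enc_bit (nums_bits (double_nums ns))) @ s rE) = s(rD := [])"
      using that(1) by auto
    then show ?thesis using stop[OF that(2)] by metis
  qed
  show ?case
  proof (cases ns rule: parse_cases)
    case 1
    note ns = this
    show ?thesis
    proof (cases r)
      case 0
      then have "s rD = []" using 1 "1.prems" by simp
      then have "runs inp (Until rD [0] gate_prog) s 1 s" by (intro runs_Until_stop) (simp add: peek_def)
      moreover have "s = s(rD := [], rE := rev (map enc_bit (nums_bits (double_nums ns))) @ s rE)"
        using \<open>s rD = []\<close> ns by (auto simp: double_nums_simps fun_eq_iff)
      ultimately show ?thesis using runs_weaken by (metis le_add2 one_le_numeral order.trans)
    next
      case (Suc r')
      then have "s rD = 2 # replicate r' 2" using ns "1.prems" by (simp add: enc_bit_def)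
      moreover have "replicate r' 2 = [] \<or> hd (replicate r' 2) = (2 :: nat)" by (cases r') auto
      ultimately show ?thesis using ns by (intro stop'[of 0 0]) (auto simp: double_nums_simps)
    qed
  next
    case 2
    then have "s rD = 1 # replicate r 2" using "1.prems" by (simp add: enc_bit_def)
    then show ?thesis using 2 by (intro stop') (auto simp: double_nums_simps)
  next
    case 3
    then have "s rD = 2 # 1 # replicate r 2" using "1.prems" by (simp add: enc_bit_def)
    then show ?thesis using 3 double_nums_simps(3) by (intro stop') auto
  next
    case (4 a)
    then have "s rD = 2 # 1 # replicate a 2 @ 1 # replicate r 2" using "1.prems" by (simp add: enc_bit_def)
    then show ?thesis using 4 double_nums_simps(4) by (intro stop'[of a]) auto
  next
    case (5 a b)
    then have "s rD = 2 # 1 # replicate a 2 @ 1 # replicate b 2 @ 1 # replicate r 2"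
      using "1.prems" by (simp add: enc_bit_def)
    then show ?thesis using 5 double_nums_simps(5) by (intro stop'[of a b]) auto
  next
    case (6 k ms)
    then have "s rD = 2 # 2 # replicate k 2 @ 1 # ?l ms"
      using "1.prems" by (simp add: enc_bit_def)
    moreover have "0 \<notin> set (?l ms)" by (auto simp: enc_bit_def)
    ultimately show ?thesis using 6 by (intro stop') (auto simp: double_nums_simps)
  next
    case (7 a ms)
    let ?s = "s(rD := ?l ms, rE := num_rev (2 * a + 1) @ num_rev 0 @ num_rev (2 * a) @ num_rev 0 @ s rE)"
    have D: "s rD = 1 # replicate a 2 @ 1 # ?l ms" using 7 "1.prems" by (simp add: enc_bit_def)
    have "runs inp (Until rD [0] gate_prog) ?s (36 * length (?s rD) + 62)
        (?s(rD := [], rE := rev (map enc_bit (nums_bits (double_nums ms))) @ ?s rE))"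
      by (rule 1(1)[rule_format]) (use 7 clean_upd(1)[OF "1.prems"(2)] in auto)
    from runs_Until_loop[OF _ runs_gate_had[OF D "1.prems"(2) enc_bits_subset] this] D
    have "runs inp (Until rD [0] gate_prog) s (36 * a + 60 + (36 * length (?s rD) + 62) + 1)
        (?s(rD := [], rE := rev (map enc_bit (nums_bits (double_nums ms))) @ ?s rE))"
      by (simp add: peek_def)
    then show ?thesis
      by (rule runs_weaken)
        (use D 7 in \<open>simp_all add: double_nums_simps fun_eq_iff num_rev_def enc_bit_def replicate_append_same\<close>)
  next
    case (8 a b c ms)
    let ?s = "s(rD := ?l ms, rE := num_rev (2 * c + 1) @ num_rev (2 * b + 1) @ num_rev (2 * a + 1) @ num_rev 1 @
      num_rev (2 * c) @ num_rev (2 * b) @ num_rev (2 * a) @ num_rev 1 @ s rE)"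
    have D: "s rD = 2 # 1 # replicate a 2 @ 1 # replicate b 2 @ 1 # replicate c 2 @ 1 # ?l ms"
      using 8 "1.prems" by (simp add: enc_bit_def)
    have "runs inp (Until rD [0] gate_prog) ?s (36 * length (?s rD) + 62)
        (?s(rD := [], rE := rev (map enc_bit (nums_bits (double_nums ms))) @ ?s rE))"
      by (rule 1(1)[rule_format]) (use 8 clean_upd(1)[OF "1.prems"(2)] in auto)
    from runs_Until_loop[OF _ runs_gate_toff[OF D "1.prems"(2) enc_bits_subset] this] D
    have "runs inp (Until rD [0] gate_prog) s (36 * (a + b + c) + 150 + (36 * length (?s rD) + 62) + 1)
        (?s(rD := [], rE := rev (map enc_bit (nums_bits (double_nums ms))) @ ?s rE))"
      by (simp add: peek_def)
    then show ?thesis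
      by (rule runs_weaken)
        (use D 8 double_nums_simps(8)[of a b c ms] in \<open>simp_all add: fun_eq_iff num_rev_def enc_bit_def replicate_append_same\<close>)
  qed
qed

definition double_prog :: com where
  "double_prog = (copy_num ;; copy_num ;; Until rD [0] gate_prog) ;; move_bits rE rD"

text \<open>Two copies with roughly doubled operands give the factor \<open>4\<close>. Over
  \<open>l\<close> rounds it becomes \<open>(2 ^ l)^2\<close>, the square of the number of samples,
  and stays polynomial.\<close>

lemma length_double_nums: "length (nums_bits (double_nums ns)) \<le> 4 * length (nums_bits ns)"
proof (induction ns rule: length_induct)
  case (1 ns)
  show ?case
  proof (cases ns rule: parse_cases)
    case (7 a ms)
    then have "length (nums_bits (double_nums ms)) \<le> 4 * length (nums_bits ms)" using 1 by auto
    then show ?thesis using 7 by (simp add: double_nums_simps)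
  next
    case (8 a b c ms)
    then have "length (nums_bits (double_nums ms)) \<le> 4 * length (nums_bits ms)" using 1 by auto
    then show ?thesis using 8 double_nums_simps(8)[of a b c ms] by simp
  next
    case 3
    then show ?thesis using double_nums_simps(3) by simp
  next
    case 4
    then show ?thesis using double_nums_simps(4) by simp
  next
    case 5
    then show ?thesis using double_nums_simps(5) by simp
  qed (simp_all add: double_nums_simps)
qed

lemma double_bits_cases:
  obtains (none) r where "bs = replicate r True" "double_bits bs = replicate (2 * r) True"
  | (one) n r where "bs = nums_bits [n] @ replicate r True" "double_bits bs = nums_bits [2 * n] @ replicate (2 * r) True"
  | (more) n m ns r where "bs = nums_bits (n # m # ns) @ replicate r True"
      "double_bits bs = nums_bits (2 * n # 2 * m # double_nums ns)"
proof -
  obtain r where r: "bs = nums_bits (unary_nums 0 bs) @ replicate r True"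
    using bits_decomp[of 0 bs] by auto
  show thesis
  proof (cases "unary_nums 0 bs" rule: remdups_adj.cases)
    case 1
    then have "bs = replicate r True" using r by simp
    then show thesis using 1 by (intro none[of r]) (simp_all add: double_bits_def)
  next
    case (2 n)
    then have bs: "bs = nums_bits [n] @ replicate r True" using r by simp
    then have "length bs = n + 1 + r" by simp
    then show thesis using 2 by (intro one[OF bs]) (simp add: double_bits_def)
  next
    case (3 n m ns)
    then have bs: "bs = nums_bits (n # m # ns) @ replicate r True" using r by simp
    then show thesis using 3 by (intro more[OF bs]) (simp add: double_bits_def)
  qed
qed

lemma length_double_bits: "length (double_bits bs) \<le> 4 * length bs"
proof (cases bs rule: double_bits_cases)
  case (more n m ns r)
  then show ?thesis using length_double_nums[of ns] by simp
qed auto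

lemma runs_double_prog:
  assumes "s rD = map enc_bit bs" "s rE = []" "clean s"
  shows "runs inp double_prog s (90 * length bs + 100) (s(rD := map enc_bit (double_bits bs)))"
proof -
  have "\<exists>T \<le> 48 * length bs + 80. runs inp (copy_num ;; copy_num ;; Until rD [0] gate_prog) s T
      (s(rD := [], rE := rev (map enc_bit (double_bits bs))))"
  proof (cases bs rule: double_bits_cases)
    case (none r)
    have D: "s rD = replicate r 2" using none assms by (simp add: enc_bit_def)
    let ?s = "s(rD := [], rE := replicate (2 * r) 2)"
    have c1: "runs inp copy_num s (6 * r + 7) ?s"
      using runs_copy_num_end[of s r, OF D, of inp] assms by simp
    have c2: "runs inp copy_num ?s (6 * 0 + 7) ?s"
      by (rule runs_weaken[OF runs_copy_num_end[of ?s 0]]) (auto simp: fun_eq_iff)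
    have c3: "runs inp (Until rD [0] gate_prog) ?s 1 ?s"
      by (rule runs_Until_stop) (simp add: peek_def)
    from runs_Seq[OF c1 runs_Seq[OF c2 c3]]
    have "runs inp (copy_num ;; copy_num ;; Until rD [0] gate_prog) s (48 * length bs + 80) ?s"
      by (rule runs_mono) (simp add: none)
    then show ?thesis using none by (auto simp: enc_bit_def)
  next
    case (one n r)
    have D: "s rD = replicate n 2 @ 1 # replicate r 2" using one assms by (simp add: enc_bit_def)
    let ?s1 = "s(rD := replicate r 2, rE := 1 # replicate (2 * n) 2)"
    let ?s2 = "s(rD := [], rE := replicate (2 * r) 2 @ 1 # replicate (2 * n) 2)"
    have c1: "runs inp copy_num s (6 * n + 7) ?s1"
      using runs_copy_num[of s n "replicate r 2", OF D] assms by simp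
    have c2: "runs inp copy_num ?s1 (6 * r + 7) ?s2"
      by (rule runs_weaken[OF runs_copy_num_end[of ?s1 r]]) (auto simp: fun_eq_iff)
    have c3: "runs inp (Until rD [0] gate_prog) ?s2 1 ?s2"
      by (rule runs_Until_stop) (simp add: peek_def)
    from runs_Seq[OF c1 runs_Seq[OF c2 c3]]
    have "runs inp (copy_num ;; copy_num ;; Until rD [0] gate_prog) s (48 * length bs + 80) ?s2"
      by (rule runs_mono) (simp add: one)
    then show ?thesis using one by (auto simp: enc_bit_def)
  next
    case (more n m ns r)
    let ?l = "map enc_bit (nums_bits ns @ replicate r True)"
    have D: "s rD = replicate n 2 @ 1 # replicate m 2 @ 1 # ?l" using more assms by (simp add: enc_bit_def)
    let ?s1 = "s(rD := replicate m 2 @ 1 # ?l, rE := num_rev (2 * n))"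
    let ?s2 = "s(rD := ?l, rE := num_rev (2 * m) @ num_rev (2 * n))"
    let ?s3 = "s(rD := [], rE := rev (map enc_bit (nums_bits (double_nums ns))) @ num_rev (2 * m) @ num_rev (2 * n))"
    have c1: "runs inp copy_num s (6 * n + 7) ?s1"
      using runs_copy_num[of s n "replicate m 2 @ 1 # ?l", OF D] assms by (simp add: num_rev_def)
    have c2: "runs inp copy_num ?s1 (6 * m + 7) ?s2"
      by (rule runs_weaken[OF runs_copy_num[of ?s1 m ?l]]) (auto simp: fun_eq_iff num_rev_def)
    have c3: "runs inp (Until rD [0] gate_prog) ?s2 (36 * length (?s2 rD) + 62) ?s3"
      by (rule runs_weaken[OF runs_gates[of ?s2 ns r]]) (use assms in \<open>auto simp: fun_eq_iff clean_def\<close>)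
    have eq: "?s3 = s(rD := [], rE := rev (map enc_bit (double_bits bs)))"
      using more num_rev_code[of "2 * n" "2 * m # double_nums ns"] num_rev_code[of "2 * m" "double_nums ns"]
      by simp
    have "length bs = n + m + 2 + length ?l" using more by simp
    then have "6 * n + 7 + (6 * m + 7 + (36 * length (?s2 rD) + 62) + 1) + 1 \<le> 48 * length bs + 80"
      by simp
    then show ?thesis using runs_Seq[OF c1 runs_Seq[OF c2 c3]] eq by metis
  qed
  then obtain T where T: "T \<le> 48 * length bs + 80" "runs inp (copy_num ;; copy_num ;; Until rD [0] gate_prog) s T
      (s(rD := [], rE := rev (map enc_bit (double_bits bs))))"
    by blast
  let ?s = "s(rD := [], rE := rev (map enc_bit (double_bits bs)))"
  have mv: "runs inp (move_bits rE rD) ?s (10 * length (?s rE) + 1) (?s(rE := [], rD := rev (?s rE) @ ?s rD))"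
    by (rule runs_move_bits) (use enc_bits_subset in auto)
  from runs_Seq[OF T(2) mv] have "runs inp double_prog s (T + (10 * length (?s rE) + 1) + 1) (?s(rE := [], rD := rev (?s rE) @ ?s rD))"
    unfolding double_prog_def .
  then show ?thesis
    by (rule runs_weaken)
      (use T(1) length_double_bits[of bs] assms in \<open>auto simp: fun_eq_iff rev_map\<close>)
qed

section \<open>Logarithmically many rounds\<close>

text \<open>The bit length of \<open>x\<close>, in a form that a stack program can follow: halve
  until nothing is left. It is the least \<open>l\<close> with \<open>x < 2 ^ l\<close>, so
  \<open>2 ^ l\<close> exceeds a prescribed polynomial \<open>x\<close> and yet remains
  polynomial.\<close>

fun rounds :: "nat \<Rightarrow> nat" where
  "rounds x = (if x = 0 then 0 else Suc (rounds (x div 2)))"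

declare rounds.simps [simp del]

lemma less_power_rounds: "x < 2 ^ rounds x"
proof (induction x rule: rounds.induct)
  case (1 x)
  then show ?case by (cases "x = 0") (auto simp: rounds.simps[of x])
qed

lemma power_rounds_le_double: "0 < x \<Longrightarrow> 2 ^ rounds x \<le> 2 * x"
proof (induction x rule: rounds.induct)
  case (1 x)
  show ?case
  proof (cases "x = 1")
    case True
    then show ?thesis by (simp add: rounds.simps[of "Suc 0"] rounds.simps[of 0])
  next
    case False
    then have "2 ^ rounds (x div 2) \<le> 2 * (x div 2)" using 1 by auto
    then show ?thesis using 1(2) rounds.simps[of x] by simp
  qed
qed

lemma power_rounds_le: "2 ^ rounds x \<le> 2 * x + 1"
  using power_rounds_le_double[of x] by (cases "x = 0") (auto simp: rounds.simps)

lemma rounds_le: "rounds x \<le> x"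
proof (induction x rule: rounds.induct)
  case (1 x)
  show ?case
  proof (cases "x = 0")
    case False
    then have "rounds (x div 2) < x" using 1 by (meson div_less_dividend le_less_trans one_less_numeral_iff semiring_norm(76) not_gr_zero)
    then show ?thesis using False by (simp add: rounds.simps[of x])
  qed (simp add: rounds.simps)
qed

lemma div_power_rounds: "x div 2 ^ i = 0 \<longleftrightarrow> rounds x \<le> i"
proof (induction x arbitrary: i rule: rounds.induct)
  case (1 x)
  show ?case
  proof (cases "x = 0")
    case False
    show ?thesis
    proof (cases i)
      case 0
      then show ?thesis using False by (simp add: rounds.simps[of x])
    next
      case (Suc j)
      have "x div 2 ^ i = x div 2 div 2 ^ j" by (simp add: Suc div_mult2_eq)
      then show ?thesis using 1[OF False, of j] False Suc by (simp add: rounds.simps[of x])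
    qed
  qed (simp add: rounds.simps)
qed

definition round_loop :: "com \<Rightarrow> com" where
  "round_loop c = Until rX [0] (halve ;; c)"

text \<open>\<open>J\<close> describes the stacks apart from the counter \<open>rX\<close>. The body
  has to work for every counter value \<open>y\<close>, so no invariant needs to mention the halved
  counter.\<close>

lemma runs_round_loop:
  assumes "\<And>i. J i rTmp = []"
    and "\<And>i y. i < rounds x \<Longrightarrow> runs inp c ((J i)(rX := U y)) B ((J (Suc i))(rX := U y))"
  shows "runs inp (round_loop c) ((J 0)(rX := U x)) (rounds x * (14 * x + B + 5) + 1) ((J (rounds x))(rX := []))"
proof -
  define I where "I i = (J i)(rX := U (x div 2 ^ i))" for i
  have "runs inp (round_loop c) (I 0) (rounds x * ((14 * x + 3) + B + 1 + 1) + 1) (I (rounds x))"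
    unfolding round_loop_def
  proof (rule runs_Until)
    fix i assume i: "i < rounds x"
    then have nz: "x div 2 ^ i \<noteq> 0" using div_power_rounds[of x i] by simp
    have "runs inp halve (I i) (14 * (x div 2 ^ i) + 3) ((I i)(rX := U (x div 2 ^ i div 2)))"
      by (rule runs_halve) (use assms(1) in \<open>auto simp: I_def\<close>)
    then have "runs inp halve (I i) (14 * x + 3) ((J i)(rX := U (x div 2 ^ Suc i)))"
      by (rule runs_weaken) (auto simp: I_def fun_eq_iff div_mult2_eq[symmetric] mult.commute)
    from runs_Seq[OF this assms(2)[OF i]]
    show "peek (I i) rX \<notin> set [0] \<and> runs inp (halve ;; c) (I i) ((14 * x + 3) + B + 1) (I (Suc i))"
      using nz by (cases "x div 2 ^ i") (auto simp: I_def peek_def)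
  qed (use div_power_rounds[of x "rounds x"] in \<open>auto simp: I_def peek_def\<close>)
  then show ?thesis
    using div_power_rounds[of x "rounds x"] by (auto simp: I_def algebra_simps)
qed

section \<open>Selecting one of the interleaved samples\<close>

fun evens :: "'a list \<Rightarrow> 'a list" where
  "evens (x # y # xs) = x # evens xs"
| "evens xs = xs"

definition odds :: "'a list \<Rightarrow> 'a list" where
  "odds xs = evens (tl xs)"

lemma length_evens: "length (evens xs) \<le> length xs"
  by (induction xs rule: evens.induct) auto

text \<open>Taking the odd positions means dropping the head and then taking the even ones, so the
  random bit only decides about one initial \<open>Pop\<close> and a single loop serves both
  cases.\<close>

definition split_prog :: com where
  "split_prog = Read rZ ;; Cond rZ [2] (Pop rD) Skip ;; Pop rZ ;;
     Until rD [0] (switch rD [1, 2] (\<lambda>x. Pop rD ;; Push rE x) ;; Pop rD) ;; move_bits rE rD"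

lemma runs_evens:
  assumes "s rD = map enc_bit bs"
  shows "runs inp (Until rD [0] (switch rD [1, 2] (\<lambda>x. Pop rD ;; Push rE x) ;; Pop rD)) s (12 * length bs + 1)
    (s(rD := [], rE := rev (map enc_bit (evens bs)) @ s rE))"
  using assms
proof (induction bs arbitrary: s rule: evens.induct)
  let ?c = "switch rD [1, 2] (\<lambda>x. Pop rD ;; Push rE x) ;; Pop rD"
  have st: "straight ?c" by simp
  have cost: "cost ?c = 11" by simp
  {
    case (1 x y xs)
    let ?s = "s(rD := map enc_bit xs, rE := enc_bit x # s rE)"
    have "sem inp ?c s = ?s" using 1(2) by (auto simp: peek_def enc_bit_def fun_eq_iff)
    then have body: "runs inp ?c s 11 ?s" using runs_line[OF st] cost by (metis order_refl)
    have IH: "runs inp (Until rD [0] ?c) ?s (12 * length xs + 1) (?s(rD := [], rE := rev (map enc_bit (evens xs)) @ ?s rE))"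
      by (rule 1(1)) simp
    have "peek s rD \<notin> set [0]" using 1(2) by (simp add: peek_def enc_bit_def)
    from runs_Until_loop[OF this body IH] have "runs inp (Until rD [0] ?c) s (12 * length (x # y # xs) + 1)
        (s(rD := [], rE := rev (map enc_bit (evens (x # y # xs))) @ s rE))"
      by (rule runs_weaken) (auto simp: fun_eq_iff)
    then show ?case .
  next
    case "2_1"
    then have "peek s rD \<in> set [0]" by (simp add: peek_def)
    from runs_Until_stop[OF this, of inp ?c]
    have "runs inp (Until rD [0] ?c) s (12 * length ([] :: bool list) + 1)
        (s(rD := [], rE := rev (map enc_bit (evens [])) @ s rE))"
      by (rule runs_weaken) (use "2_1" in \<open>auto simp: fun_eq_iff\<close>)
    then show ?case .
  next
    case ("2_2" x)
    let ?s = "s(rD := [], rE := enc_bit x # s rE)"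
    have "sem inp ?c s = ?s" using "2_2" by (auto simp: peek_def enc_bit_def fun_eq_iff)
    then have body: "runs inp ?c s 11 ?s" using runs_line[OF st] cost by (metis order_refl)
    have stop: "peek ?s rD \<in> set [0]" by (simp add: peek_def)
    have "peek s rD \<notin> set [0]" using "2_2" by (simp add: peek_def enc_bit_def)
    from runs_Until_loop[OF this body runs_Until_stop[OF stop]] have "runs inp (Until rD [0] ?c) s (12 * length [x] + 1)
        (s(rD := [], rE := rev (map enc_bit (evens [x])) @ s rE))"
      by (rule runs_weaken) (auto simp: fun_eq_iff)
    then show ?case .
  }
qed

lemma runs_split_prog:
  assumes "s rD = map enc_bit bs" "s rE = []" "s rZ = []" "s 0 = U p" "inp p = enc_bit b"
  shows "runs inp split_prog s (22 * length bs + 15)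
    (s(0 := U (Suc p), rD := map enc_bit (if b then odds bs else evens bs)))"
proof -
  let ?bs = "if b then tl bs else bs"
  let ?s = "s(0 := U (Suc p), rD := map enc_bit ?bs)"
  have "runs inp (Read rZ) s 2 (s(0 := U (Suc p), rZ := [enc_bit b]))"
    using assms by (intro runs_line) (auto simp: fun_eq_iff read_sym_def enc_bit_def)
  moreover have "runs inp (Cond rZ [2] (Pop rD) Skip) (s(0 := U (Suc p), rZ := [enc_bit b])) 3
      (s(0 := U (Suc p), rZ := [enc_bit b], rD := map enc_bit ?bs))"
    using assms by (intro runs_line) (auto simp: fun_eq_iff peek_def enc_bit_def map_tl)
  moreover have "runs inp (Pop rZ) (s(0 := U (Suc p), rZ := [enc_bit b], rD := map enc_bit ?bs)) 1 ?s"
    using assms by (intro runs_line) (auto simp: fun_eq_iff)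
  moreover have "runs inp (Until rD [0] (switch rD [1, 2] (\<lambda>x. Pop rD ;; Push rE x) ;; Pop rD)) ?s
      (12 * length ?bs + 1) (?s(rD := [], rE := rev (map enc_bit (evens ?bs)) @ ?s rE))"
    by (rule runs_evens) simp
  moreover have "runs inp (move_bits rE rD) (?s(rD := [], rE := rev (map enc_bit (evens ?bs)) @ ?s rE))
     (10 * length ((?s(rD := [], rE := rev (map enc_bit (evens ?bs)) @ ?s rE)) rE) + 1)
     (?s(rD := [], rE := [], rD := rev (rev (map enc_bit (evens ?bs)))))"
    by (rule runs_weaken[OF runs_move_bits]) (use assms enc_bits_subset in \<open>auto simp: fun_eq_iff enc_bit_def\<close>)
  ultimately have "runs inp split_prog s (2 + (3 + (1 + (12 * length ?bs + 1 +
      (10 * length ((?s(rD := [], rE := rev (map enc_bit (evens ?bs)) @ ?s rE)) rE) + 1) + 1) + 1) + 1) + 1)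
     (?s(rD := [], rE := [], rD := rev (rev (map enc_bit (evens ?bs)))))"
    unfolding split_prog_def by (intro runs_Seq)
  then show ?thesis
    by (rule runs_weaken)
      (use assms length_evens[of ?bs] in \<open>auto simp: fun_eq_iff odds_def\<close>)
qed

fun extract_leaf :: "bool list \<Rightarrow> 'a list \<Rightarrow> 'a list" where
  "extract_leaf [] xs = xs"
| "extract_leaf (b # bs) xs = extract_leaf bs (if b then odds xs else evens xs)"

lemma extract_leaf_snoc:
  "extract_leaf (bs @ [b]) xs = (if b then odds (extract_leaf bs xs) else evens (extract_leaf bs xs))"
  by (induction bs arbitrary: xs) auto

lemma length_extract_leaf: "length (extract_leaf bs xs) \<le> length xs"
proof (induction bs rule: rev_induct)
  case (snoc b bs)
  have "length (odds (extract_leaf bs xs)) \<le> length (extract_leaf bs xs)"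
    using length_evens[of "tl (extract_leaf bs xs)"] by (simp add: odds_def)
  then show ?case using snoc length_evens[of "extract_leaf bs xs"] by (auto simp: extract_leaf_snoc)
qed simp

lemma runs_split_rounds:
  assumes "s rD = map enc_bit xs" "s rE = []" "s rZ = []" "s rTmp = []" "s 0 = U p"
    and "length bs = rounds x" "\<And>i. i < rounds x \<Longrightarrow> inp (p + i) = enc_bit (bs ! i)" "s rX = U x"
  shows "runs inp (round_loop split_prog) s (rounds x * (14 * x + (22 * length xs + 15) + 5) + 1)
    (s(0 := U (p + rounds x), rD := map enc_bit (extract_leaf bs xs), rX := []))"
proof -
  define J where "J i = s(0 := U (p + i), rD := map enc_bit (extract_leaf (take i bs) xs))" for i
  have "runs inp (round_loop split_prog) ((J 0)(rX := U x)) (rounds x * (14 * x + (22 * length xs + 15) + 5) + 1)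
    ((J (rounds x))(rX := []))"
  proof (rule runs_round_loop)
    fix i y assume i: "i < rounds x"
    let ?t = "extract_leaf (take i bs) xs"
    have "take (Suc i) bs = take i bs @ [bs ! i]" using i assms(6) by (simp add: take_Suc_conv_app_nth)
    then have e: "extract_leaf (take (Suc i) bs) xs = (if bs ! i then odds ?t else evens ?t)"
      by (simp add: extract_leaf_snoc)
    have "runs inp split_prog ((J i)(rX := U y)) (22 * length ?t + 15)
      ((J i)(rX := U y, 0 := U (Suc (p + i)), rD := map enc_bit (if bs ! i then odds ?t else evens ?t)))"
      by (rule runs_split_prog) (use assms i in \<open>auto simp: J_def\<close>)
    then show "runs inp split_prog ((J i)(rX := U y)) (22 * length xs + 15) ((J (Suc i))(rX := U y))"
      by (rule runs_weaken)
        (use length_extract_leaf[of "take i bs" xs] in \<open>auto simp: J_def fun_eq_iff e\<close>)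
  qed (use assms in \<open>auto simp: J_def\<close>)
  moreover have "(J 0)(rX := U x) = s" using assms by (auto simp: J_def fun_eq_iff)
  ultimately show ?thesis using assms(6) by (simp add: J_def)
qed

lemma length_double_bits_iter: "length ((double_bits ^^ i) bs) \<le> 4 ^ i * length bs"
proof (induction i)
  case (Suc i)
  have "length ((double_bits ^^ Suc i) bs) \<le> 4 * length ((double_bits ^^ i) bs)"
    using length_double_bits by simp
  also have "\<dots> \<le> 4 ^ Suc i * length bs" using Suc by simp
  finally show ?case .
qed simp

text \<open>The square bounds the growth: \<open>4 ^ rounds x = (2 ^ rounds x)^2\<close>, and
  \<open>2 ^ rounds x \<le> 2 * x + 1\<close>.\<close>

lemma runs_double_rounds:
  assumes "s rD = map enc_bit bs" "s rE = []" "clean s" "s rX = U x"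
  shows "runs inp (round_loop double_prog) s (rounds x * (14 * x + (90 * ((2 * x + 1)\<^sup>2 * length bs) + 100) + 5) + 1)
    (s(rD := map enc_bit ((double_bits ^^ rounds x) bs), rX := []))"
proof -
  define J where "J i = s(rD := map enc_bit ((double_bits ^^ i) bs))" for i
  have "runs inp (round_loop double_prog) ((J 0)(rX := U x))
      (rounds x * (14 * x + (90 * ((2 * x + 1)\<^sup>2 * length bs) + 100) + 5) + 1) ((J (rounds x))(rX := []))"
  proof (rule runs_round_loop)
    fix i y assume i: "i < rounds x"
    have "(4::nat) ^ i \<le> 4 ^ rounds x" using i by (intro power_increasing) auto
    also have "\<dots> = (2 ^ rounds x)\<^sup>2" by (simp add: power_mult[symmetric] power2_eq_square power_mult_distrib[symmetric])
    also have "\<dots> \<le> (2 * x + 1)\<^sup>2" by (rule power_mono[OF power_rounds_le]) simp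
    finally have "4 ^ i * length bs \<le> (2 * x + 1)\<^sup>2 * length bs" by (rule mult_right_mono) simp
    then have len: "length ((double_bits ^^ i) bs) \<le> (2 * x + 1)\<^sup>2 * length bs"
      using length_double_bits_iter order.trans by blast
    have "runs inp double_prog ((J i)(rX := U y)) (90 * length ((double_bits ^^ i) bs) + 100)
      ((J i)(rX := U y, rD := map enc_bit (double_bits ((double_bits ^^ i) bs))))"
      by (rule runs_double_prog) (use assms in \<open>auto simp: J_def clean_def\<close>)
    then show "runs inp double_prog ((J i)(rX := U y)) (90 * ((2 * x + 1)\<^sup>2 * length bs) + 100) ((J (Suc i))(rX := U y))"
      by (rule runs_weaken) (use len in \<open>auto simp: J_def fun_eq_iff\<close>)
  qed (use assms in \<open>auto simp: J_def clean_def\<close>)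
  moreover have "(J 0)(rX := U x) = s" using assms by (auto simp: J_def fun_eq_iff)
  ultimately show ?thesis by (simp add: J_def)
qed

section \<open>Simulating a machine with two stacks\<close>

text \<open>
  The simulated tape is cut at the head: \<open>rL\<close> holds the cells to its left, \<open>rR\<close> the scanned cell and those to its right.
  The flag in a cell code marks cell \<open>0\<close>, so that the output can be found again.
\<close>

definition cell_code :: "nat \<Rightarrow> bool \<Rightarrow> nat" where
  "cell_code a f = 2 * a + 1 + of_bool f"

definition code_sym :: "nat \<Rightarrow> nat" where
  "code_sym x = (x - 1) div 2"

definition code_flag :: "nat \<Rightarrow> bool" where
  "code_flag x \<longleftrightarrow> x \<noteq> 0 \<and> even x"

lemma code_simps [simp]: "code_sym (cell_code a f) = a" "code_flag (cell_code a f) = f" "0 < cell_code a f"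
  "code_sym 0 = 0" "code_flag 0 = False"
  by (auto simp: cell_code_def code_sym_def code_flag_def)

text \<open>States are stored shifted by one because \<open>0\<close> means an empty stack, whence
  \<open>q - 1\<close>. Tape beyond the stored part is blank: an empty \<open>rR\<close> has code
  \<open>0\<close>, whose symbol is \<open>0\<close>, and a left move over an empty
  \<open>rL\<close> supplies \<open>1\<close>, the code of an unflagged blank.\<close>

definition step_entry :: "tm \<Rightarrow> nat \<Rightarrow> nat \<Rightarrow> nat \<Rightarrow> com" where
  "step_entry M S q x = (case map_of M (q - 1, code_sym x) of
     None \<Rightarrow> Skip
   | Some (q', a, d) \<Rightarrow> Pop rQ ;; Push rQ (q' + 1) ;; Pop rR ;;
       (case d of
          Stay \<Rightarrow> Push rR (cell_code a (code_flag x))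
        | Rgt \<Rightarrow> Push rL (cell_code a (code_flag x))
        | Lft \<Rightarrow> Push rR (cell_code a (code_flag x)) ;;
            Cond rL [0] (Push rR 1) (switch rL [1..<S] (\<lambda>y. Pop rL ;; Push rR y))))"

definition step_prog :: "tm \<Rightarrow> nat \<Rightarrow> com" where
  "step_prog M S = switch rQ [0..<S] (\<lambda>q. switch rR [0..<S] (\<lambda>x. step_entry M S q x))"

text \<open>The number \<open>9\<close> exceeds the largest code of a raw symbol,
  \<open>cell_code 3 True = 8\<close>; the other inequalities do the same for the symbols in the
  table and for the shifted states.\<close>

definition tm_bound :: "tm \<Rightarrow> nat \<Rightarrow> bool" where
  "tm_bound M S \<longleftrightarrow> 9 \<le> S \<and> (\<forall>q a q' a' d. ((q, a), (q', a', d)) \<in> set M \<longrightarrow>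
     q + 2 < S \<and> q' + 2 < S \<and> 2 * a + 3 < S \<and> 2 * a' + 3 < S)"

lemma ex_tm_bound: "\<exists>S. tm_bound M S"
proof -
  have "\<exists>S \<ge> 9. \<forall>q a q' a' d. ((q, a), (q', a', d)) \<in> set M \<longrightarrow>
     q + 2 < S \<and> q' + 2 < S \<and> 2 * a + 3 < S \<and> 2 * a' + 3 < S"
  proof (induction M)
    case (Cons e M)
    then obtain S where S: "S \<ge> 9" "\<And>q a q' a' d. ((q, a), (q', a', d)) \<in> set M \<Longrightarrow>
     q + 2 < S \<and> q' + 2 < S \<and> 2 * a + 3 < S \<and> 2 * a' + 3 < S" by blast
    obtain q a q' a' d where e: "e = ((q, a), (q', a', d))" by (metis prod.exhaust)
    show ?case
      by (rule exI[of _ "S + q + q' + 2 * a + 2 * a' + 4"]) (use S e in \<open>fastforce\<close>)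
  qed auto
  then show ?thesis unfolding tm_bound_def by blast
qed

lemma wf_step_prog: "tm_bound M S \<Longrightarrow> wf_com nregs S (step_prog M S)"
proof -
  assume M: "tm_bound M S"
  have "wf_com nregs S (step_entry M S q x)" for q x
  proof (cases "map_of M (q - 1, code_sym x)")
    case (Some e)
    obtain q' a d where e: "e = (q', a, d)" by (metis prod.exhaust)
    have "((q - 1, code_sym x), (q', a, d)) \<in> set M" using map_of_SomeD[OF Some] e by simp
    then have "q' + 2 < S" "2 * a + 3 < S" "9 \<le> S" using M unfolding tm_bound_def by blast+
    then have "q' + 1 < S" "cell_code a b < S" "9 \<le> S" for b by (auto simp: cell_code_def)
    then show ?thesis using Some e by (auto simp: step_entry_def intro!: wf_switch split: dir.split)
  qed (simp add: step_entry_def)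
  then show ?thesis unfolding step_prog_def by (auto intro!: wf_switch)
qed

lemma straight_step_prog: "straight (step_prog M S)"
  by (auto simp: step_prog_def step_entry_def intro!: straight_switch split: option.split prod.split dir.split)

text \<open>The default \<open>1\<close> is the code of an unflagged blank, so finite stacks stand
  for infinite half tapes.\<close>

definition look :: "nat list \<Rightarrow> nat \<Rightarrow> nat" where
  "look l i = (if i < length l then l ! i else 1)"

lemma look_Cons: "look (x # l) i = (case i of 0 \<Rightarrow> x | Suc j \<Rightarrow> look l j)"
  by (cases i) (auto simp: look_def)

lemma look_tl: "look (tl l) i = look l (Suc i)"
  by (cases l) (auto simp: look_def)

definition tape_split :: "nat \<Rightarrow> config \<Rightarrow> nat list \<Rightarrow> nat list \<Rightarrow> bool" where
  "tape_split S c l r \<longleftrightarrow> (case c of (q, tp, h) \<Rightarrow>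
     (\<forall>i. look r i = cell_code (tp (h + int i)) (h + int i = 0)) \<and>
     (\<forall>i. look l i = cell_code (tp (h - 1 - int i)) (h - 1 - int i = 0)) \<and>
     (\<forall>x \<in> set l \<union> set r. 0 < x \<and> x < S))"

lemma look_peek: "(\<forall>x \<in> set l. 0 < x) \<Longrightarrow>
  code_sym (case l of [] \<Rightarrow> 0 | a # _ \<Rightarrow> a) = code_sym (look l 0) \<and>
  code_flag (case l of [] \<Rightarrow> 0 | a # _ \<Rightarrow> a) = code_flag (look l 0)"
  by (cases l) (auto simp: look_def code_sym_def code_flag_def)

lemma step_prog_correct:
  assumes M: "tm_bound M S" and q: "q + 2 < S" and s: "s rQ = [q + 1]" "s rL = l" "s rR = r"
    and h: "tape_split S (q, tp, h) l r" and st: "tm_step M (q, tp, h) = (q1, tp1, h1)"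
  shows "\<exists>l1 r1. sem inp (step_prog M S) s = s(rQ := [q1 + 1], rL := l1, rR := r1) \<and>
    tape_split S (q1, tp1, h1) l1 r1 \<and> q1 + 2 < S"
proof -
  let ?x = "peek s rR"
  have pos: "\<forall>x \<in> set r. 0 < x" "\<forall>x \<in> set l. 0 < x" using h by (auto simp: tape_split_def)
  have S9: "9 \<le> S" using M by (simp add: tm_bound_def)
  have r0: "look r 0 = cell_code (tp h) (h = 0)" using h by (auto simp: tape_split_def)
  have x: "code_sym ?x = tp h" "code_flag ?x = (h = 0)"
    using look_peek[OF pos(1)] r0 s by (simp_all add: peek_def)
  have xS: "?x < S" using h s S9 by (cases r) (auto simp: peek_def tape_split_def)
  have qS: "peek s rQ = q + 1" "q + 1 < S" using s q by (auto simp: peek_def)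
  have sem1: "sem inp (step_prog M S) s = sem inp (step_entry M S (q + 1) ?x) s"
    unfolding step_prog_def sem_switch using xS qS by simp
  show ?thesis
  proof (cases "map_of M (q, tp h)")
    case None
    then have "sem inp (step_prog M S) s = s" "(q1, tp1, h1) = (q, tp, h)"
      using sem1 x st by (auto simp: step_entry_def tm_step_def)
    moreover have "s = s(rQ := [q + 1], rL := l, rR := r)" using s by (auto simp: fun_eq_iff)
    ultimately show ?thesis using h q by auto
  next
    case (Some e)
    obtain q' a d where e: "e = (q', a, d)" by (metis prod.exhaust)
    have "((q, tp h), (q', a, d)) \<in> set M" using map_of_SomeD[OF Some] e by simp
    then have b: "q' + 2 < S" "2 * a + 3 < S" using M unfolding tm_bound_def by blast+
    have eq: "q1 = q'" "tp1 = tp(h := a)" "h1 = h + move d"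
      using st Some e by (auto simp: tm_step_def)
    let ?a = "cell_code a (h = 0)"
    have aS: "0 < ?a" "?a < S" using b by (auto simp: cell_code_def)
    have L: "look l i = cell_code (tp (h - 1 - int i)) (h - 1 - int i = 0)"
      and R: "look r i = cell_code (tp (h + int i)) (h + int i = 0)" for i
      using h by (auto simp: tape_split_def)
    have bnd: "\<forall>x \<in> set l \<union> set r. 0 < x \<and> x < S" using h by (auto simp: tape_split_def)
    have bnd': "\<forall>x \<in> set (tl l) \<union> set (tl r). 0 < x \<and> x < S"
      using bnd by (metis Un_iff list.set_sel(2) tl_Nil)
    show ?thesis
    proof (cases d)
      case Stay
      have "sem inp (step_prog M S) s = s(rQ := [q' + 1], rL := l, rR := ?a # tl r)"
        unfolding sem1 using Some e x Stay s by (auto simp: step_entry_def fun_eq_iff)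
      moreover have "tape_split S (q1, tp1, h1) l (?a # tl r)"
        using L R bnd bnd' aS unfolding tape_split_def eq
        by (auto simp: Stay move_def look_Cons look_tl split: nat.split)
      ultimately show ?thesis using b eq by blast
    next
      case Rgt
      have "sem inp (step_prog M S) s = s(rQ := [q' + 1], rL := ?a # l, rR := tl r)"
        unfolding sem1 using Some e x Rgt s by (auto simp: step_entry_def fun_eq_iff)
      moreover have "tape_split S (q1, tp1, h1) (?a # l) (tl r)"
        using L R bnd bnd' aS unfolding tape_split_def eq
        by (auto simp: Rgt move_def look_Cons look_tl algebra_simps split: nat.split)
      ultimately show ?thesis using b eq by blast
    next
      case Lft
      let ?y = "look l 0"
      have "sem inp (step_prog M S) s = s(rQ := [q' + 1], rL := tl l, rR := ?y # ?a # tl r)"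
      proof (cases l)
        case Nil
        then show ?thesis
          unfolding sem1 using Some e x Lft s by (auto simp: step_entry_def fun_eq_iff peek_def look_def)
      next
        case (Cons y l')
        then have "0 < y" "y < S" using bnd by auto
        then show ?thesis
          unfolding sem1 using Some e x Lft s Cons
          by (auto simp: step_entry_def fun_eq_iff peek_def look_def sem_switch)
      qed
      moreover have "tape_split S (q1, tp1, h1) (tl l) (?y # ?a # tl r)"
      proof -
        have "0 < ?y" "?y < S" using bnd S9 by (cases l; auto simp: look_def)+
        then show ?thesis
          using L R bnd' aS unfolding tape_split_def eq
          by (auto simp: Lft move_def look_Cons look_tl algebra_simps split: nat.split)
      qed
      ultimately show ?thesis using b eq by blast
    qed
  qed
qed

definition sim_prog :: "tm \<Rightarrow> nat \<Rightarrow> com" where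
  "sim_prog M S = Push rQ 1 ;; Until rT [0] (Pop rT ;; step_prog M S)"

lemma runs_sim_prog:
  assumes M: "tm_bound M S" and s: "s rQ = []" "s rL = l" "s rR = r" "s rT = U t"
    and h: "tape_split S (0, tp, h) l r" and run: "tm_run M t (0, tp, h) = (q1, tp1, h1)"
  shows "\<exists>l1 r1. runs inp (sim_prog M S) s (t * (cost (step_prog M S) + 3) + 3)
      (s(rT := [], rQ := [q1 + 1], rL := l1, rR := r1)) \<and> tape_split S (q1, tp1, h1) l1 r1 \<and>
    length l1 \<le> length l + (t * (cost (step_prog M S) + 3) + 3) \<and>
    length r1 \<le> length r + (t * (cost (step_prog M S) + 3) + 3)"
proof -
  let ?c = "Pop rT ;; step_prog M S"
  define I where "I i = (sem inp ?c ^^ i) (s(rQ := [1]))" for i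
  have st: "straight ?c" using straight_step_prog by simp
  have inv: "\<exists>l1 r1. I i = s(rT := U (t - i), rQ := [fst (tm_run M i (0, tp, h)) + 1], rL := l1, rR := r1) \<and>
    tape_split S (tm_run M i (0, tp, h)) l1 r1 \<and> fst (tm_run M i (0, tp, h)) + 2 < S" if "i \<le> t" for i
    using that
  proof (induction i)
    case 0
    have "I 0 = s(rT := U t, rQ := [1], rL := l, rR := r)" using s by (auto simp: I_def fun_eq_iff)
    then show ?case using h M by (intro exI[of _ l] exI[of _ r]) (auto simp: tm_run_def tm_bound_def)
  next
    case (Suc i)
    obtain q tp' h' where c: "tm_run M i (0, tp, h) = (q, tp', h')" by (metis prod.exhaust)
    then obtain l1 r1 where IH: "I i = s(rT := U (t - i), rQ := [q + 1], rL := l1, rR := r1)"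
      "tape_split S (q, tp', h') l1 r1" "q + 2 < S"
      using Suc.IH[OF Suc_leD[OF Suc.prems]] unfolding c fst_conv by blast
    obtain q2 tp2 h2 where c2: "tm_step M (q, tp', h') = (q2, tp2, h2)" by (metis prod.exhaust)
    have c': "tm_run M (Suc i) (0, tp, h) = (q2, tp2, h2)" using c c2 by (simp add: tm_run_def)
    let ?s = "s(rT := U (t - Suc i), rQ := [q + 1], rL := l1, rR := r1)"
    have "tl (U (t - i)) = U (t - Suc i)" using Suc(2) by (metis Suc_diff_Suc Suc_le_eq list.sel(3) replicate_Suc)
    then have "sem inp (Pop rT) (I i) = ?s" unfolding IH(1) by (auto simp: fun_eq_iff)
    then have step: "I (Suc i) = sem inp (step_prog M S) ?s" by (simp add: I_def)
    obtain l2 r2 where "sem inp (step_prog M S) ?s = ?s(rQ := [q2 + 1], rL := l2, rR := r2)"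
      "tape_split S (q2, tp2, h2) l2 r2" "q2 + 2 < S"
      using step_prog_correct[OF M IH(3) _ _ _ IH(2) c2, of ?s inp] by auto
    then show ?case unfolding step c'
      by (intro exI[of _ l2] exI[of _ r2]) (auto simp: fun_eq_iff)
  qed
  have loop: "runs inp (Until rT [0] ?c) (I 0) (t * (cost ?c + 1) + 1) (I t)"
  proof (rule runs_Until)
    fix i assume i: "i < t"
    then obtain d where "t - i = Suc d" by (metis Suc_diff_Suc)
    then have "peek (I i) rT \<notin> set [0]" using inv[of i] i by (auto simp: peek_def)
    moreover have "runs inp ?c (I i) (cost ?c) (I (Suc i))"
      using runs_straight[OF st, of inp "I i"] by (simp add: I_def)
    ultimately show "peek (I i) rT \<notin> set [0] \<and> runs inp ?c (I i) (cost ?c) (I (Suc i))" by blast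
  qed (use inv[of t] in \<open>auto simp: peek_def\<close>)
  have push: "runs inp (Push rQ 1) s 1 (I 0)"
    by (rule runs_line) (auto simp: I_def s)
  obtain l1 r1 where f: "I t = s(rT := [], rQ := [q1 + 1], rL := l1, rR := r1)" "tape_split S (q1, tp1, h1) l1 r1"
    using inv[of t] run by auto
  have R: "runs inp (sim_prog M S) s (t * (cost (step_prog M S) + 3) + 3) (I t)"
    unfolding sim_prog_def by (rule runs_mono[OF runs_Seq[OF push loop]]) (simp add: algebra_simps)
  show ?thesis using R f s runs_length[OF R, of rL] runs_length[OF R, of rR]
    by (intro exI[of _ l1] exI[of _ r1]) simp
qed

definition flag_codes :: "nat \<Rightarrow> nat list" where
  "flag_codes S = 0 # filter code_flag [0..<S]"

text \<open>The codes \<open>3\<close>, \<open>4\<close> belong to the symbol \<open>1\<close> and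
  \<open>5\<close>, \<open>6\<close> to the symbol \<open>2\<close>, without and with the flag; this
  also explains the test \<open>x < 5\<close> in \<open>collect_prog\<close>.\<close>

definition non_bit_codes :: "nat \<Rightarrow> nat list" where
  "non_bit_codes S = filter (\<lambda>x. x \<notin> {3, 4, 5, 6}) [0..<S]"

definition collect_prog :: "nat \<Rightarrow> com" where
  "collect_prog S = transfer rL [0] rR [1..<S] id ;; drop_until rR (flag_codes S) ;;
     transfer rR (non_bit_codes S) rE [3, 4, 5, 6] (\<lambda>x. if x < 5 then 1 else 2) ;; move_bits rE rD"

text \<open>\<open>k\<close> is the place of cell \<open>0\<close> in the joined list. It lies
  inside the list because cell \<open>0\<close> carries a flag, whereas every position outside reads
  as an unflagged blank.\<close>

lemma tape_split_merge:
  assumes "tape_split S (q, tp, h) l r"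
  shows "\<exists>k < length (rev l @ r). 
    (\<forall>i. look (rev l @ r) i = cell_code (tp (int i - int k)) (int i = int k))"
proof -
  let ?w = "rev l @ r"
  define b where "b = h - int (length l)"
  have L: "look l i = cell_code (tp (h - 1 - int i)) (h - 1 - int i = 0)"
    and R: "look r i = cell_code (tp (h + int i)) (h + int i = 0)" for i
    using assms by (auto simp: tape_split_def)
  have W: "look ?w i = cell_code (tp (b + int i)) (b + int i = 0)" for i
  proof (cases "i < length l")
    case True
    then have "look ?w i = look l (length l - 1 - i)" by (auto simp: look_def nth_append rev_nth)
    moreover have "h - 1 - int (length l - 1 - i) = b + int i" using True by (simp add: b_def)
    ultimately show ?thesis using L[of "length l - 1 - i"] by simp
  next
    case False
    then have "look ?w i = look r (i - length l)" by (auto simp: look_def nth_append)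
    moreover have "h + int (i - length l) = b + int i" using False by (simp add: b_def)
    ultimately show ?thesis using R[of "i - length l"] by simp
  qed
  have flag: "look x i \<noteq> cell_code a True" if "length x \<le> i" for x i a
    using that by (auto simp: look_def cell_code_def)
  have "b \<le> 0"
  proof (rule ccontr)
    assume "\<not> b \<le> 0"
    then have "length l \<le> nat (h - 1)" "h - 1 - int (nat (h - 1)) = 0" by (auto simp: b_def)
    then show False using L[of "nat (h - 1)"] flag by (metis (full_types))
  qed
  then have k: "b = - int (nat (- b))" by simp
  have "nat (- b) < length ?w"
  proof (rule ccontr)
    assume "\<not> nat (- b) < length ?w"
    then show False using W[of "nat (- b)"] flag[of ?w "nat (- b)"] k by simp
  qed
  moreover have "look ?w i = cell_code (tp (int i - int (nat (- b)))) (int i = int (nat (- b)))" for i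
  proof -
    have b: "b + int i = int i - int (nat (- b))" "(b + int i = 0) = (int i = int (nat (- b)))"
      using k by linarith+
    show ?thesis by (rule W[of i, unfolded b(2), unfolded b(1)])
  qed
  ultimately show ?thesis by blast
qed

lemma runs_collect_prog:
  assumes S: "9 \<le> S" and s: "s rL = l" "s rR = r" "s rE = []" "s rD = []"
    and h: "tape_split S (q, tp, h) l r" and N: "\<And>i. N \<le> i \<Longrightarrow> tp (int i) = 0"
  shows "\<exists>r'. runs inp (collect_prog S) s ((length l + length r) * (4 * S + 40) + 10)
    (s(rL := [], rR := r', rD := map enc_bit (tm_output N (q, tp, h))))"
proof -
  define w where "w = rev l @ r"
  have w: "length w = length l + length r" by (simp add: w_def)
  have bnd: "\<And>x. x \<in> set l \<Longrightarrow> 0 < x \<and> x < S" "\<And>x. x \<in> set w \<Longrightarrow> 0 < x \<and> x < S"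
    using h by (auto simp: tape_split_def w_def)
  obtain k where k: "k < length w" "\<And>i. look w i = cell_code (tp (int i - int k)) (int i = int k)"
    using tape_split_merge[OF h] unfolding w_def by blast
  let ?s1 = "s(rL := [], rR := w)"
  have c1: "runs inp (transfer rL [0] rR [1..<S] id) s (length l * (4 * length [1..<S] + 2) + 1) ?s1"
    by (rule runs_weaken[OF runs_transfer_all]) (use s bnd(1) in \<open>force simp: fun_eq_iff w_def\<close>)+
  let ?w' = "drop k w"
  have wk: "w ! i = cell_code (tp (int i - int k)) (int i = int k)" if "i < length w" for i
    using k(2)[of i] that by (simp add: look_def)
  have "takeWhile (\<lambda>x. x \<notin> set (flag_codes S)) w = take k w"
  proof (rule takeWhile_eq_take_P_nth)
    fix i assume i: "i < k" "i < length w"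
    then have "\<not> code_flag (w ! i)" "0 < w ! i" using wk[OF i(2)] by auto
    then show "w ! i \<notin> set (flag_codes S)" by (simp add: flag_codes_def)
  next
    assume i: "k < length w"
    have "w ! k \<in> set w" using i nth_mem by blast
    then have "w ! k < S" using bnd by auto
    moreover have "code_flag (w ! k)" using wk[OF i] by simp
    ultimately show "\<not> w ! k \<notin> set (flag_codes S)" by (simp add: flag_codes_def)
  qed
  then have dw: "dropWhile (\<lambda>x. x \<notin> set (flag_codes S)) w = ?w'"
    using k(1) by (metis dropWhile_eq_drop length_take min.absorb4)
  let ?s2 = "s(rL := [], rR := ?w')"
  have c2: "runs inp (drop_until rR (flag_codes S)) ?s1 (2 * length w + 1) ?s2"
  proof -
    have "runs inp (drop_until rR (flag_codes S)) ?s1 (2 * length (?s1 rR) + 1)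
        (?s1(rR := dropWhile (\<lambda>x. x \<notin> set (flag_codes S)) (?s1 rR)))"
      by (rule runs_drop_until) (simp add: flag_codes_def)
    then show ?thesis by (rule runs_weaken) (use dw in \<open>auto simp: fun_eq_iff\<close>)
  qed
  let ?P = "\<lambda>x. x \<in> set [3, 4, 5, 6 :: nat]" and ?g = "\<lambda>x :: nat. if x < 5 then 1 else 2 :: nat"
  let ?bit = "\<lambda>a :: nat. a = 1 \<or> a = 2"
  let ?tl = "map (\<lambda>i. tp (int i)) [0..<N]"
  define m where "m = length (takeWhile ?bit ?tl)"
  have w': "?w' ! i = cell_code (tp (int i)) (i = 0)" if "i < length ?w'" for i
    using wk[of "k + i"] that k(1) by simp
  have outside: "tp (int i) = 0" if "length ?w' \<le> i" for i
  proof -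
    have "look w (k + i) = 1" using that k(1) by (auto simp: look_def)
    then show ?thesis using k(2)[of "k + i"] by (simp add: cell_code_def)
  qed
  have mN: "m \<le> N" unfolding m_def using length_takeWhile_le[of ?bit ?tl] by simp
  have mbit: "?bit (tp (int i))" if "i < m" for i
  proof -
    have "takeWhile ?bit ?tl ! i \<in> set (takeWhile ?bit ?tl)" using that nth_mem unfolding m_def by blast
    then have "?bit (takeWhile ?bit ?tl ! i)" using set_takeWhileD by fast
    moreover have "takeWhile ?bit ?tl ! i = tp (int i)"
      using takeWhile_nth[of i ?bit ?tl] that mN by (simp add: m_def)
    ultimately show ?thesis by simp
  qed
  \<comment> \<open>\<open>tm_output\<close> cuts off at \<open>N\<close>, the program does not. If
    all \<open>N\<close> cells hold bits, cell \<open>N\<close> is blank by assumption, and both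
    stop at the same place.\<close>
  have mend: "\<not> ?bit (tp (int m))"
  proof (cases "m < N")
    case True
    then show ?thesis using nth_length_takeWhile[of ?bit ?tl] by (simp add: m_def)
  next
    case False
    then show ?thesis using N[of m] by simp
  qed
  have mw: "m \<le> length ?w'"
  proof (rule ccontr)
    assume "\<not> m \<le> length ?w'"
    then show False using mbit[of "length ?w'"] outside[of "length ?w'"] by simp
  qed
  have tw: "takeWhile ?P ?w' = take m ?w'"
  proof (rule takeWhile_eq_take_P_nth)
    fix i assume "i < m" "i < length ?w'"
    then show "?P (?w' ! i)" using w'[of i] mbit[of i] by (auto simp: cell_code_def)
  next
    assume "m < length ?w'"
    then show "\<not> ?P (?w' ! m)" using w'[of m] mend by (auto simp: cell_code_def split: if_splits)
  qed
  have out: "map ?g (take m ?w') = map enc_bit (tm_output N (q, tp, h))"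
  proof (rule nth_equalityI)
    show "length (map ?g (take m ?w')) = length (map enc_bit (tm_output N (q, tp, h)))"
      using mw by (simp add: tm_output_def m_def)
    fix i assume "i < length (map ?g (take m ?w'))"
    then have i: "i < m" "i < length ?w'" by auto
    have "takeWhile ?bit ?tl ! i = tp (int i)"
      using takeWhile_nth[of i ?bit ?tl] i mN by (simp add: m_def)
    then show "map ?g (take m ?w') ! i = map enc_bit (tm_output N (q, tp, h)) ! i"
      using i mbit[of i] w'[of i] by (auto simp: tm_output_def m_def enc_bit_def cell_code_def)
  qed
  let ?s3 = "s(rL := [], rR := dropWhile ?P ?w', rE := rev (map enc_bit (tm_output N (q, tp, h))))"
  have c3: "runs inp (transfer rR (non_bit_codes S) rE [3, 4, 5, 6] ?g) ?s2 (18 * length w + 1) ?s3"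
  proof -
    have "runs inp (transfer rR (non_bit_codes S) rE [3, 4, 5, 6] ?g) ?s2
        (length (takeWhile ?P (?s2 rR)) * (4 * length [3, 4, 5, 6 :: nat] + 2) + 1)
        (?s2(rR := dropWhile ?P (?s2 rR), rE := map ?g (rev (takeWhile ?P (?s2 rR))) @ ?s2 rE))"
    proof (rule runs_transfer)
      fix x assume "x \<in> insert 0 (set (?s2 rR))"
      then have "x < S" using bnd S by (auto dest: in_set_dropD)
      then show "x \<in> set (non_bit_codes S) \<longleftrightarrow> x \<notin> set [3, 4, 5, 6]" by (auto simp: non_bit_codes_def)
    qed auto
    then show ?thesis
    proof (rule runs_weaken)
      have "map ?g (rev (takeWhile ?P ?w')) = rev (map enc_bit (tm_output N (q, tp, h)))"
        unfolding tw using out by (metis rev_map)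
      then show "?s2(rR := dropWhile ?P (?s2 rR), rE := map ?g (rev (takeWhile ?P (?s2 rR))) @ ?s2 rE) = ?s3"
        using s by (simp add: fun_upd_twist)
      have "length (takeWhile ?P ?w') \<le> length w" unfolding tw by simp
      then show "length (takeWhile ?P (?s2 rR)) * (4 * length [3, 4, 5, 6 :: nat] + 2) + 1 \<le> 18 * length w + 1"
        by simp
    qed
  qed
  have c4: "runs inp (move_bits rE rD) ?s3 (10 * length (?s3 rE) + 1) (?s3(rE := [], rD := rev (?s3 rE) @ ?s3 rD))"
    by (rule runs_move_bits) (auto simp: enc_bit_def)
  have len: "length (?s3 rE) \<le> length w"
    using arg_cong[OF out, of length] mw by simp
  have A: "runs inp (collect_prog S) s (length l * (4 * length [1..<S] + 2) + 1 +
      (2 * length w + 1 + (18 * length w + 1 + (10 * length (?s3 rE) + 1) + 1) + 1) + 1)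
      (?s3(rE := [], rD := rev (?s3 rE) @ ?s3 rD))"
    unfolding collect_prog_def by (rule runs_Seq[OF c1 runs_Seq[OF c2 runs_Seq[OF c3 c4]]])
  have B: "length l * (4 * length [1..<S] + 2) + 1 +
      (2 * length w + 1 + (18 * length w + 1 + (10 * length (?s3 rE) + 1) + 1) + 1) + 1
      \<le> (length l + length r) * (4 * S + 40) + 10"
  proof -
    have "length l * (4 * length [1..<S] + 2) \<le> (length l + length r) * (4 * S + 2)"
      by (intro mult_mono) auto
    then show ?thesis using len w by (simp add: algebra_simps)
  qed
  have C: "?s3(rE := [], rD := rev (?s3 rE) @ ?s3 rD)
    = s(rL := [], rR := dropWhile ?P ?w', rD := map enc_bit (tm_output N (q, tp, h)))"
    using s by (auto simp: fun_eq_iff rev_map)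
  show ?thesis by (rule exI, rule runs_weaken[OF A B C])
qed

text \<open>The head moves by at most one cell per step. Hence the window of
  \<open>length w + t + 1\<close> cells in \<open>tm_exec\<close> never truncates an output.\<close>

lemma tape_blank_outside:
  assumes "tm_run M t (tm_init w) = (q, tp, h)"
  shows "\<bar>h\<bar> \<le> int t \<and> (\<forall>i. length w + t \<le> i \<longrightarrow> tp (int i) = 0)"
  using assms
proof (induction t arbitrary: q tp h)
  case 0
  then show ?case by (auto simp: tm_run_def tm_init_def)
next
  case (Suc t)
  obtain q' tp' h' where c: "tm_run M t (tm_init w) = (q', tp', h')" by (metis prod.exhaust)
  have IH: "\<bar>h'\<bar> \<le> int t" "\<And>i. length w + t \<le> i \<Longrightarrow> tp' (int i) = 0" using Suc.IH[OF c] by auto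
  have "tm_step M (q', tp', h') = (q, tp, h)" using Suc(2) c by (simp add: tm_run_def)
  then have st: "(case map_of M (q', tp' h') of None \<Rightarrow> (q', tp', h')
      | Some (q'', a, d) \<Rightarrow> (q'', tp'(h' := a), h' + move d)) = (q, tp, h)"
    by (simp add: tm_step_def)
  show ?case
  proof (cases "map_of M (q', tp' h')")
    case None
    then show ?thesis using st IH by auto
  next
    case (Some e)
    obtain q'' a d where "e = (q'', a, d)" by (metis prod.exhaust)
    then have eq: "tp = tp'(h' := a)" "h = h' + move d" using Some st by auto
    have "\<bar>move d\<bar> \<le> 1" by (cases d) (auto simp: move_def)
    then have "\<bar>h\<bar> \<le> int (Suc t)" using IH(1) eq(2) by linarith
    moreover have "tp (int i) = 0" if "length w + Suc t \<le> i" for i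
      using IH that eq(1) by auto
    ultimately show ?thesis by blast
  qed
qed

lemma tape_split_init:
  assumes "w \<noteq> []" "set w \<subseteq> {1, 2, 3}" "9 \<le> S"
  shows "tape_split S (tm_init w) [] (cell_code (hd w) True # map (\<lambda>a. cell_code a False) (tl w))"
proof -
  let ?r = "cell_code (hd w) True # map (\<lambda>a. cell_code a False) (tl w)"
  let ?tp = "\<lambda>i. if 0 \<le> i \<and> i < int (length w) then w ! nat i else 0"
  obtain a v where w: "w = a # v" using assms(1) by (cases w) auto
  have "look ?r i = cell_code (?tp (int i)) (int i = 0)" for i
  proof -
    have "look ?r i = cell_code (if i < length w then w ! i else 0) (i = 0)"
      by (cases i) (auto simp: look_def w cell_code_def)
    then show ?thesis by simp
  qed
  moreover have "x < S" if "x \<in> set ?r" for x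
    using that assms(2,3) w by (auto simp: cell_code_def)
  moreover have "0 < x" if "x \<in> set ?r" for x
    using that by (auto simp: cell_code_def)
  ultimately show ?thesis
    by (auto simp: tape_split_def tm_init_def look_def cell_code_def)
qed

lemma runs_execute:
  assumes M: "tm_bound M S" and w: "w \<noteq> []" "set w \<subseteq> {1, 2, 3}"
    and s: "s rQ = []" "s rL = []" "s rR = cell_code (hd w) True # map (\<lambda>a. cell_code a False) (tl w)"
      "s rT = U t" "s rE = []" "s rD = []"
  shows "\<exists>q r. runs inp (sim_prog M S ;; collect_prog S) s
      (t * (cost (step_prog M S) + 3) + 4 + ((length w + 2 * (t * (cost (step_prog M S) + 3) + 3)) * (4 * S + 40) + 10))
      (s(rT := [], rQ := q, rR := r, rD := map enc_bit (tm_exec M t w)))"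
proof -
  let ?T = "t * (cost (step_prog M S) + 3) + 3"
  have S: "9 \<le> S" using M by (simp add: tm_bound_def)
  obtain q1 tp1 h1 where c: "tm_run M t (tm_init w) = (q1, tp1, h1)" by (metis prod.exhaust)
  obtain tp where i: "tm_init w = (0, tp, 0)" by (simp add: tm_init_def)
  obtain l1 r1 where sim: "runs inp (sim_prog M S) s ?T (s(rT := [], rQ := [q1 + 1], rL := l1, rR := r1))"
    "tape_split S (q1, tp1, h1) l1 r1" "length l1 \<le> ?T" "length r1 \<le> length w + ?T"
    using runs_sim_prog[OF M s(1-4) tape_split_init[OF w S, unfolded i] c[unfolded i], of inp] w by auto
  let ?s = "s(rT := [], rQ := [q1 + 1], rL := l1, rR := r1)"
  have "\<exists>r'. runs inp (collect_prog S) ?s ((length l1 + length r1) * (4 * S + 40) + 10)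
    (?s(rL := [], rR := r', rD := map enc_bit (tm_output (length w + t + 1) (q1, tp1, h1))))"
    by (rule runs_collect_prog[OF S]) (use s sim(2) tape_blank_outside[OF c] in auto)
  then obtain r' where "runs inp (collect_prog S) ?s ((length l1 + length r1) * (4 * S + 40) + 10)
    (?s(rL := [], rR := r', rD := map enc_bit (tm_exec M t w)))"
    using c by (auto simp: tm_exec_def)
  from runs_Seq[OF sim(1) this] have "runs inp (sim_prog M S ;; collect_prog S) s
     (?T + ((length l1 + length r1) * (4 * S + 40) + 10) + 1)
     (s(rT := [], rQ := [q1 + 1], rR := r', rD := map enc_bit (tm_exec M t w)))"
    by (rule runs_weaken) (use s in \<open>auto simp: fun_eq_iff\<close>)
  moreover have "(length l1 + length r1) * (4 * S + 40) \<le> (length w + 2 * ?T) * (4 * S + 40)"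
    using sim by (intro mult_right_mono) auto
  ultimately show ?thesis
    by (intro exI[of _ "[q1 + 1]"] exI[of _ r']) (elim runs_mono, simp)
qed

section \<open>Polynomial time\<close>

text \<open>The base \<open>n + 2\<close> is at least \<open>2\<close>, so constants and sums are
  absorbed by a larger exponent even at \<open>n = 0\<close>.\<close>

definition poly_bounded :: "(nat \<Rightarrow> nat) \<Rightarrow> bool" where
  "poly_bounded f \<longleftrightarrow> (\<exists>k. \<forall>n. f n \<le> (n + 2) ^ k)"

lemma poly_bounded_const: "poly_bounded (\<lambda>n. c)"
proof -
  have "c \<le> (n + 2) ^ c" for n :: nat
    using less_exp[of c] power_mono[of 2 "n + 2" c] by linarith
  then show ?thesis unfolding poly_bounded_def by blast
qed

lemma poly_bounded_id: "poly_bounded (\<lambda>n. n)"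
  unfolding poly_bounded_def by (rule exI[of _ 1]) simp

lemma poly_bounded_mult: "poly_bounded f \<Longrightarrow> poly_bounded g \<Longrightarrow> poly_bounded (\<lambda>n. f n * g n)"
  unfolding poly_bounded_def
proof (elim exE)
  fix a b assume "\<forall>n. f n \<le> (n + 2) ^ a" "\<forall>n. g n \<le> (n + 2) ^ b"
  then show "\<exists>k. \<forall>n. f n * g n \<le> (n + 2) ^ k"
    by (intro exI[of _ "a + b"]) (simp add: power_add mult_mono)
qed

lemma poly_bounded_add: "poly_bounded f \<Longrightarrow> poly_bounded g \<Longrightarrow> poly_bounded (\<lambda>n. f n + g n)"
  unfolding poly_bounded_def
proof (elim exE)
  fix a b assume *: "\<forall>n. f n \<le> (n + 2) ^ a" "\<forall>n. g n \<le> (n + 2) ^ b"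
  have "f n + g n \<le> (n + 2) ^ (a + b + 1)" for n
  proof -
    have "f n \<le> (n + 2) ^ (a + b)" "g n \<le> (n + 2) ^ (a + b)"
      using * power_increasing[of a "a + b" "n + 2"] power_increasing[of b "a + b" "n + 2"]
      by (auto intro: order.trans)
    then have "f n + g n \<le> 2 * (n + 2) ^ (a + b)" by linarith
    also have "\<dots> \<le> (n + 2) ^ (a + b + 1)" by simp
    finally show ?thesis .
  qed
  then show "\<exists>k. \<forall>n. f n + g n \<le> (n + 2) ^ k" by blast
qed

lemma poly_bounded_power: "poly_bounded f \<Longrightarrow> poly_bounded (\<lambda>n. f n ^ k)"
  by (induction k) (auto intro: poly_bounded_const poly_bounded_mult)

lemma poly_bounded_mono: "poly_bounded g \<Longrightarrow> (\<And>n. f n \<le> g n) \<Longrightarrow> poly_bounded f"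
  unfolding poly_bounded_def using order.trans by blast

lemmas poly_bounded_intros =
  poly_bounded_add poly_bounded_mult poly_bounded_power poly_bounded_id poly_bounded_const

lemma poly_bounded_time_bound: "poly_bounded (time_bound k)"
  unfolding time_bound_def by (intro poly_bounded_intros)

lemma poly_bounded_power_time: "poly_bounded (power_time k)"
  by (induction k) (auto intro!: poly_bounded_intros)

lemma poly_bounded_rounds: "poly_bounded f \<Longrightarrow> poly_bounded (\<lambda>n. rounds (f n))"
  using rounds_le poly_bounded_mono by metis

lemma poly_bounded_le_time_bound:
  assumes "poly_bounded f"
  shows "\<exists>k. \<forall>n. f n \<le> time_bound k n"
proof -
  from assms obtain k where k: "\<And>n. f n \<le> (n + 2) ^ k" unfolding poly_bounded_def by blast
  \<comment> \<open>For \<open>n \<ge> 2\<close> the exponent \<open>2 * k\<close> suffices because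
    \<open>n + 2 \<le> n ^ 2\<close>; for \<open>n < 2\<close> the additive part of
    \<open>time_bound\<close> must already cover \<open>3 ^ k\<close>.\<close>
  define j where "j = 2 * k + 3 ^ k"
  have "f n \<le> time_bound j n" for n
  proof (cases "n < 2")
    case True
    then have "(n + 2) ^ k \<le> 3 ^ k" by (intro power_mono) auto
    then show ?thesis using k[of n] unfolding time_bound_def j_def by linarith
  next
    case False
    then have "n + 2 \<le> n ^ 2" using mult_le_mono1[of 2 n n] unfolding power2_eq_square by linarith
    then have "(n + 2) ^ k \<le> n ^ (2 * k)" by (metis power_mono power_mult zero_le)
    also have "\<dots> \<le> n ^ j" using False by (intro power_increasing) (auto simp: j_def)
    finally show ?thesis using k[of n] unfolding time_bound_def by linarith
  qed
  then show ?thesis by blast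
qed

text \<open>Code \<open>5\<close> is the symbol of a unary digit, and \<open>6\<close> the same with
  the flag of cell \<open>0\<close>. For \<open>n = 0\<close> there is no digit to flag, hence the
  assumption \<open>0 < n\<close> from here on, harmless for asymptotic claims.\<close>

definition load_prog :: com where
  "load_prog = add_count rR 5 ;; Pop rR ;; Push rR 6"

lemma runs_load_prog:
  assumes "s rC = U n" "s rC' = []" "0 < n"
  shows "runs inp load_prog s (12 * n + 7) (s(rR := 6 # replicate (n - 1) 5 @ s rR))"
proof -
  have "runs inp (add_count rR 5) s (12 * n + 3) (s(rR := replicate n 5 @ s rR))"
    by (rule runs_add_count) (use assms in auto)
  moreover have "runs inp (Pop rR ;; Push rR 6) (s(rR := replicate n 5 @ s rR)) 3
      (s(rR := 6 # replicate (n - 1) 5 @ s rR))"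
    by (rule runs_line) (use assms in \<open>auto simp: fun_eq_iff gr0_conv_Suc\<close>)
  ultimately have "runs inp load_prog s (12 * n + 3 + 3 + 1) (s(rR := 6 # replicate (n - 1) 5 @ s rR))"
    unfolding load_prog_def by (rule runs_Seq)
  then show ?thesis by (rule runs_mono) simp
qed

text \<open>The input gives the bits in order, so \<open>rZ\<close> holds them reversed and the
  transfer restores the order; \<open>2 * x + 1\<close> is the unflagged code of \<open>x\<close>,
  and \<open>7\<close> that of the separator \<open>3\<close>.\<close>

definition random_prog :: "nat \<Rightarrow> com" where
  "random_prog k = clock k ;; Until rT [0] (Pop rT ;; Read rZ) ;; transfer rZ [0] rR [1, 2] (\<lambda>x. 2 * x + 1) ;; Push rR 7"

lemma runs_random_prog:
  assumes s: "s rC = U n" "s rC' = []" "s rT = []" "s rTmp = []" "s rZ = []" "s rR = []" "s 0 = U p"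
    and u: "length u = time_bound k n" "\<And>i. i < length u \<Longrightarrow> inp (p + i) = enc_bit (u ! i)"
  shows "runs inp (random_prog k) s (power_time k n + 2 * k + 15 * time_bound k n + 8)
    (s(0 := U (p + time_bound k n), rR := 7 # map (\<lambda>b. cell_code (enc_bit b) False) u))"
proof -
  let ?t = "time_bound k n"
  define I where "I i = s(rT := U (?t - i), 0 := U (p + i), rZ := rev (map enc_bit (take i u)))" for i
  have c1: "runs inp (clock k) s (power_time k n + 2 * k + 2) (I 0)"
    by (rule runs_weaken[OF runs_clock[OF s(1-4)]]) (use s in \<open>auto simp: I_def fun_eq_iff\<close>)
  have c2: "runs inp (Until rT [0] (Pop rT ;; Read rZ)) (I 0) (?t * (4 + 1) + 1) (I ?t)"
  proof (rule runs_Until)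
    fix i assume i: "i < ?t"
    then obtain d where d: "?t - i = Suc d" "?t - Suc i = d" by (metis Suc_diff_Suc)
    have "take (Suc i) u = take i u @ [u ! i]" using i u by (simp add: take_Suc_conv_app_nth)
    moreover have "read_sym (inp (p + i)) = enc_bit (u ! i)" using u i by (simp add: read_sym_def enc_bit_def)
    ultimately show "peek (I i) rT \<notin> set [0] \<and> runs inp (Pop rT ;; Read rZ) (I i) 4 (I (Suc i))"
      by (auto simp: I_def peek_def d fun_eq_iff intro!: runs_line)
  qed (simp add: I_def peek_def)
  let ?s = "s(rT := [], 0 := U (p + ?t), rZ := [], rR := map (\<lambda>b. cell_code (enc_bit b) False) u)"
  have c3: "runs inp (transfer rZ [0] rR [1, 2] (\<lambda>x. 2 * x + 1)) (I ?t) (10 * ?t + 1) ?s"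
    by (rule runs_weaken[OF runs_transfer_all])
      (use s u enc_bits_subset[of u] in \<open>auto simp: I_def fun_eq_iff rev_map cell_code_def\<close>)
  have c4: "runs inp (Push rR 7) ?s 1 (s(0 := U (p + ?t), rR := 7 # map (\<lambda>b. cell_code (enc_bit b) False) u))"
    by (rule runs_line) (use s in \<open>auto simp: fun_eq_iff\<close>)
  show ?thesis unfolding random_prog_def
    by (rule runs_mono[OF runs_Seq[OF c1 runs_Seq[OF c2 runs_Seq[OF c3 c4]]]]) simp
qed

definition rounds_prog :: "nat \<Rightarrow> com \<Rightarrow> com" where
  "rounds_prog a c = clock a ;; move_unary rT rX ;; round_loop c ;; move_bits rD rOut"

lemma runs_rounds_prog:
  assumes s: "s rC = U n" "s rC' = []" "s rT = []" "s rTmp = []" "s rX = []" "s rOut = []"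
    and c: "runs inp (round_loop c) (s(rX := U (time_bound a n))) B s'" "s' rD = map enc_bit bs" "s' rOut = []"
    and len: "length bs \<le> L"
  shows "\<exists>s''. runs inp (rounds_prog a c) s (power_time a n + 2 * a + 6 * time_bound a n + B + 10 * L + 10) s'' \<and>
    s'' rOut = rev (map enc_bit bs)"
proof -
  let ?x = "time_bound a n"
  have c1: "runs inp (clock a) s (power_time a n + 2 * a + 2) (s(rT := U ?x))"
    by (rule runs_clock[OF s(1-4)])
  have c2: "runs inp (move_unary rT rX) (s(rT := U ?x)) (6 * ?x + 1) (s(rX := U ?x))"
    by (rule runs_weaken[OF runs_move_unary[of rT rX "s(rT := U ?x)" ?x]]) (use s in \<open>auto simp: fun_eq_iff\<close>)
  have c4: "runs inp (move_bits rD rOut) s' (10 * length (s' rD) + 1) (s'(rD := [], rOut := rev (s' rD) @ s' rOut))"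
    by (rule runs_move_bits) (use c enc_bits_subset in auto)
  have "runs inp (rounds_prog a c) s (power_time a n + 2 * a + 6 * ?x + B + 10 * L + 10)
      (s'(rD := [], rOut := rev (s' rD) @ s' rOut))"
    unfolding rounds_prog_def
    by (rule runs_mono[OF runs_Seq[OF c1 runs_Seq[OF c2 runs_Seq[OF c(1) c4]]]]) (use len c in simp)
  moreover have "(s'(rD := [], rOut := rev (s' rD) @ s' rOut)) rOut = rev (map enc_bit bs)"
    using c by simp
  ultimately show ?thesis by blast
qed

definition execute_prog :: "tm \<Rightarrow> nat \<Rightarrow> nat \<Rightarrow> com" where
  "execute_prog M S k = load_prog ;; clock k ;; sim_prog M S ;; collect_prog S"

definition execute_time :: "tm \<Rightarrow> nat \<Rightarrow> nat \<Rightarrow> nat \<Rightarrow> nat" where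
  "execute_time M S k n = (let t = time_bound k n * (cost (step_prog M S) + 3) in
     12 * n + power_time k n + 2 * k + t + 20 + ((n + 1 + time_bound k n + 2 * (t + 3)) * (4 * S + 40) + 10))"

lemma runs_execute_prog:
  assumes M: "tm_bound M S" and n: "0 < n"
    and s: "s rC = U n" "s rC' = []" "s rT = []" "s rTmp = []" "s rQ = []" "s rL = []"
      "s rE = []" "s rD = []" "s rR = map (\<lambda>a. cell_code a False) v"
    and v: "set v \<subseteq> {1, 2, 3}" "length v \<le> time_bound k n + 1"
  shows "\<exists>q r. runs inp (execute_prog M S k) s (execute_time M S k n)
    (s(rQ := q, rR := r, rD := map enc_bit (tm_exec M (time_bound k n) (unary_input n @ v))))"
proof -
  let ?t = "time_bound k n" and ?w = "unary_input n @ v"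
  let ?r = "6 # replicate (n - 1) 5 @ map (\<lambda>a. cell_code a False) v"
  have c1: "runs inp load_prog s (12 * n + 7) (s(rR := ?r))"
    using runs_load_prog[OF s(1,2) n, of inp] s by simp
  have c2: "runs inp (clock k) (s(rR := ?r)) (power_time k n + 2 * k + 2) (s(rR := ?r, rT := U ?t))"
    by (rule runs_clock) (use s in auto)
  obtain m where m: "n = Suc m" using n gr0_conv_Suc by blast
  have r: "?r = cell_code (hd ?w) True # map (\<lambda>a. cell_code a False) (tl ?w)"
    by (simp add: m unary_input_def enc_bit_def cell_code_def)
  have w: "?w \<noteq> []" "set ?w \<subseteq> {1, 2, 3}" using m v by (auto simp: unary_input_def enc_bit_def)
  have lw: "length ?w \<le> n + 1 + ?t" using v by (simp add: unary_input_def)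
  obtain q r' where c3: "runs inp (sim_prog M S ;; collect_prog S) (s(rR := ?r, rT := U ?t))
      (?t * (cost (step_prog M S) + 3) + 4 + ((length ?w + 2 * (?t * (cost (step_prog M S) + 3) + 3)) * (4 * S + 40) + 10))
      (s(rR := ?r, rT := U ?t, rT := [], rQ := q, rR := r', rD := map enc_bit (tm_exec M ?t ?w)))"
    using runs_execute[OF M w, of "s(rR := ?r, rT := U ?t)" ?t inp] s r by auto
  have "runs inp (execute_prog M S k) s (execute_time M S k n)
    (s(rQ := q, rR := r', rD := map enc_bit (tm_exec M ?t ?w)))"
    unfolding execute_prog_def
  proof (rule runs_weaken[OF runs_Seq[OF c1 runs_Seq[OF c2 c3]]])
    have "(length ?w + 2 * (?t * (cost (step_prog M S) + 3) + 3)) * (4 * S + 40)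
        \<le> (n + 1 + ?t + 2 * (?t * (cost (step_prog M S) + 3) + 3)) * (4 * S + 40)"
      using lw by (intro mult_right_mono) auto
    then show "12 * n + 7 + (power_time k n + 2 * k + 2 + (?t * (cost (step_prog M S) + 3) + 4 +
        ((length ?w + 2 * (?t * (cost (step_prog M S) + 3) + 3)) * (4 * S + 40) + 10)) + 1) + 1
        \<le> execute_time M S k n"
      unfolding execute_time_def Let_def by linarith
  qed (use s in \<open>auto simp: fun_eq_iff\<close>)
  then show ?thesis by blast
qed

lemma length_tm_exec: "length (tm_exec M t w) \<le> length w + t + 1"
proof -
  obtain q tp h where "tm_run M t (tm_init w) = (q, tp, h)" by (metis prod.exhaust)
  then show ?thesis
    using length_takeWhile_le[of "\<lambda>s. s = 1 \<or> s = 2" "map (\<lambda>i. tp (int i)) [0..<length w + t + 1]"]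
    by (simp add: tm_exec_def tm_output_def del: upt_Suc)
qed

lemma poly_bounded_execute_time: "poly_bounded (execute_time M S k)"
  unfolding execute_time_def Let_def
  by (intro poly_bounded_intros poly_bounded_time_bound poly_bounded_power_time)

definition prover_prog :: "tm \<Rightarrow> nat \<Rightarrow> nat \<Rightarrow> nat \<Rightarrow> com" where
  "prover_prog M S k a = read_count ;; execute_prog M S k ;; rounds_prog a double_prog"

definition sampler_prog :: "tm \<Rightarrow> nat \<Rightarrow> nat \<Rightarrow> nat \<Rightarrow> com" where
  "sampler_prog M S k a = read_count ;; random_prog k ;; execute_prog M S k ;; rounds_prog a split_prog"

abbreviation tape_input :: "nat list \<Rightarrow> nat \<Rightarrow> nat" where
  "tape_input w \<equiv> \<lambda>i. if i < length w then w ! i else 0"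

lemma runs_prover_prog:
  assumes M: "tm_bound M S"
  shows "\<exists>T. poly_bounded T \<and> (\<forall>n > 0. \<exists>s'. runs (tape_input (unary_input n)) (prover_prog M S k a) (\<lambda>_. []) (T n) s' \<and>
    s' rOut = rev (map enc_bit ((double_bits ^^ rounds (time_bound a n)) (tm_exec M (time_bound k n) (unary_input n)))))"
proof -
  define L where "L n = n + time_bound k n + 1" for n
  define B where "B n = rounds (time_bound a n) * (14 * time_bound a n + (90 * ((2 * time_bound a n + 1) ^ 2 * L n) + 100) + 5) + 1" for n
  define T where "T n = 7 * n + 6 + (execute_time M S k n +
    (power_time a n + 2 * a + 6 * time_bound a n + B n + 10 * ((2 * time_bound a n + 1) ^ 2 * L n) + 10) + 1) + 1" for n
  have "poly_bounded T"
    unfolding T_def B_def L_def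
    by (intro poly_bounded_intros poly_bounded_rounds poly_bounded_time_bound poly_bounded_power_time poly_bounded_execute_time)
  moreover have "\<exists>s'. runs (tape_input (unary_input n)) (prover_prog M S k a) (\<lambda>_. []) (T n) s' \<and>
    s' rOut = rev (map enc_bit ((double_bits ^^ rounds (time_bound a n)) (tm_exec M (time_bound k n) (unary_input n))))"
    if n: "0 < n" for n
  proof -
    let ?inp = "tape_input (unary_input n)" and ?x = "time_bound a n"
    let ?bs = "tm_exec M (time_bound k n) (unary_input n)"
    let ?s0 = "(\<lambda>_. [])(0 := U (Suc n), rC := U n)"
    have c1: "runs ?inp read_count (\<lambda>_. []) (7 * n + 6) ?s0"
      by (rule runs_read_count) (auto simp: unary_input_def enc_bit_def read_sym_def)
    obtain q r where c2: "runs ?inp (execute_prog M S k) ?s0 (execute_time M S k n)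
        (?s0(rQ := q, rR := r, rD := map enc_bit ?bs))"
      using runs_execute_prog[OF M n, of ?s0 "[]" k ?inp] by auto
    let ?s1 = "?s0(rQ := q, rR := r, rD := map enc_bit ?bs)"
    have len: "length ?bs \<le> L n" using length_tm_exec[of M "time_bound k n" "unary_input n"]
      by (simp add: L_def unary_input_def)
    have "4 ^ rounds ?x = ((2::nat) ^ rounds ?x)\<^sup>2" by (simp add: power_mult[symmetric] power2_eq_square power_mult_distrib[symmetric])
    also have "\<dots> \<le> (2 * ?x + 1)\<^sup>2" by (rule power_mono[OF power_rounds_le]) simp
    finally have len2: "length ((double_bits ^^ rounds ?x) ?bs) \<le> (2 * ?x + 1)\<^sup>2 * L n"
      using length_double_bits_iter[of "rounds ?x" ?bs] len by (meson le_trans mult_le_mono)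
    let ?B = "rounds ?x * (14 * ?x + (90 * ((2 * ?x + 1) ^ 2 * length ?bs) + 100) + 5) + 1"
    have "?B \<le> B n" unfolding B_def using len by (intro add_mono mult_mono) auto
    moreover have "runs ?inp (round_loop double_prog) (?s1(rX := U ?x)) ?B
       (?s1(rX := U ?x, rD := map enc_bit ((double_bits ^^ rounds ?x) ?bs), rX := []))"
      by (rule runs_double_rounds) (auto simp: clean_def)
    ultimately have c3: "runs ?inp (round_loop double_prog) (?s1(rX := U ?x)) (B n)
       (?s1(rX := U ?x, rD := map enc_bit ((double_bits ^^ rounds ?x) ?bs), rX := []))"
      using runs_mono by blast
    obtain s'' where "runs ?inp (rounds_prog a double_prog) ?s1
        (power_time a n + 2 * a + 6 * time_bound a n + B n + 10 * ((2 * ?x + 1) ^ 2 * L n) + 10) s''"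
      and out: "s'' rOut = rev (map enc_bit ((double_bits ^^ rounds ?x) ?bs))"
      using runs_rounds_prog[OF _ _ _ _ _ _ c3 _ _ len2] by auto
    from runs_Seq[OF c1 runs_Seq[OF c2 this(1)]] out show ?thesis
      unfolding prover_prog_def T_def by blast
  qed
  ultimately show ?thesis by blast
qed

text \<open>\<open>T\<close> is fixed before \<open>r\<close>, and \<open>r\<close> only has to be
  long enough. This breaks a circle: the random tape is as long as the final time bound, which can
  be chosen only once \<open>T\<close> is known. The first block of \<open>r\<close> drives the
  simulated machine, the next one selects the sample.\<close>

lemma runs_sampler_prog:
  assumes M: "tm_bound M S"
  shows "\<exists>T. poly_bounded T \<and> (\<forall>n > 0. \<forall>r. time_bound k n + rounds (time_bound a n) \<le> length r \<longrightarrow>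
    (\<exists>s'. runs (tape_input (unary_input n @ [3] @ map enc_bit r)) (sampler_prog M S k a) (\<lambda>_. []) (T n) s' \<and>
    s' rOut = rev (map enc_bit (extract_leaf (take (rounds (time_bound a n)) (drop (time_bound k n) r))
      (tm_exec M (time_bound k n) (unary_input n @ [3] @ map enc_bit (take (time_bound k n) r)))))))"
proof -
  define L where "L n = n + 1 + time_bound k n + time_bound k n + 1" for n
  define B where "B n = rounds (time_bound a n) * (14 * time_bound a n + (22 * L n + 15) + 5) + 1" for n
  define T where "T n = 7 * n + 6 + ((power_time k n + 2 * k + 15 * time_bound k n + 8) + (execute_time M S k n +
    (power_time a n + 2 * a + 6 * time_bound a n + B n + 10 * L n + 10) + 1) + 1) + 1" for n
  have "poly_bounded T"
    unfolding T_def B_def L_def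
    by (intro poly_bounded_intros poly_bounded_rounds poly_bounded_time_bound poly_bounded_power_time poly_bounded_execute_time)
  moreover have "\<exists>s'. runs (tape_input (unary_input n @ [3] @ map enc_bit r)) (sampler_prog M S k a) (\<lambda>_. []) (T n) s' \<and>
    s' rOut = rev (map enc_bit (extract_leaf (take (rounds (time_bound a n)) (drop (time_bound k n) r))
      (tm_exec M (time_bound k n) (unary_input n @ [3] @ map enc_bit (take (time_bound k n) r)))))"
    if n: "0 < n" and lr: "time_bound k n + rounds (time_bound a n) \<le> length r" for n r
  proof -
    let ?inp = "tape_input (unary_input n @ [3] @ map enc_bit r)" and ?x = "time_bound a n" and ?t = "time_bound k n"
    let ?u = "take ?t r" and ?b = "take (rounds ?x) (drop ?t r)"
    let ?v = "[3] @ map enc_bit ?u"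
    let ?bs = "tm_exec M ?t (unary_input n @ ?v)"
    let ?s0 = "(\<lambda>_. [])(0 := U (Suc n), rC := U n)"
    have inp: "?inp (Suc n + i) = enc_bit (r ! i)" if "i < length r" for i
      using that by (simp add: unary_input_def nth_append)
    have c1: "runs ?inp read_count (\<lambda>_. []) (7 * n + 6) ?s0"
      by (rule runs_read_count) (auto simp: unary_input_def enc_bit_def read_sym_def nth_append)
    let ?s1 = "?s0(0 := U (Suc n + ?t), rR := map (\<lambda>a. cell_code a False) ?v)"
    have c2: "runs ?inp (random_prog k) ?s0 (power_time k n + 2 * k + 15 * time_bound k n + 8) ?s1"
    proof (rule runs_weaken)
      show "runs ?inp (random_prog k) ?s0 (power_time k n + 2 * k + 15 * time_bound k n + 8)
        (?s0(0 := U (Suc n + ?t), rR := 7 # map (\<lambda>b. cell_code (enc_bit b) False) ?u))"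
        by (rule runs_random_prog) (use lr inp in auto)
    qed (auto simp: cell_code_def)
    have v: "set ?v \<subseteq> {1, 2, 3}" by (auto simp: enc_bit_def)
    obtain q r' where c3: "runs ?inp (execute_prog M S k) ?s1 (execute_time M S k n)
        (?s1(rQ := q, rR := r', rD := map enc_bit ?bs))"
      using runs_execute_prog[OF M n, of ?s1 ?v k ?inp] v by auto
    let ?s2 = "?s1(rQ := q, rR := r', rD := map enc_bit ?bs)"
    have len: "length ?bs \<le> L n" using length_tm_exec[of M ?t "unary_input n @ ?v"]
      by (simp add: L_def unary_input_def)
    let ?B = "rounds ?x * (14 * ?x + (22 * length ?bs + 15) + 5) + 1"
    have "?B \<le> B n" unfolding B_def using len by (intro add_mono mult_mono) auto
    moreover have "runs ?inp (round_loop split_prog) (?s2(rX := U ?x)) ?B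
       (?s2(rX := U ?x, 0 := U (Suc n + ?t + rounds ?x), rD := map enc_bit (extract_leaf ?b ?bs), rX := []))"
    proof (rule runs_split_rounds)
      fix i assume "i < rounds ?x"
      then have b: "?b ! i = r ! (?t + i)" and i: "?t + i < length r" using lr by auto
      show "?inp (Suc n + ?t + i) = enc_bit (?b ! i)"
        unfolding b add.assoc[of "Suc n"] by (rule inp[OF i])
    qed (use lr in auto)
    ultimately have c4: "runs ?inp (round_loop split_prog) (?s2(rX := U ?x)) (B n)
       (?s2(rX := U ?x, 0 := U (Suc n + ?t + rounds ?x), rD := map enc_bit (extract_leaf ?b ?bs), rX := []))"
      using runs_mono by blast
    have len2: "length (extract_leaf ?b ?bs) \<le> L n" using length_extract_leaf len le_trans by blast
    obtain s'' where "runs ?inp (rounds_prog a split_prog) ?s2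
        (power_time a n + 2 * a + 6 * time_bound a n + B n + 10 * L n + 10) s''"
      and out: "s'' rOut = rev (map enc_bit (extract_leaf ?b ?bs))"
      using runs_rounds_prog[OF _ _ _ _ _ _ c4 _ _ len2] by auto
    from runs_Seq[OF c1 runs_Seq[OF c2 runs_Seq[OF c3 this(1)]]] out show ?thesis
      unfolding sampler_prog_def T_def by blast
  qed
  ultimately show ?thesis by blast
qed

lemma wf_progs:
  assumes "tm_bound M S"
  shows "wf_com nregs S (prover_prog M S k a)" "wf_com nregs S (sampler_prog M S k a)"
proof -
  have S: "9 \<le> S" using assms by (simp add: tm_bound_def)
  have mu: "wf_com nregs S (move_unary x y)" if "x < nregs" "y < nregs" for x y
    using that S unfolding move_unary_def by (intro wf_transfer) auto
  have mb: "wf_com nregs S (move_bits x y)" if "x < nregs" "y < nregs" for x y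
    using that S unfolding move_bits_def by (intro wf_transfer) auto
  have ac: "wf_com nregs S (add_count x y)" if "x < nregs" "0 < y" "y < S" for x y
    using that mu S unfolding add_count_def by auto
  have "wf_com nregs S (power_prog j)" for j
    by (induction j) (use S mu ac in \<open>auto simp: mult_count_def\<close>)
  moreover have "wf_com nregs S (pushes rT j)" for j
    by (induction j) (use S in auto)
  ultimately have cl: "wf_com nregs S (clock j)" for j unfolding clock_def by simp
  have rc: "wf_com nregs S read_count" using S by (simp add: read_count_def)
  have du: "wf_com nregs S (drop_until x y)" if "x < nregs" for x y using that by (simp add: drop_until_def)
  have "wf_com nregs S (collect_prog S)"
    unfolding collect_prog_def using S du mb by (auto intro!: wf_transfer)
  moreover have "wf_com nregs S (sim_prog M S)" unfolding sim_prog_def using S wf_step_prog[OF assms] by simp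
  ultimately have ex: "wf_com nregs S (execute_prog M S j)" for j
    unfolding execute_prog_def load_prog_def using cl ac S by simp
  have ra: "wf_com nregs S (random_prog j)" for j
    unfolding random_prog_def using S cl by (auto intro!: wf_transfer)
  have ha: "wf_com nregs S halve" unfolding halve_def using S mu by simp
  have rn: "wf_com nregs S (read_num x)" if "x < nregs" for x
    unfolding read_num_def using S that by (intro wf_transfer) auto
  have em: "wf_com nregs S (emit p x)" if "x < nregs" for p x
    unfolding emit_def using S that mu by simp
  have "wf_com nregs S gate_prog"
    unfolding gate_prog_def emit_had_def emit_toff_def using S rn em du by simp
  then have db: "wf_com nregs S double_prog"
    unfolding double_prog_def copy_num_def using S mb by simp
  have sp: "wf_com nregs S split_prog"
    unfolding split_prog_def using S mb by simp
  show "wf_com nregs S (prover_prog M S k a)" "wf_com nregs S (sampler_prog M S k a)"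
    unfolding prover_prog_def sampler_prog_def rounds_prog_def round_loop_def
    using rc ex ra ha db sp cl mu mb by simp_all
qed

lemma poly_bounded_compile: "poly_bounded T \<Longrightarrow> poly_bounded (\<lambda>n. T n * (2 * T n + 5) + T n + 4)"
  by (intro poly_bounded_intros)

lemma compile_run:
  assumes "stack_compiler K S p"
  shows "\<exists>M. \<forall>w T s' T' bs. set w \<subseteq> {1, 2, 3} \<longrightarrow> runs (tape_input w) p (\<lambda>_. []) T s' \<longrightarrow>
    T * (2 * T + 5) + T + 4 \<le> T' \<longrightarrow> s' rOut = rev (map enc_bit bs) \<longrightarrow> tm_exec M T' w = bs"
proof -
  obtain M where M: "\<And>w t s' T. set w \<subseteq> {1, 2, 3} \<Longrightarrow> exec (tape_input w) p (\<lambda>_. []) t s' \<Longrightarrow>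
     set (s' 1) \<subseteq> {1, 2} \<Longrightarrow> t * (2 * t + 5) + t + 4 \<le> T \<Longrightarrow> tm_exec M T w = map (\<lambda>s. s = 2) (rev (s' 1))"
    using stack_compiler.compile_correct[OF assms] by blast
  have "tm_exec M T' w = bs"
    if w: "set w \<subseteq> {1, 2, 3}" and r: "runs (tape_input w) p (\<lambda>_. []) T s'"
      and T: "T * (2 * T + 5) + T + 4 \<le> T'" and out: "s' rOut = rev (map enc_bit bs)" for w T s' T' bs
  proof -
    obtain t where t: "t \<le> T" "exec (tape_input w) p (\<lambda>_. []) t s'" using r unfolding runs_def by blast
    have "t * (2 * t + 5) \<le> T * (2 * T + 5)" using t(1) by (intro mult_mono) auto
    then have "t * (2 * t + 5) + t + 4 \<le> T'" using t(1) T by linarith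
    moreover have "set (s' 1) \<subseteq> {1, 2}" using out by (auto simp: enc_bit_def)
    ultimately have "tm_exec M T' w = map (\<lambda>s. s = 2) (rev (s' 1))" using M[OF w t(2)] by blast
    also have "\<dots> = bs" unfolding out by (induction bs) (auto simp: enc_bit_def)
    finally show "tm_exec M T' w = bs" .
  qed
  then show ?thesis by blast
qed

lemma prover_machine:
  "\<exists>M' k'. \<forall>n > 0. tm_exec M' (time_bound k' n) (unary_input n)
     = (double_bits ^^ rounds (time_bound a n)) (tm_exec M (time_bound k n) (unary_input n))"
proof -
  obtain S where S: "tm_bound M S" using ex_tm_bound by blast
  have comp: "stack_compiler nregs S (prover_prog M S k a)"
    using wf_progs(1)[OF S] S by unfold_locales (auto simp: tm_bound_def)
  obtain T where T: "poly_bounded T" "\<forall>n > 0. \<exists>s'. runs (tape_input (unary_input n)) (prover_prog M S k a) (\<lambda>_. []) (T n) s' \<and>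
    s' rOut = rev (map enc_bit ((double_bits ^^ rounds (time_bound a n)) (tm_exec M (time_bound k n) (unary_input n))))"
    using runs_prover_prog[OF S, of k a] by (elim exE conjE)
  obtain k' where k': "\<And>n. T n * (2 * T n + 5) + T n + 4 \<le> time_bound k' n"
    using poly_bounded_le_time_bound[OF poly_bounded_compile[OF T(1)]] by blast
  obtain M' where M': "\<And>w T s' T' bs. set w \<subseteq> {1, 2, 3} \<Longrightarrow>
    runs (tape_input w) (prover_prog M S k a) (\<lambda>_. []) T s' \<Longrightarrow>
    T * (2 * T + 5) + T + 4 \<le> T' \<Longrightarrow> s' rOut = rev (map enc_bit bs) \<Longrightarrow> tm_exec M' T' w = bs"
    using compile_run[OF comp] by blast
  show ?thesis
  proof (intro exI allI impI)
    fix n :: nat assume "0 < n"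
    then obtain s' where "runs (tape_input (unary_input n)) (prover_prog M S k a) (\<lambda>_. []) (T n) s'"
      "s' rOut = rev (map enc_bit ((double_bits ^^ rounds (time_bound a n)) (tm_exec M (time_bound k n) (unary_input n))))"
      using T(2) by blast
    moreover have "set (unary_input n) \<subseteq> {1, 2, 3}" by (auto simp: unary_input_def enc_bit_def)
    ultimately show "tm_exec M' (time_bound k' n) (unary_input n)
        = (double_bits ^^ rounds (time_bound a n)) (tm_exec M (time_bound k n) (unary_input n))"
      using M' k' by blast
  qed
qed

lemma sampler_machine:
  "\<exists>M' k'. \<forall>n > 0. time_bound k n + rounds (time_bound a n) \<le> time_bound k' n \<and>
     (\<forall>r. length r = time_bound k' n \<longrightarrow>
       tm_exec M' (time_bound k' n) (unary_input n @ [3] @ map enc_bit r)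
       = extract_leaf (take (rounds (time_bound a n)) (drop (time_bound k n) r))
         (tm_exec M (time_bound k n) (unary_input n @ [3] @ map enc_bit (take (time_bound k n) r))))"
proof -
  obtain S where S: "tm_bound M S" using ex_tm_bound by blast
  have comp: "stack_compiler nregs S (sampler_prog M S k a)"
    using wf_progs(2)[OF S] S by unfold_locales (auto simp: tm_bound_def)
  obtain T where T: "poly_bounded T" "\<forall>n > 0. \<forall>r. time_bound k n + rounds (time_bound a n) \<le> length r \<longrightarrow>
    (\<exists>s'. runs (tape_input (unary_input n @ [3] @ map enc_bit r)) (sampler_prog M S k a) (\<lambda>_. []) (T n) s' \<and>
    s' rOut = rev (map enc_bit (extract_leaf (take (rounds (time_bound a n)) (drop (time_bound k n) r))
      (tm_exec M (time_bound k n) (unary_input n @ [3] @ map enc_bit (take (time_bound k n) r))))))"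
    using runs_sampler_prog[OF S, of k a] by (elim exE conjE)
  \<comment> \<open>One exponent \<open>k'\<close> has to serve two purposes: enough time for the
    compiled program, and enough random bits for the simulation together with the selection.\<close>
  have "poly_bounded (\<lambda>n. (T n * (2 * T n + 5) + T n + 4) + (time_bound k n + rounds (time_bound a n)))"
    by (intro poly_bounded_add poly_bounded_compile T poly_bounded_time_bound poly_bounded_rounds)
  then obtain k' where k': "\<And>n. (T n * (2 * T n + 5) + T n + 4) + (time_bound k n + rounds (time_bound a n)) \<le> time_bound k' n"
    using poly_bounded_le_time_bound by blast
  have k'': "T n * (2 * T n + 5) + T n + 4 \<le> time_bound k' n"
    and k3: "time_bound k n + rounds (time_bound a n) \<le> time_bound k' n" for n
    using add_leD1[OF k'[of n]] add_leD2[OF k'[of n]] by simp_all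
  obtain M' where M': "\<And>w T s' T' bs. set w \<subseteq> {1, 2, 3} \<Longrightarrow>
    runs (tape_input w) (sampler_prog M S k a) (\<lambda>_. []) T s' \<Longrightarrow>
    T * (2 * T + 5) + T + 4 \<le> T' \<Longrightarrow> s' rOut = rev (map enc_bit bs) \<Longrightarrow> tm_exec M' T' w = bs"
    using compile_run[OF comp] by blast
  show ?thesis
  proof (intro exI allI impI conjI)
    fix n :: nat assume n: "0 < n"
    show "time_bound k n + rounds (time_bound a n) \<le> time_bound k' n" by (rule k3)
    fix r :: "bool list" assume r: "length r = time_bound k' n"
    then have "time_bound k n + rounds (time_bound a n) \<le> length r" using k3 by simp
    then obtain s' where "runs (tape_input (unary_input n @ [3] @ map enc_bit r)) (sampler_prog M S k a) (\<lambda>_. []) (T n) s'"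
      "s' rOut = rev (map enc_bit (extract_leaf (take (rounds (time_bound a n)) (drop (time_bound k n) r))
      (tm_exec M (time_bound k n) (unary_input n @ [3] @ map enc_bit (take (time_bound k n) r)))))"
      using T(2) n by blast
    moreover have "set (unary_input n @ [3] @ map enc_bit r) \<subseteq> {1, 2, 3}"
      by (auto simp: unary_input_def enc_bit_def)
    ultimately show "tm_exec M' (time_bound k' n) (unary_input n @ [3] @ map enc_bit r)
       = extract_leaf (take (rounds (time_bound a n)) (drop (time_bound k n) r))
         (tm_exec M (time_bound k n) (unary_input n @ [3] @ map enc_bit (take (time_bound k n) r)))"
      using M' k'' by blast
  qed
qed

section \<open>Interleaved copies of a circuit\<close>

fun interleave :: "'a list \<Rightarrow> 'a list \<Rightarrow> 'a list" where
  "interleave (x # xs) (y # ys) = x # y # interleave xs ys"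
| "interleave _ _ = []"

lemma length_interleave: "length xs = length ys \<Longrightarrow> length (interleave xs ys) = 2 * length xs"
  by (induction xs ys rule: list_induct2) auto

lemma evens_interleave: "length xs = length ys \<Longrightarrow> evens (interleave xs ys) = xs"
  by (induction xs ys rule: list_induct2) auto

lemma odds_Cons: "odds (x # y # zs) = y # odds zs"
  by (cases zs) (auto simp: odds_def)

lemma odds_interleave: "length xs = length ys \<Longrightarrow> odds (interleave xs ys) = ys"
  by (induction xs ys rule: list_induct2) (auto simp: odds_Cons, simp add: odds_def)

lemma interleave_evens_odds:
  "length zs = 2 * n \<Longrightarrow> interleave (evens zs) (odds zs) = zs \<and> length (evens zs) = n \<and> length (odds zs) = n"
proof (induction n arbitrary: zs)
  case (Suc n)
  then obtain x y ws where "zs = x # y # ws" "length ws = 2 * n"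
    by (metis (no_types, lifting) Suc_length_conv mult_Suc_right numeral_2_eq_2 plus_nat.simps)
  then show ?case using Suc.IH[of ws] by (simp add: odds_Cons)
qed (simp add: odds_def)

lemma take_interleave: "length xs = length ys \<Longrightarrow> take (2 * m) (interleave xs ys) = interleave (take m xs) (take m ys)"
proof (induction xs ys arbitrary: m rule: list_induct2)
  case (Cons x xs y ys)
  then show ?case by (cases m) auto
qed simp

lemma interleave_nth:
  assumes "length xs = length ys" "i < length xs"
  shows "interleave xs ys ! (2 * i) = xs ! i" "interleave xs ys ! Suc (2 * i) = ys ! i"
  using assms
proof (induction xs ys arbitrary: i rule: list_induct2)
  case (Cons x xs y ys)
  { case 1 then show ?case using Cons by (cases i) auto }
  { case 2 then show ?case using Cons by (cases i) auto }
qed simp_all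

lemma interleave_update:
  assumes "length xs = length ys"
  shows "(interleave xs ys)[2 * i := v] = interleave (xs[i := v]) ys"
    "(interleave xs ys)[Suc (2 * i) := v] = interleave xs (ys[i := v])"
  using assms
proof (induction xs ys arbitrary: i rule: list_induct2)
  case (Cons x xs y ys)
  { case 1 then show ?case using Cons by (cases i) auto }
  { case 2 then show ?case using Cons by (cases i) auto }
qed simp_all

text \<open>\<open>\<Psi>\<close> is the tensor product of \<open>\<phi>\<close> and
  \<open>\<theta>\<close>, with the qubits of \<open>\<phi>\<close> at the even and those of
  \<open>\<theta>\<close> at the odd positions.\<close>

definition product_state :: "nat \<Rightarrow> (bool list \<Rightarrow> real) \<Rightarrow> (bool list \<Rightarrow> real) \<Rightarrow> (bool list \<Rightarrow> real) \<Rightarrow> bool" where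
  "product_state n \<Psi> \<phi> \<theta> \<longleftrightarrow> (\<forall>a b. length a = n \<longrightarrow> length b = n \<longrightarrow> \<Psi> (interleave a b) = \<phi> a * \<theta> b)"

lemma odd_index_less: "Suc (2 * i) < 2 * n \<longleftrightarrow> i < n"
  by linarith

lemma product_state_even_had:
  "product_state n \<Psi> \<phi> \<theta> \<Longrightarrow> product_state n (apply_gate (2 * n) (Had (2 * i)) \<Psi>) (apply_gate n (Had i) \<phi>) \<theta>"
  unfolding product_state_def by (auto simp: interleave_update interleave_nth distrib_right left_diff_distrib)

lemma product_state_odd_had:
  "product_state n \<Psi> \<phi> \<theta> \<Longrightarrow>
    product_state n (apply_gate (2 * n) (Had (Suc (2 * i))) \<Psi>) \<phi> (apply_gate n (Had i) \<theta>)"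
  unfolding product_state_def
  by (auto simp: interleave_update interleave_nth odd_index_less distrib_left right_diff_distrib)

text \<open>Besides acting on one factor only, the doubled gate is valid exactly when the original
  is; so invalid gates, which act as the identity, remain harmless.\<close>

lemma product_state_even_toff:
  assumes "product_state n \<Psi> \<phi> \<theta>"
  shows "product_state n (apply_gate (2 * n) (Toff (2 * a) (2 * b) (2 * c)) \<Psi>) (apply_gate n (Toff a b c) \<phi>) \<theta>"
proof -
  have "(2 * a < 2 * n \<and> 2 * b < 2 * n \<and> 2 * c < 2 * n \<and> distinct [2 * a, 2 * b, 2 * c])
    = (a < n \<and> b < n \<and> c < n \<and> distinct [a, b, c])" by auto
  then show ?thesis using assms unfolding product_state_def apply_gate.simps
    by (auto simp: interleave_update interleave_nth)
qed

lemma product_state_odd_toff: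
  assumes "product_state n \<Psi> \<phi> \<theta>"
  shows "product_state n (apply_gate (2 * n) (Toff (Suc (2 * a)) (Suc (2 * b)) (Suc (2 * c))) \<Psi>) \<phi> (apply_gate n (Toff a b c) \<theta>)"
proof -
  have "(Suc (2 * a) < 2 * n \<and> Suc (2 * b) < 2 * n \<and> Suc (2 * c) < 2 * n \<and> distinct [Suc (2 * a), Suc (2 * b), Suc (2 * c)])
    = (a < n \<and> b < n \<and> c < n \<and> distinct [a, b, c])" by (auto simp: odd_index_less)
  then show ?thesis using assms unfolding product_state_def apply_gate.simps
    by (auto simp: interleave_update interleave_nth)
qed

lemma product_state_double_gate:
  assumes "product_state n \<Psi> \<phi> \<theta>"
  shows "product_state n (fold (apply_gate (2 * n)) (double_gate g) \<Psi>) (apply_gate n g \<phi>) (apply_gate n g \<theta>)"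
  using product_state_odd_had[OF product_state_even_had[OF assms]]
    product_state_odd_toff[OF product_state_even_toff[OF assms]]
  by (cases g) (simp_all del: apply_gate.simps)

lemma interleave_inject:
  assumes "length a = length b" "length c = length d" "interleave a b = interleave c d"
  shows "a = c \<and> b = d"
  using evens_interleave[OF assms(1)] evens_interleave[OF assms(2)]
    odds_interleave[OF assms(1)] odds_interleave[OF assms(2)] assms(3) by simp

lemma interleave_replicate: "interleave (replicate n x) (replicate n x) = replicate (2 * n) x"
  by (induction n) auto

lemma run_circuit_double:
  "product_state n (run_circuit (2 * n) (concat (map double_gate gs))) (run_circuit n gs) (run_circuit n gs)"
proof -
  have "product_state n (fold (apply_gate (2 * n)) (concat (map double_gate gs)) \<Psi>)
     (fold (apply_gate n) gs \<phi>) (fold (apply_gate n) gs \<theta>)" if "product_state n \<Psi> \<phi> \<theta>" for \<Psi> \<phi> \<theta>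
    using that
  proof (induction gs arbitrary: \<Psi> \<phi> \<theta>)
    case (Cons g gs)
    from Cons.IH[OF product_state_double_gate[OF Cons.prems, of g]] show ?case by simp
  qed simp
  moreover have "product_state n (\<lambda>x. if x = replicate (2 * n) False then 1 else 0)
      (\<lambda>x. if x = replicate n False then 1 else 0) (\<lambda>x. if x = replicate n False then 1 else 0)"
    unfolding product_state_def interleave_replicate[symmetric]
    by (auto dest!: interleave_inject[rotated 2])
  ultimately show ?thesis unfolding run_circuit_def by blast
qed

section \<open>Norm preservation and measurement of product states\<close>

lemma finite_bit_lists: "finite {x :: bool list. length x = n}"
  using finite_lists_length_eq[of "UNIV :: bool set" n] by simp

text \<open>For a Hadamard gate, pair \<open>x\<close> with its flip at \<open>i\<close>: the two
  new amplitudes \<open>(u + v) / sqrt 2\<close> and \<open>(u - v) / sqrt 2\<close> have the same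
  sum of squares as \<open>u\<close> and \<open>v\<close>, and summing over all \<open>x\<close>
  counts each pair twice on both sides. A Toffoli gate permutes the bit lists by an
  involution.\<close>

lemma norm_apply_gate:
  "(\<Sum>x | length x = n. (apply_gate n g \<psi> x)\<^sup>2) = (\<Sum>x | length x = n. (\<psi> x)\<^sup>2)"
proof (cases g)
  case (Had i)
  show ?thesis
  proof (cases "i < n")
    case True
    let ?f = "\<lambda>x. x[i := \<not> x ! i]" and ?L = "{x :: bool list. length x = n}" and ?h = "apply_gate n g \<psi>"
    have flip: "(\<Sum>x\<in>?L. k (?f x)) = (\<Sum>x\<in>?L. k x)" for k :: "bool list \<Rightarrow> real"
      by (rule sum.reindex_bij_witness[of _ ?f ?f]) (use True in auto)
    have "(?h x)\<^sup>2 + (?h (?f x))\<^sup>2 = (\<psi> x)\<^sup>2 + (\<psi> (?f x))\<^sup>2" if "x \<in> ?L" for x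
    proof -
      have sq: "((u + v) / sqrt 2)\<^sup>2 + ((u - v) / sqrt 2)\<^sup>2 = u\<^sup>2 + v\<^sup>2" for u v :: real
        by (simp add: power_divide field_simps power2_eq_square)
      have l: "x[i := x ! i] = x" by simp
      show ?thesis
      proof (cases "x ! i")
        case x: True
        then have "x[i := True] = x" using l by simp
        then show ?thesis using True that x sq[of "\<psi> (x[i := False])" "\<psi> x"] by (simp add: Had)
      next
        case x: False
        then have "x[i := False] = x" using l by simp
        then show ?thesis using True that x sq[of "\<psi> x" "\<psi> (x[i := True])"] by (simp add: Had)
      qed
    qed
    then have "(\<Sum>x\<in>?L. (?h x)\<^sup>2 + (?h (?f x))\<^sup>2) = (\<Sum>x\<in>?L. (\<psi> x)\<^sup>2 + (\<psi> (?f x))\<^sup>2)"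
      by (rule sum.cong[OF refl])
    then show ?thesis
      using flip[of "\<lambda>x. (?h x)\<^sup>2"] flip[of "\<lambda>x. (\<psi> x)\<^sup>2"] by (simp add: sum.distrib)
  qed (simp add: Had)
next
  case (Toff a b c)
  show ?thesis
  proof (cases "a < n \<and> b < n \<and> c < n \<and> distinct [a, b, c]")
    case True
    let ?f = "\<lambda>x. if x ! a \<and> x ! b then x[c := (\<not> x ! c)] else x"
    have "(\<Sum>x | length x = n. (\<psi> (?f x))\<^sup>2) = (\<Sum>x | length x = n. (\<psi> x)\<^sup>2)"
      by (rule sum.reindex_bij_witness[of _ ?f ?f]) (use True in auto)
    then show ?thesis unfolding Toff apply_gate.simps if_P[OF True] .
  next
    case False
    then show ?thesis unfolding Toff apply_gate.simps if_not_P[OF False] by simp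
  qed
qed

lemma norm_run_circuit: "(\<Sum>x | length x = n. (run_circuit n gs x)\<^sup>2) = 1"
proof -
  have "(\<Sum>x | length x = n. (fold (apply_gate n) gs \<psi> x)\<^sup>2) = (\<Sum>x | length x = n. (\<psi> x)\<^sup>2)" for \<psi>
  proof (induction gs arbitrary: \<psi>)
    case (Cons g gs)
    then show ?case using norm_apply_gate by simp
  qed simp
  moreover have "(\<Sum>x | length x = n. (if x = replicate n False then 1 else 0 :: real)\<^sup>2) = 1"
    using finite_bit_lists[of n] by (simp add: if_distrib[of "\<lambda>x. x\<^sup>2"] sum.delta cong: if_cong)
  ultimately show ?thesis unfolding run_circuit_def by simp
qed

definition state_pmf :: "nat \<Rightarrow> gate list \<Rightarrow> bool list pmf" where
  "state_pmf n gs = embed_pmf (\<lambda>x. if length x = n then (run_circuit n gs x)\<^sup>2 else 0)"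

lemma pmf_state_pmf: "pmf (state_pmf n gs) x = (if length x = n then (run_circuit n gs x)\<^sup>2 else 0)"
  unfolding state_pmf_def
proof (rule pmf_embed_pmf)
  let ?f = "\<lambda>x. if length x = n then (run_circuit n gs x)\<^sup>2 else 0"
  have "(\<integral>\<^sup>+x. ennreal (?f x) \<partial>count_space UNIV) = (\<Sum>x | length x = n. ennreal (?f x))"
    by (rule nn_integral_count_space') (auto simp: finite_bit_lists)
  also have "\<dots> = ennreal (\<Sum>x | length x = n. ?f x)" by (rule sum_ennreal) auto
  also have "\<dots> = 1" using norm_run_circuit[of n gs] by simp
  finally show "(\<integral>\<^sup>+x. ennreal (?f x) \<partial>count_space UNIV) = 1" .
qed simp

lemma set_state_pmf: "set_pmf (state_pmf n gs) \<subseteq> {x. length x = n}"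
  by (auto simp: set_pmf_eq pmf_state_pmf)

text \<open>Amplitudes of a product state multiply, hence so do the squares; a bit list of length
  \<open>2 * n\<close> is the interleaving of exactly one pair.\<close>

lemma state_pmf_double:
  "state_pmf (2 * n) (concat (map double_gate gs))
    = map_pmf (\<lambda>(x, y). interleave x y) (pair_pmf (state_pmf n gs) (state_pmf n gs))" (is "_ = map_pmf ?I ?P")
proof (rule pmf_eqI)
  fix z :: "bool list"
  have inj: "inj_on ?I {(x, y). length x = n \<and> length y = n}"
    by (auto simp: inj_on_def dest!: interleave_inject[rotated 2])
  have sub: "set_pmf ?P \<subseteq> {(x, y). length x = n \<and> length y = n}" using set_state_pmf[of n gs] by auto
  show "pmf (state_pmf (2 * n) (concat (map double_gate gs))) z = pmf (map_pmf ?I ?P) z"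
  proof (cases "length z = 2 * n")
    case True
    let ?x = "evens z" and ?y = "odds z"
    have z: "interleave ?x ?y = z" "length ?x = n" "length ?y = n"
      using interleave_evens_odds[OF True] by auto
    have "pmf (map_pmf ?I ?P) z = measure_pmf.prob ?P (?I -` {z})" by (simp add: pmf_map)
    also have "\<dots> = measure_pmf.prob ?P {(?x, ?y)}"
    proof (rule measure_pmf.finite_measure_eq_AE)
      show "AE p in measure_pmf ?P. (p \<in> ?I -` {z}) = (p \<in> {(?x, ?y)})"
        unfolding AE_measure_pmf_iff
      proof
        fix p assume "p \<in> set_pmf ?P"
        then obtain a b where p: "p = (a, b)" "length a = n" "length b = n" using sub by auto
        then show "(p \<in> ?I -` {z}) = (p \<in> {(?x, ?y)})"
          using z(1) evens_interleave[of a b] odds_interleave[of a b] by auto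
      qed
    qed auto
    also have "\<dots> = pmf (state_pmf n gs) ?x * pmf (state_pmf n gs) ?y" by (simp add: measure_pmf_single pmf_pair)
    also have "\<dots> = pmf (state_pmf (2 * n) (concat (map double_gate gs))) z"
      using run_circuit_double[of n gs] z True unfolding product_state_def
      by (auto simp: pmf_state_pmf power_mult_distrib) (metis power_mult_distrib)
    finally show ?thesis by simp
  next
    case False
    have "length w = 2 * n" if w: "w \<in> set_pmf (map_pmf ?I ?P)" for w
    proof -
      obtain a b where "(a, b) \<in> set_pmf ?P" "w = interleave a b" using w by auto
      then show ?thesis using sub length_interleave[of a b] by auto
    qed
    then have "z \<notin> set_pmf (map_pmf ?I ?P)" using False by blast
    then have "pmf (map_pmf ?I ?P) z = 0" unfolding set_pmf_iff by blast
    then show ?thesis using False by (simp add: pmf_state_pmf)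
  qed
qed

lemma circuit_dist_double:
  "circuit_dist (2 * n) (2 * m) (concat (map double_gate gs))
    = map_pmf (\<lambda>(x, y). interleave x y) (pair_pmf (circuit_dist n m gs) (circuit_dist n m gs))"
proof -
  let ?S = "state_pmf n gs"
  have "circuit_dist (2 * n) (2 * m) (concat (map double_gate gs))
      = map_pmf (\<lambda>(x, y). take (2 * m) (interleave x y)) (pair_pmf ?S ?S)"
    unfolding circuit_dist_def state_pmf_def[symmetric] state_pmf_double map_pmf_comp
    by (simp add: case_prod_unfold)
  also have "\<dots> = map_pmf (\<lambda>(x, y). interleave (take m x) (take m y)) (pair_pmf ?S ?S)"
    using set_state_pmf[of n gs] by (intro map_pmf_cong) (auto simp: take_interleave subset_eq)
  also have "\<dots> = map_pmf (\<lambda>(x, y). interleave x y) (map_pmf (\<lambda>(x, y). (take m x, take m y)) (pair_pmf ?S ?S))"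
    by (simp add: map_pmf_comp case_prod_unfold)
  also have "\<dots> = map_pmf (\<lambda>(x, y). interleave x y) (pair_pmf (circuit_dist n m gs) (circuit_dist n m gs))"
    unfolding circuit_dist_def state_pmf_def[symmetric] map_pair ..
  finally show ?thesis .
qed

text \<open>That all samples have one common length is what later allows \<open>evens\<close> and
  \<open>odds\<close> to recover the two halves of an interleaved pair.\<close>

lemma set_circuit_dist: "set_pmf (circuit_dist n m gs) \<subseteq> {x. length x = min n m}"
  using set_state_pmf[of n gs] unfolding circuit_dist_def state_pmf_def[symmetric] by auto

section \<open>Random leaves of a product distribution\<close>

abbreviation expect :: "'a pmf \<Rightarrow> ('a \<Rightarrow> real) \<Rightarrow> real" where
  "expect p f \<equiv> measure_pmf.expectation p f"

lemma expect_finite: "finite (set_pmf p) \<Longrightarrow> expect p f = (\<Sum>x\<in>set_pmf p. f x * pmf p x)"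
  by (rule integral_measure_pmf_real) auto

lemma expect_pair:
  assumes "finite (set_pmf p)" "finite (set_pmf q)"
  shows "expect (pair_pmf p q) f = expect p (\<lambda>x. expect q (\<lambda>y. f (x, y)))"
proof -
  have "expect (pair_pmf p q) f = (\<Sum>z\<in>set_pmf p \<times> set_pmf q. f z * pmf (pair_pmf p q) z)"
    using assms by (subst expect_finite) auto
  also have "\<dots> = (\<Sum>x\<in>set_pmf p. \<Sum>y\<in>set_pmf q. f (x, y) * (pmf p x * pmf q y))"
    by (simp add: sum.cartesian_product pmf_pair case_prod_unfold) (simp add: pmf_pair[symmetric])
  also have "\<dots> = expect p (\<lambda>x. expect q (\<lambda>y. f (x, y)))"
    using assms by (simp add: expect_finite sum_distrib_right sum_distrib_left mult_ac)
  finally show ?thesis .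
qed

primrec pow_dist :: "nat \<Rightarrow> 'a list pmf \<Rightarrow> 'a list pmf" where
  "pow_dist 0 A = A"
| "pow_dist (Suc l) A = map_pmf (\<lambda>(x, y). interleave x y) (pair_pmf (pow_dist l A) (pow_dist l A))"

text \<open>On a list of \<open>2 ^ l\<close> interleaved samples this is the mean of
  \<open>f\<close> over the samples; the recursion mirrors both \<open>pow_dist\<close> and the coin
  flips of \<open>extract_leaf\<close>.\<close>

primrec leaf_avg :: "('a list \<Rightarrow> real) \<Rightarrow> nat \<Rightarrow> 'a list \<Rightarrow> real" where
  "leaf_avg f 0 xs = f xs"
| "leaf_avg f (Suc l) xs = (leaf_avg f l (evens xs) + leaf_avg f l (odds xs)) / 2"

lemma leaf_avg_bounds:
  assumes "\<And>x. 0 \<le> f x \<and> f x \<le> 1"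
  shows "0 \<le> leaf_avg f l xs \<and> leaf_avg f l xs \<le> 1"
proof (induction l arbitrary: xs)
  case (Suc l)
  show ?case using Suc[of "evens xs"] Suc[of "odds xs"] by simp
qed (use assms in simp)

lemma finite_pow_dist: "finite (set_pmf A) \<Longrightarrow> finite (set_pmf (pow_dist l A))"
  by (induction l) auto

lemma set_pow_dist: "set_pmf A \<subseteq> {x. length x = m} \<Longrightarrow> set_pmf (pow_dist l A) \<subseteq> {x. length x = 2 ^ l * m}"
proof (induction l)
  case (Suc l)
  then have IH: "set_pmf (pow_dist l A) \<subseteq> {x. length x = 2 ^ l * m}" by simp
  show ?case
  proof
    fix z assume "z \<in> set_pmf (pow_dist (Suc l) A)"
    then obtain a b where "a \<in> set_pmf (pow_dist l A)" "b \<in> set_pmf (pow_dist l A)" "z = interleave a b" by auto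
    moreover from this have "length a = 2 ^ l * m" "length b = 2 ^ l * m" using subsetD[OF IH] by blast+
    ultimately show "z \<in> {x. length x = 2 ^ Suc l * m}" using length_interleave[of a b] by simp
  qed
qed simp

text \<open>Interleaving two independent copies halves the variance.\<close>

lemma pow_dist_moments:
  fixes A :: "'a list pmf"
  assumes fin: "finite (set_pmf A)" and len: "set_pmf A \<subseteq> {x. length x = m}"
    and f: "\<And>x. 0 \<le> f x \<and> f x \<le> 1"
  shows "expect (pow_dist l A) (\<lambda>x. leaf_avg f l x - expect A f) = 0 \<and>
    expect (pow_dist l A) (\<lambda>x. (leaf_avg f l x - expect A f)\<^sup>2) \<le> (1 / 2) ^ l"
proof (induction l)
  case 0
  have int: "integrable A f" for f :: "'a list \<Rightarrow> real" using fin by (rule integrable_measure_pmf_finite)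
  have mu: "0 \<le> expect A f" "expect A f \<le> 1"
    using f by (auto intro!: integral_nonneg measure_pmf.integral_le_const int)
  have "(f x - expect A f)\<^sup>2 \<le> 1" for x
    using f[of x] mu by (intro power_le_one_iff[THEN iffD2] abs_square_le_1[THEN iffD2]) auto
  then have "expect A (\<lambda>x. (f x - expect A f)\<^sup>2) \<le> 1"
    by (auto intro!: measure_pmf.integral_le_const int)
  moreover have "expect A (\<lambda>x. f x - expect A f) = 0"
    by (subst Bochner_Integration.integral_diff) (auto intro: int)
  ultimately show ?case by simp
next
  case (Suc l)
  let ?p = "pow_dist l A" and ?g = "\<lambda>x. leaf_avg f l x - expect A f"
  have fp: "finite (set_pmf ?p)" by (rule finite_pow_dist[OF fin])
  have int: "integrable ?p h" for h :: "'a list \<Rightarrow> real" using fp by (rule integrable_measure_pmf_finite)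
  have g: "leaf_avg f (Suc l) (interleave x y) - expect A f = (?g x + ?g y) / 2"
    if "x \<in> set_pmf ?p" "y \<in> set_pmf ?p" for x y
  proof -
    have "length x = 2 ^ l * m" "length y = 2 ^ l * m" using that subsetD[OF set_pow_dist[OF len, of l]] by blast+
    then have "length x = length y" by simp
    then show ?thesis by (simp add: evens_interleave odds_interleave field_simps)
  qed
  have E: "expect (pow_dist (Suc l) A) (\<lambda>z. h (leaf_avg f (Suc l) z - expect A f))
      = expect ?p (\<lambda>x. expect ?p (\<lambda>y. h ((?g x + ?g y) / 2)))" for h :: "real \<Rightarrow> real"
  proof -
    have "expect (pow_dist (Suc l) A) (\<lambda>z. h (leaf_avg f (Suc l) z - expect A f))
      = expect (pair_pmf ?p ?p) (\<lambda>z. h (leaf_avg f (Suc l) (interleave (fst z) (snd z)) - expect A f))"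
      by (simp add: case_prod_unfold)
    also have "\<dots> = expect (pair_pmf ?p ?p) (\<lambda>z. h ((?g (fst z) + ?g (snd z)) / 2))"
      by (rule integral_cong_AE) (auto simp: AE_measure_pmf_iff g simp del: leaf_avg.simps)
    also have "\<dots> = expect ?p (\<lambda>x. expect ?p (\<lambda>y. h ((?g x + ?g y) / 2)))"
      by (subst expect_pair[OF fp fp]) simp
    finally show ?thesis .
  qed
  have IH: "expect ?p ?g = 0" "expect ?p (\<lambda>x. (?g x)\<^sup>2) \<le> (1 / 2) ^ l" using Suc by auto
  have add: "expect ?p (\<lambda>x. u x + v x) = expect ?p u + expect ?p v" for u v :: "'a list \<Rightarrow> real"
    by (rule Bochner_Integration.integral_add[OF int int])
  have "expect ?p (\<lambda>x. expect ?p (\<lambda>y. (?g x + ?g y) / 2)) = (expect ?p ?g + expect ?p ?g) / 2"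
    by (simp only: add add_divide_distrib integral_divide_zero) simp
  then have mean: "expect (pow_dist (Suc l) A) (\<lambda>z. leaf_avg f (Suc l) z - expect A f) = 0"
    using E[of id] IH by simp
  \<comment> \<open>The terms are grouped so that the cross term is linear in the inner variable,
    where it vanishes because the deviation has mean zero.\<close>
  have sq: "((u + v) / 2)\<^sup>2 = u\<^sup>2 / 4 + (u / 2 * v + v\<^sup>2 / 4)" for u v :: real
    by (simp add: power2_eq_square field_simps)
  have inner: "expect ?p (\<lambda>y. ((?g x + ?g y) / 2)\<^sup>2) = (?g x)\<^sup>2 / 4 + expect ?p (\<lambda>y. (?g y)\<^sup>2) / 4" for x
    unfolding sq by (simp only: add integral_mult_right_zero integral_divide_zero IH) simp
  have "expect ?p (\<lambda>x. expect ?p (\<lambda>y. ((?g x + ?g y) / 2)\<^sup>2)) = expect ?p (\<lambda>y. (?g y)\<^sup>2) / 2"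
    unfolding inner by (simp only: add integral_divide_zero) simp
  then have "expect (pow_dist (Suc l) A) (\<lambda>z. (leaf_avg f (Suc l) z - expect A f)\<^sup>2) \<le> (1 / 2) ^ Suc l"
    using E[of "\<lambda>x. x\<^sup>2"] IH(2) by simp
  with mean show ?case by blast
qed

text \<open>Outside \<open>G\<close> the deviation is at most \<open>1\<close>, which costs the
  first term. On \<open>G\<close> the second moment under \<open>Q\<close> is at most
  \<open>K\<close> times that under the product distribution, hence at most
  \<open>K * (1 / 2) ^ l\<close>.\<close>

lemma marginal_close:
  fixes A Q :: "'a list pmf"
  assumes fin: "finite (set_pmf A)" "finite (set_pmf Q)" and len: "set_pmf A \<subseteq> {x. length x = m}"
    and f: "\<And>x. 0 \<le> f x \<and> f x \<le> 1"
    and G: "\<And>x. x \<in> G \<Longrightarrow> pmf Q x \<le> K * pmf (pow_dist l A) x" and K: "0 \<le> K" and e: "0 < \<epsilon>"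
  shows "\<bar>expect Q (leaf_avg f l) - expect A f\<bar> \<le> (1 - measure_pmf.prob Q G) + \<epsilon> + K * (1 / 2) ^ l / \<epsilon>"
proof -
  let ?P = "pow_dist l A" and ?d = "\<lambda>x. leaf_avg f l x - expect A f"
  have fP: "finite (set_pmf ?P)" by (rule finite_pow_dist[OF fin(1)])
  have int: "integrable Q h" for h :: "'a list \<Rightarrow> real" using fin(2) by (rule integrable_measure_pmf_finite)
  have intA: "integrable A h" for h :: "'a list \<Rightarrow> real" using fin(1) by (rule integrable_measure_pmf_finite)
  have mu: "0 \<le> expect A f" "expect A f \<le> 1"
    using f by (auto intro!: integral_nonneg measure_pmf.integral_le_const intA)
  have d1: "\<bar>?d x\<bar> \<le> 1" for x using leaf_avg_bounds[of f l x, OF f] mu by auto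
  \<comment> \<open>A pointwise form of Chebyshev's inequality that needs no tail event: a deviation
    above \<open>\<epsilon>\<close> is at most its square divided by
    \<open>\<epsilon>\<close>.\<close>
  have d2: "\<bar>?d x\<bar> \<le> \<epsilon> + (?d x)\<^sup>2 / \<epsilon>" for x
  proof (cases "\<bar>?d x\<bar> \<le> \<epsilon>")
    case True
    then show ?thesis using e by (simp add: add_increasing2)
  next
    case False
    then have "\<bar>?d x\<bar> * \<epsilon> \<le> \<bar>?d x\<bar> * \<bar>?d x\<bar>" by (intro mult_left_mono) auto
    then have "\<bar>?d x\<bar> \<le> (?d x)\<^sup>2 / \<epsilon>" using e by (simp add: field_simps power2_eq_square abs_mult[symmetric])
    then show ?thesis using e by simp
  qed
  have "\<bar>expect Q (leaf_avg f l) - expect A f\<bar> = \<bar>expect Q ?d\<bar>"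
    by (subst Bochner_Integration.integral_diff) (auto intro: int)
  also have "\<dots> \<le> expect Q (\<lambda>x. \<bar>?d x\<bar>)" by (rule integral_abs_bound)
  also have "\<dots> \<le> expect Q (\<lambda>x. indicator (- G) x + (\<epsilon> + indicator G x * (?d x)\<^sup>2 / \<epsilon>))"
  proof (rule integral_mono[OF int int])
    fix x
    show "\<bar>?d x\<bar> \<le> indicator (- G) x + (\<epsilon> + indicator G x * (?d x)\<^sup>2 / \<epsilon>)"
      using d1[of x] d2[of x] e by (cases "x \<in> G") (auto simp: indicator_def)
  qed
  also have "\<dots> = measure_pmf.prob Q (- G) + (\<epsilon> + expect Q (\<lambda>x. indicator G x * (?d x)\<^sup>2) / \<epsilon>)"
    by (simp add: Bochner_Integration.integral_add[OF int int])
  also have "measure_pmf.prob Q (- G) = 1 - measure_pmf.prob Q G"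
    using measure_pmf.prob_compl[of G Q] by (simp add: Compl_eq_Diff_UNIV)
  also have "expect Q (\<lambda>x. indicator G x * (?d x)\<^sup>2) \<le> K * expect ?P (\<lambda>x. (?d x)\<^sup>2)"
  proof -
    let ?F = "set_pmf Q \<union> set_pmf ?P"
    have "expect Q (\<lambda>x. indicator G x * (?d x)\<^sup>2) = (\<Sum>x\<in>?F. indicator G x * (?d x)\<^sup>2 * pmf Q x)"
      by (rule integral_measure_pmf_real) (use fin fP in auto)
    also have "\<dots> \<le> (\<Sum>x\<in>?F. K * ((?d x)\<^sup>2 * pmf ?P x))"
    proof (rule sum_mono)
      fix x
      show "indicator G x * (?d x)\<^sup>2 * pmf Q x \<le> K * ((?d x)\<^sup>2 * pmf ?P x)"
      proof (cases "x \<in> G")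
        case True
        then have "(?d x)\<^sup>2 * pmf Q x \<le> (?d x)\<^sup>2 * (K * pmf ?P x)" by (intro mult_left_mono G) auto
        then show ?thesis using True by (simp add: mult_ac)
      qed (use K in simp)
    qed
    also have "\<dots> = K * expect ?P (\<lambda>x. (?d x)\<^sup>2)"
      unfolding sum_distrib_left[symmetric]
      by (subst integral_measure_pmf_real[of ?F]) (use fin fP in auto)
    finally show ?thesis .
  qed
  also have "K * expect ?P (\<lambda>x. (?d x)\<^sup>2) \<le> K * (1 / 2) ^ l"
    using pow_dist_moments[OF fin(1) len f, of l] K by (intro mult_left_mono) auto
  finally show ?thesis using e by (simp add: divide_right_mono add.assoc)
qed

section \<open>Uniform bits, the likelihood test and statistical distance\<close>

definition unif :: "nat \<Rightarrow> bool list pmf" where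
  "unif n = pmf_of_set {r. length r = n}"

lemma bit_lists: "finite {r :: bool list. length r = n}" "{r :: bool list. length r = n} \<noteq> {}"
  using finite_bit_lists Ex_list_of_length by auto

lemma card_bit_lists: "card {r :: bool list. length r = n} = 2 ^ n"
  using card_lists_length_eq[of "UNIV :: bool set" n] by simp

lemma set_unif: "set_pmf (unif n) = {r. length r = n}"
  unfolding unif_def by (rule set_pmf_of_set[OF bit_lists(2,1)])

lemma finite_unif: "finite (set_pmf (unif n))"
  unfolding set_unif by (rule bit_lists)

lemma pmf_unif: "pmf (unif n) r = (if length r = n then 1 / 2 ^ n else 0)"
  unfolding unif_def using bit_lists[of n] by (simp add: pmf_of_set card_bit_lists)

lemma unif_split: "map_pmf (\<lambda>r. (take a r, drop a r)) (unif (a + b)) = pair_pmf (unif a) (unif b)"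
proof (rule pmf_eqI)
  fix z :: "bool list \<times> bool list"
  obtain u v where z: "z = (u, v)" by (cases z)
  have "pmf (map_pmf (\<lambda>r. (take a r, drop a r)) (unif (a + b))) z
    = measure_pmf.prob (unif (a + b)) ((\<lambda>r. (take a r, drop a r)) -` {z})" by (simp add: pmf_map)
  also have "\<dots> = measure_pmf.prob (unif (a + b)) (if length u = a \<and> length v = b then {u @ v} else {})"
  proof (rule measure_pmf.finite_measure_eq_AE)
    show "AE r in measure_pmf (unif (a + b)). (r \<in> (\<lambda>r. (take a r, drop a r)) -` {z})
        = (r \<in> (if length u = a \<and> length v = b then {u @ v} else {}))"
      unfolding AE_measure_pmf_iff set_unif z
    proof
      fix r :: "bool list" assume "r \<in> {r. length r = a + b}"
      then have r: "length (take a r) = a" "length (drop a r) = b" by auto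
      show "(r \<in> (\<lambda>r. (take a r, drop a r)) -` {(u, v)}) = (r \<in> (if length u = a \<and> length v = b then {u @ v} else {}))"
      proof (cases "length u = a \<and> length v = b")
        case True
        then show ?thesis by (auto simp: append_eq_conv_conj) (metis append_take_drop_id)
      next
        case False
        then have "(take a r, drop a r) \<noteq> (u, v)" using r by blast
        then show ?thesis using False by auto
      qed
    qed
  qed auto
  also have "\<dots> = pmf (pair_pmf (unif a) (unif b)) z"
    by (simp add: z pmf_pair pmf_unif measure_pmf_single power_add)
  finally show "pmf (map_pmf (\<lambda>r. (take a r, drop a r)) (unif (a + b))) z = pmf (pair_pmf (unif a) (unif b)) z" .
qed

lemma unif_take: "map_pmf (take a) (unif (a + b)) = unif a"
proof -
  have "map_pmf (take a) (unif (a + b)) = map_pmf fst (map_pmf (\<lambda>r. (take a r, drop a r)) (unif (a + b)))"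
    by (simp add: map_pmf_comp)
  then show ?thesis unfolding unif_split map_fst_pair_pmf .
qed

text \<open>The random bits of the simulated machine and the selecting coins are independent, and
  the unread rest of the random tape does not influence them.\<close>

lemma unif_two_blocks:
  assumes "a + b \<le> c"
  shows "map_pmf (\<lambda>r. (take a r, take b (drop a r))) (unif c) = pair_pmf (unif a) (unif b)"
proof -
  obtain d where c: "c = a + (b + d)" using assms le_Suc_ex by (metis add.assoc)
  have "map_pmf (\<lambda>r. (take a r, take b (drop a r))) (unif c)
    = map_pmf (\<lambda>(u, v). (id u, take b v)) (map_pmf (\<lambda>r. (take a r, drop a r)) (unif c))"
    by (simp add: map_pmf_comp)
  also have "\<dots> = pair_pmf (map_pmf id (unif a)) (map_pmf (take b) (unif (b + d)))"
    unfolding c unif_split map_pair ..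
  finally show ?thesis by (simp add: unif_take)
qed

text \<open>The first coin decides between \<open>odds\<close> and \<open>evens\<close>, each with
  probability one half, which is one unfolding of \<open>leaf_avg\<close>.\<close>

lemma expect_extract_leaf: "expect (unif l) (\<lambda>bs. f (extract_leaf bs xs)) = leaf_avg f l xs"
proof (induction l arbitrary: xs)
  case 0
  have "unif 0 = return_pmf []" unfolding unif_def by (simp add: pmf_of_set_singleton)
  then show ?case by simp
next
  case (Suc l)
  let ?L = "{r :: bool list. length r = l}"
  have set: "{r :: bool list. length r = Suc l} = Cons True ` ?L \<union> Cons False ` ?L"
    by (auto simp: length_Suc_conv)
  have E: "expect (unif k) h = (\<Sum>r | length r = k. h r) / 2 ^ k" for k and h :: "bool list \<Rightarrow> real"
    unfolding expect_finite[OF finite_unif] set_unif by (simp add: pmf_unif sum_divide_distrib)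
  have "(\<Sum>r | length r = Suc l. f (extract_leaf r xs))
      = (\<Sum>r\<in>Cons True ` ?L. f (extract_leaf r xs)) + (\<Sum>r\<in>Cons False ` ?L. f (extract_leaf r xs))"
    unfolding set by (rule sum.union_disjoint) (auto simp: bit_lists)
  also have "\<dots> = (\<Sum>r\<in>?L. f (extract_leaf r (odds xs))) + (\<Sum>r\<in>?L. f (extract_leaf r (evens xs)))"
    by (simp add: sum.reindex)
  finally show ?case using Suc[of "odds xs"] Suc[of "evens xs"] unfolding E by (simp add: field_simps)
qed

text \<open>Where \<open>Q i\<close> exceeds \<open>K * P\<close>, the mass of \<open>P\<close> is
  less than a fraction \<open>1 / K\<close> of the mass of \<open>Q i\<close>, so test
  \<open>i\<close> fails with probability at most \<open>1 / K\<close>; a union bound over the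
  \<open>n\<close> tests follows.\<close>

lemma likelihood_test_complete:
  fixes P :: "'a pmf"
  assumes fin: "finite (set_pmf P)" and K: "0 < K"
  shows "1 - real n / K \<le> measure_pmf.prob P {x. \<forall>i<n. pmf (Q i) x \<le> K * pmf P x}"
proof -
  let ?B = "\<lambda>i. {x. K * pmf P x < pmf (Q i) x}"
  have bad: "measure_pmf.prob P (?B i) \<le> 1 / K" for i
  proof -
    have f: "finite (?B i \<inter> set_pmf P)" using fin by simp
    have "measure_pmf.prob P (?B i) = (\<Sum>x\<in>?B i \<inter> set_pmf P. pmf P x)"
      using measure_Int_set_pmf[of P "?B i"] measure_measure_pmf_finite[OF f, of P] by simp
    also have "\<dots> \<le> (\<Sum>x\<in>?B i \<inter> set_pmf P. pmf (Q i) x / K)"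
      using K by (intro sum_mono) (auto simp: field_simps)
    also have "\<dots> = measure_pmf.prob (Q i) (?B i \<inter> set_pmf P) / K"
      using measure_measure_pmf_finite[OF f, of "Q i"] by (simp add: sum_divide_distrib)
    also have "\<dots> \<le> 1 / K" using K by (intro divide_right_mono) auto
    finally show ?thesis .
  qed
  let ?G = "{x. \<forall>i<n. pmf (Q i) x \<le> K * pmf P x}"
  have "measure_pmf.prob P (- ?G) \<le> measure_pmf.prob P (\<Union>i<n. ?B i)"
    by (rule measure_pmf.finite_measure_mono) (auto simp: not_le)
  also have "\<dots> \<le> (\<Sum>i<n. measure_pmf.prob P (?B i))"
    by (rule measure_pmf.finite_measure_subadditive_finite) auto
  also have "\<dots> \<le> (\<Sum>i<n. 1 / K)" by (rule sum_mono) (rule bad)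
  finally have "measure_pmf.prob P (- ?G) \<le> real n / K" by simp
  then show ?thesis using measure_pmf.prob_compl[of ?G P] by (simp add: Compl_eq_Diff_UNIV)
qed

lemma prob_diff_le_stat_dist: "\<bar>measure_pmf.prob p A - measure_pmf.prob q A\<bar> \<le> stat_dist p q"
  unfolding stat_dist_def
proof (rule cSUP_upper)
  show "bdd_above (range (\<lambda>A. \<bar>measure_pmf.prob p A - measure_pmf.prob q A\<bar>))"
  proof (rule bdd_aboveI2)
    fix A
    have "0 \<le> measure_pmf.prob p A" "measure_pmf.prob p A \<le> 1" "0 \<le> measure_pmf.prob q A" "measure_pmf.prob q A \<le> 1"
      by auto
    then show "\<bar>measure_pmf.prob p A - measure_pmf.prob q A\<bar> \<le> 1" by linarith
  qed
qed simp

text \<open>\<open>stat_dist\<close> ranges over events, whereas a verifier is randomized. No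
  randomized test beats the best event, the set where \<open>p\<close> has the larger mass.\<close>

lemma expect_diff_le_stat_dist:
  fixes p q :: "'a pmf"
  assumes fin: "finite (set_pmf p)" "finite (set_pmf q)" and g: "\<And>x. 0 \<le> g x \<and> g x \<le> 1"
  shows "expect p g - expect q g \<le> stat_dist p q"
proof -
  let ?F = "set_pmf p \<union> set_pmf q"
  let ?S = "{x \<in> ?F. pmf q x < pmf p x}"
  have F: "finite ?F" "finite ?S" using fin by auto
  have E: "expect p g = (\<Sum>x\<in>?F. g x * pmf p x)" "expect q g = (\<Sum>x\<in>?F. g x * pmf q x)"
    by (rule integral_measure_pmf_real; use F in auto)+
  have "expect p g - expect q g = (\<Sum>x\<in>?F. g x * (pmf p x - pmf q x))"
    unfolding E by (simp add: sum_subtractf right_diff_distrib)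
  also have "\<dots> \<le> (\<Sum>x\<in>?F. if pmf q x < pmf p x then pmf p x - pmf q x else 0)"
  proof (rule sum_mono)
    fix x
    show "g x * (pmf p x - pmf q x) \<le> (if pmf q x < pmf p x then pmf p x - pmf q x else 0)"
      using g[of x] mult_left_le_one_le[of "pmf p x - pmf q x" "g x"]
        mult_nonneg_nonpos[of "g x" "pmf p x - pmf q x"] by auto
  qed
  also have "\<dots> = (\<Sum>x\<in>?S. pmf p x - pmf q x)" by (rule sum.inter_filter[symmetric, OF F(1)])
  also have "\<dots> = measure_pmf.prob p ?S - measure_pmf.prob q ?S"
    using measure_measure_pmf_finite[OF F(2), of p] measure_measure_pmf_finite[OF F(2), of q]
    by (simp add: sum_subtractf)
  also have "\<dots> \<le> stat_dist p q" using prob_diff_le_stat_dist[of p ?S q] by linarith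
  finally show ?thesis .
qed

section \<open>The equivalence\<close>

definition circuit_output :: "nat \<times> nat \<times> gate list \<Rightarrow> bool list pmf" where
  "circuit_output c = (case c of (n, m, gs) \<Rightarrow> circuit_dist n m gs)"

lemma qpt_dist_eq: "qpt_dist A n = circuit_output (decode_circuit (tm_exec (fst A) (time_bound (snd A) n) (unary_input n)))"
  by (simp add: qpt_dist_def circuit_output_def)

lemma circuit_output_iter_double:
  "circuit_output (decode_circuit ((double_bits ^^ l) bs)) = pow_dist l (circuit_output (decode_circuit bs))"
proof (induction l)
  case (Suc l)
  obtain n m gs where c: "decode_circuit ((double_bits ^^ l) bs) = (n, m, gs)" by (metis prod.exhaust)
  then show ?case using Suc circuit_dist_double[of n m gs]
    by (simp add: decode_double_bits double_circuit_def circuit_output_def)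
qed simp

lemma qpt_pow_dist: "\<exists>A'. \<forall>n > 0. qpt_dist A' n = pow_dist (rounds (time_bound a n)) (qpt_dist A n)"
proof -
  obtain M' k' where "\<forall>n > 0. tm_exec M' (time_bound k' n) (unary_input n)
     = (double_bits ^^ rounds (time_bound a n)) (tm_exec (fst A) (time_bound (snd A) n) (unary_input n))"
    using prover_machine by blast
  then show ?thesis by (intro exI[of _ "(M', k')"]) (simp add: qpt_dist_eq circuit_output_iter_double)
qed

lemma set_qpt_dist: "\<exists>m. set_pmf (qpt_dist A n) \<subseteq> {x. length x = m}"
  unfolding qpt_dist_eq circuit_output_def using set_circuit_dist by (auto split: prod.split) blast

lemma finite_qpt_dist: "finite (set_pmf (qpt_dist A n))"
  using set_qpt_dist[of A n] finite_bit_lists finite_subset by blast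

lemma ppt_dist_eq: "ppt_dist B n = map_pmf (\<lambda>r. tm_exec (fst B) (time_bound (snd B) n)
  (unary_input n @ [3] @ map enc_bit r)) (unif (time_bound (snd B) n))"
  by (simp add: ppt_dist_def unif_def Let_def)

lemma finite_ppt_dist: "finite (set_pmf (ppt_dist B n))"
  unfolding ppt_dist_eq using finite_unif by simp

text \<open>\<open>B'\<close> runs \<open>B\<close> and outputs a random one of the interleaved
  samples. It does not depend on \<open>f\<close>, so all test sets can be treated with the same
  adversary.\<close>

lemma ppt_random_leaf:
  "\<exists>B'. \<forall>n > 0. \<forall>f. expect (ppt_dist B' n) f = expect (ppt_dist B n) (leaf_avg f (rounds (time_bound a n)))"
proof -
  let ?M = "fst B" and ?k = "snd B"
  obtain M' k' where M': "\<And>n. n > 0 \<Longrightarrow> time_bound ?k n + rounds (time_bound a n) \<le> time_bound k' n"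
    "\<And>n r. n > 0 \<Longrightarrow> length r = time_bound k' n \<Longrightarrow>
       tm_exec M' (time_bound k' n) (unary_input n @ [3] @ map enc_bit r)
       = extract_leaf (take (rounds (time_bound a n)) (drop (time_bound ?k n) r))
         (tm_exec ?M (time_bound ?k n) (unary_input n @ [3] @ map enc_bit (take (time_bound ?k n) r)))"
    using sampler_machine[of ?k a ?M] by blast
  have "expect (ppt_dist (M', k') n) f = expect (ppt_dist B n) (leaf_avg f (rounds (time_bound a n)))"
    if n: "n > 0" for n f
  proof -
    let ?t = "time_bound ?k n" and ?l = "rounds (time_bound a n)"
    let ?F = "\<lambda>u. tm_exec ?M ?t (unary_input n @ [3] @ map enc_bit u)"
    have "ppt_dist (M', k') n = map_pmf (\<lambda>r. extract_leaf (take ?l (drop ?t r)) (?F (take ?t r))) (unif (time_bound k' n))"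
      unfolding ppt_dist_eq fst_conv snd_conv by (rule map_pmf_cong[OF refl]) (use M'(2)[OF n] set_unif in blast)
    also have "\<dots> = map_pmf (\<lambda>(u, b). extract_leaf b (?F u))
        (map_pmf (\<lambda>r. (take ?t r, take ?l (drop ?t r))) (unif (time_bound k' n)))"
      by (simp add: map_pmf_comp)
    also have "\<dots> = map_pmf (\<lambda>(u, b). extract_leaf b (?F u)) (pair_pmf (unif ?t) (unif ?l))"
      unfolding unif_two_blocks[OF M'(1)[OF n]] ..
    finally have "expect (ppt_dist (M', k') n) f = expect (pair_pmf (unif ?t) (unif ?l)) (\<lambda>z. f (extract_leaf (snd z) (?F (fst z))))"
      by (simp add: case_prod_unfold)
    also have "\<dots> = expect (unif ?t) (\<lambda>u. leaf_avg f ?l (?F u))"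
      by (subst expect_pair[OF finite_unif finite_unif]) (simp add: expect_extract_leaf)
    also have "\<dots> = expect (ppt_dist B n) (leaf_avg f ?l)"
      unfolding ppt_dist_eq by simp
    finally show ?thesis .
  qed
  then show ?thesis by blast
qed

lemma acc_prob_eq: "acc_prob V D n = expect (D n) (\<lambda>x. pmf (V n x) True)"
  unfolding acc_prob_def by (rule pmf_bind)

lemma acc_prob_deterministic: "acc_prob (\<lambda>n x. return_pmf (x \<in> G n)) D n = measure_pmf.prob (D n) (G n)"
proof -
  have "(\<lambda>x. pmf (return_pmf (x \<in> G n)) True) = indicator (G n)" by (auto simp: indicator_def fun_eq_iff)
  then show ?thesis unfolding acc_prob_eq by simp
qed

lemma poly_le_power:
  fixes P :: "real poly"
  shows "\<exists>k. \<forall>n :: nat. \<bar>poly P (real n)\<bar> \<le> real ((n + 2) ^ k)"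
proof (induction P)
  case 0
  show ?case by simp
next
  case (pCons c P)
  then obtain k where k: "\<And>n :: nat. \<bar>poly P (real n)\<bar> \<le> real ((n + 2) ^ k)" by blast
  obtain j where "\<bar>c\<bar> \<le> real j" using real_arch_simple by blast
  then have j: "\<bar>c\<bar> \<le> real ((n + 2) ^ j)" for n
    using less_exp[of j] power_mono[of 2 "n + 2" j] by (metis le_add2 less_imp_le_nat of_nat_mono order_trans zero_le)
  have "\<bar>poly (pCons c P) (real n)\<bar> \<le> real ((n + 2) ^ (j + k + 2))" for n
  proof -
    have "\<bar>poly (pCons c P) (real n)\<bar> \<le> \<bar>c\<bar> + real n * \<bar>poly P (real n)\<bar>"
      using abs_triangle_ineq[of c "real n * poly P (real n)"] by (simp add: abs_mult)
    also have "\<dots> \<le> real ((n + 2) ^ j) + real n * real ((n + 2) ^ k)"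
      by (intro add_mono mult_left_mono j k) auto
    also have "\<dots> = real ((n + 2) ^ j + n * (n + 2) ^ k)" by simp
    also have "(n + 2) ^ j + n * (n + 2) ^ k \<le> (n + 2) ^ (j + k + 1) + (n + 2) ^ (j + k + 1)"
    proof (rule add_mono)
      show "(n + 2) ^ j \<le> (n + 2) ^ (j + k + 1)" by (rule power_increasing) auto
      have "n * (n + 2) ^ k \<le> (n + 2) ^ (k + 1)" by simp
      also have "\<dots> \<le> (n + 2) ^ (j + k + 1)" by (rule power_increasing) auto
      finally show "n * (n + 2) ^ k \<le> (n + 2) ^ (j + k + 1)" .
    qed
    also have "\<dots> \<le> (n + 2) ^ (j + k + 2)" by simp
    finally show ?thesis by simp
  qed
  then show ?case by blast
qed

lemma poly_le_time_bound:
  fixes P :: "real poly"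
  shows "\<exists>a. \<forall>n. poly P (real n) \<le> real (time_bound a n)"
proof -
  obtain k where k: "\<And>n :: nat. \<bar>poly P (real n)\<bar> \<le> real ((n + 2) ^ k)" using poly_le_power by blast
  have "poly_bounded (\<lambda>n. (n + 2) ^ k)" by (intro poly_bounded_intros)
  then obtain a where "\<And>n. (n + 2) ^ k \<le> time_bound a n" using poly_bounded_le_time_bound by blast
  then have "real ((n + 2) ^ k) \<le> real (time_bound a n)" for n by (simp only: of_nat_le_iff)
  then show ?thesis using k by (meson abs_le_D1 order_trans)
qed

lemma QAS_imp_IVPoQ:
  assumes "is_QAS A"
  shows "\<exists>P V. is_NI_IVPoQ P V"
proof -
  obtain p where p: "pos_poly p"
    and qas: "\<And>B. \<forall>\<^sub>F n in sequentially. stat_dist (qpt_dist A n) (ppt_dist B n) > 1 / p n"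
    using assms unfolding is_QAS_def by blast
  obtain R where R: "\<And>n. p n = poly R (real n)" and pos: "\<And>n. 0 < p n"
    using p unfolding pos_poly_def by blast
  \<comment> \<open>The polynomial is \<open>64 * (n + 1) * p^3\<close>, that is
    \<open>16 * K * p^2\<close> for the \<open>K\<close> below; \<open>2 ^ l\<close> will exceed
    it.\<close>
  obtain a where a: "\<And>n. poly ([:64, 64:] * R ^ 3) (real n) \<le> real (time_bound a n)"
    using poly_le_time_bound by blast
  define l where "l n = rounds (time_bound a n)" for n
  \<comment> \<open>Chosen for \<open>n / K \<le> 1 / (4 * p)\<close>, the completeness error;
    \<open>n + 1\<close> instead of \<open>n\<close> keeps \<open>K\<close> positive at
    \<open>n = 0\<close>.\<close>
  define K where "K n = 4 * (real n + 1) * p n" for n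
  have K: "0 < K n" for n using pos[of n] by (simp add: K_def)
  have large: "16 * K n * (p n)\<^sup>2 \<le> 2 ^ l n" for n
  proof -
    have "16 * K n * (p n)\<^sup>2 = poly ([:64, 64:] * R ^ 3) (real n)"
      by (simp add: K_def R power2_eq_square power3_eq_cube algebra_simps)
    also have "\<dots> \<le> real (time_bound a n)" by (rule a)
    also have "\<dots> \<le> real (2 ^ l n)" using less_power_rounds[of "time_bound a n"] unfolding l_def of_nat_le_iff by simp
    finally show ?thesis by simp
  qed
  obtain P where P: "\<And>n. n > 0 \<Longrightarrow> qpt_dist P n = pow_dist (l n) (qpt_dist A n)"
    using qpt_pow_dist[of a A] unfolding l_def by blast
  \<comment> \<open>\<open>from_nat\<close> enumerates all pairs of a machine and a time exponent.
    The set need not be decidable in any efficient way, since the verifier is unbounded.\<close>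
  define G where "G n = {x. \<forall>i<n. pmf (ppt_dist (from_nat i) n) x \<le> K n * pmf (qpt_dist P n) x}" for n
  define V where "V = (\<lambda>n x. return_pmf (x \<in> G n))"
  have complete: "1 - 1 / (4 * p n) \<le> acc_prob V (qpt_dist P) n" for n
  proof -
    have "real n / K n \<le> (real n + 1) / K n" using K[of n] by (intro divide_right_mono) auto
    also have "\<dots> = 1 / (4 * p n)" using K[of n] pos[of n] by (simp add: frac_eq_eq) (simp add: K_def algebra_simps)
    finally have "real n / K n \<le> 1 / (4 * p n)" .
    moreover have "1 - real n / K n \<le> measure_pmf.prob (qpt_dist P n) (G n)"
      unfolding G_def by (rule likelihood_test_complete[OF finite_qpt_dist K])
    ultimately show ?thesis unfolding V_def acc_prob_deterministic by linarith
  qed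
  have sound: "\<forall>\<^sub>F n in sequentially. acc_prob V (ppt_dist B) n \<le> 1 - 1 / (2 * p n)" for B :: alg
  proof -
    obtain B' where B': "\<And>n f. n > 0 \<Longrightarrow> expect (ppt_dist B' n) f = expect (ppt_dist B n) (leaf_avg f (l n))"
      using ppt_random_leaf[of B a] unfolding l_def by blast
    \<comment> \<open>From \<open>n > to_nat B\<close> on, \<open>B\<close> is among the tested
      algorithms; this also gives \<open>n > 0\<close>.\<close>
    show ?thesis using qas[of B'] eventually_gt_at_top[of "to_nat B"]
    proof eventually_elim
      case (elim n)
      then have n: "n > 0" by simp
      show ?case
      proof (rule ccontr)
        assume "\<not> ?thesis"
        then have acc: "1 - measure_pmf.prob (ppt_dist B n) (G n) < 1 / (2 * p n)"
          unfolding V_def acc_prob_deterministic by simp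
        obtain m where m: "set_pmf (qpt_dist A n) \<subseteq> {x. length x = m}" using set_qpt_dist by blast
        have G: "pmf (ppt_dist B n) x \<le> K n * pmf (pow_dist (l n) (qpt_dist A n)) x" if "x \<in> G n" for x
        proof -
          have "pmf (ppt_dist (from_nat (to_nat B)) n) x \<le> K n * pmf (qpt_dist P n) x"
            using that elim(2) unfolding G_def by blast
          then show ?thesis using P[OF n] by simp
        qed
        \<comment> \<open>This is the last error term of \<open>marginal_close\<close> for
          \<open>\<epsilon> = 1 / (4 * p)\<close>; it is where \<open>2 ^ l\<close> must reach
          \<open>16 * K * p^2\<close>.\<close>
        have small: "K n * (1 / 2) ^ l n / (1 / (4 * p n)) \<le> 1 / (4 * p n)"
        proof -
          have "16 * K n * (p n)\<^sup>2 * (1 / 2) ^ l n \<le> 2 ^ l n * (1 / 2) ^ l n"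
            by (intro mult_right_mono large) simp
          then have "16 * K n * (p n)\<^sup>2 * (1 / 2) ^ l n \<le> 1" by (simp add: power_mult_distrib[symmetric])
          then show ?thesis using pos[of n] by (simp add: field_simps power2_eq_square)
        qed
        have bound: "\<bar>expect (ppt_dist B n) (leaf_avg f (l n)) - expect (qpt_dist A n) f\<bar> \<le> 1 / p n"
          if f: "\<And>x. 0 \<le> f x \<and> f x \<le> 1" for f
        proof -
          have "\<bar>expect (ppt_dist B n) (leaf_avg f (l n)) - expect (qpt_dist A n) f\<bar>
              \<le> (1 - measure_pmf.prob (ppt_dist B n) (G n)) + 1 / (4 * p n) + K n * (1 / 2) ^ l n / (1 / (4 * p n))"
            by (rule marginal_close[OF finite_qpt_dist finite_ppt_dist m f G])
              (use K[of n] pos[of n] in auto)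
          \<comment> \<open>The error budget: rejection probability of the adversary, tolerated
            deviation \<open>\<epsilon>\<close>, and variance term.\<close>
          moreover have "1 / (2 * p n) + 1 / (4 * p n) + 1 / (4 * p n) = 1 / p n"
            using pos[of n] by (simp add: field_simps)
          ultimately show ?thesis using acc small by linarith
        qed
        have "stat_dist (qpt_dist A n) (ppt_dist B' n) \<le> 1 / p n"
          unfolding stat_dist_def
        proof (rule cSUP_least)
          fix T
          have "\<bar>expect (ppt_dist B n) (leaf_avg (indicator T) (l n)) - expect (qpt_dist A n) (indicator T)\<bar> \<le> 1 / p n"
            by (rule bound) (simp add: indicator_def)
          then show "\<bar>measure_pmf.prob (qpt_dist A n) T - measure_pmf.prob (ppt_dist B' n) T\<bar> \<le> 1 / p n"
            using B'[OF n, of "indicator T"] by (simp add: abs_minus_commute)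
        qed simp
        then show False using elim(1) by linarith
      qed
    qed
  qed
  have "pos_poly (\<lambda>n. 4 * p n)"
    unfolding pos_poly_def using R pos by (auto intro!: exI[of _ "smult 4 R"])
  moreover have "(1 - 1 / (4 * p n)) - (1 - 1 / (2 * p n)) \<ge> 1 / (4 * p n)" for n
    using pos[of n] by (simp add: field_simps)
  ultimately have "is_NI_IVPoQ P V"
    unfolding is_NI_IVPoQ_def using complete sound
    by (intro exI[of _ "\<lambda>n. 1 - 1 / (4 * p n)"] exI[of _ "\<lambda>n. 1 - 1 / (2 * p n)"] exI[of _ "\<lambda>n. 4 * p n"]) auto
  then show ?thesis by blast
qed

lemma IVPoQ_imp_QAS:
  assumes "is_NI_IVPoQ P V"
  shows "is_QAS P"
proof -
  obtain c s q where q: "pos_poly q" and gap: "\<And>n. c n - s n \<ge> 1 / q n"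
    and complete: "\<forall>\<^sub>F n in sequentially. acc_prob V (qpt_dist P) n \<ge> c n"
    and sound: "\<And>B. \<forall>\<^sub>F n in sequentially. acc_prob V (ppt_dist B) n \<le> s n"
    using assms unfolding is_NI_IVPoQ_def by blast
  obtain R where R: "\<And>n. q n = poly R (real n)" and pos: "\<And>n. 0 < q n"
    using q unfolding pos_poly_def by blast
  have "pos_poly (\<lambda>n. q n + 1)"
    unfolding pos_poly_def using R pos by (auto intro!: exI[of _ "R + 1"] add_pos_pos)
  moreover have "\<forall>\<^sub>F n in sequentially. stat_dist (qpt_dist P n) (ppt_dist B n) > 1 / (q n + 1)" for B
    using complete sound[of B]
  proof eventually_elim
    case (elim n)
    have "1 / (q n + 1) < 1 / q n" using pos[of n] by (simp add: field_simps)
    also have "\<dots> \<le> acc_prob V (qpt_dist P) n - acc_prob V (ppt_dist B) n" using gap[of n] elim by linarith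
    also have "\<dots> \<le> stat_dist (qpt_dist P n) (ppt_dist B n)"
      unfolding acc_prob_eq
      by (rule expect_diff_le_stat_dist[OF finite_qpt_dist finite_ppt_dist]) (simp add: pmf_le_1)
    finally show ?case .
  qed
  ultimately show ?thesis unfolding is_QAS_def by blast
qed

theorem theorem1p3:
  shows "(\<exists>A :: alg. is_QAS A) \<longleftrightarrow> (\<exists>(P :: alg) (V2 :: nat \<Rightarrow> bool list \<Rightarrow> bool pmf). is_NI_IVPoQ P V2)"
  using QAS_imp_IVPoQ IVPoQ_imp_QAS by blast

end
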